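(* Let $d\in\{2,3\}$, and let $\theta$ be the passive tracer advected by a solution $u$ of the Navier–Stokes equations, with source $g=g_{\kappa_0,\kappa_g}$ (notation as in the context). For a wavenumber $\kappa$ let $$\Theta_\kappa=\frac1{L^d}\Bigl[-(u^<\cdot\nabla\theta^<,\theta^>)+(u^>\cdot\nabla\theta^>,\theta^<)\Bigr]$$ be the flux of $\theta$ through $\kappa$, where $u^<=u_{\kappa_0,\kappa}$, $u^>=u_{\kappa,\infty}$, $\theta^<=\theta_{\kappa_0,\kappa}$, $\theta^>=\theta_{\kappa,\infty}$. Then $$1-\Bigl(\frac{\kappa}{\kappa_\theta}\Bigr)^2\le\frac{\langle\Theta_\kappa\rangle}{\chi}\le1\qquad\text{for }\ \kappa_g\le\kappa\le\kappa_\theta.$$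
   Context: Let $\Omega=[0,L]^d$ with periodic boundary conditions and $\kappa_0=2\pi/L$. The velocity $u$ satisfies the incompressible Navier–Stokes equations $\partial_t u-\nu\Delta u+(u\cdot\nabla)u+\nabla p=F$, $\nabla\cdot u=0$, $\int_\Omega u\,dx=0$, $\int_\Omega F\,dx=0$, $u(\cdot,t_0)=u_0$ (a Leray–Hopf weak solution when $d=3$). The tracer $\theta$ satisfies $\partial_t\theta-\mu\Delta\theta+u\cdot\nabla\theta=g$ with time-independent source $g=g(x)$, periodic boundary conditions, $\int_\Omega\theta\,dx=\int_\Omega g\,dx=0$. Here $\nu,\mu>0$. $(\cdot,\cdot)$ and $|\cdot|$ are the $L^2(\Omega)$ inner product and norm. For a function with Fourier series $\sum_{k\in\mathbb Z^d}\hat u_ke^{i\kappa_0k\cdot x}$, $u_{\kappa_1,\kappa_2}$ denotes the part of the series with wavenumbers $\kappa_1\le\kappa_0|k|<\kappa_2$ (similarly for $\theta$, $g$). The source is spectrally bounded: $g=g_{\kappa_0,\kappa_g}$ with $\kappa_0<\kappa_g<\infty$. Averages: $\langle\Phi\rangle=\mathrm{Lim}_{T\to\infty}\frac1T\int_0^T\Phi\,dt$, where $\mathrm{Lim}$ is a fixed Hahn–Banach extension of the classical limit; it is applied to functionals of $u(t)$ and of $\theta(t)$. Define $\chi=\frac{\mu}{L^d}\langle|\nabla\theta|^2\rangle$ and $\kappa_\theta^2=\langle|\nabla\theta|^2\rangle/\langle|\theta|^2\rangle$. *)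

theory Defs
  imports "HOL-Analysis.Analysis"
begin

section \<open>Functions on the periodic box\<close>

text \<open>
  A function on the torus is represented by its values on one period cell; periodicity enters
  through the test functions and the Fourier modes. The space dimension is \<open>CARD('n)\<close>.
\<close>

definition Omega :: "real \<Rightarrow> (real^'n) measure" where
  "Omega L = lebesgue_on (cbox 0 (\<chi> i. L))"

definition L2_field :: "real \<Rightarrow> (real^'n \<Rightarrow> 'b::euclidean_space) \<Rightarrow> bool" where
  "L2_field L f \<longleftrightarrow>
     f \<in> borel_measurable (Omega L) \<and> integrable (Omega L) (\<lambda>x. (norm (f x))\<^sup>2)"

definition l2_inner ::
    "real \<Rightarrow> (real^'n \<Rightarrow> 'b::euclidean_space) \<Rightarrow> (real^'n \<Rightarrow> 'b) \<Rightarrow> real" where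
  "l2_inner L f h = (LINT x|Omega L. f x \<bullet> h x)"

definition l2_norm :: "real \<Rightarrow> (real^'n \<Rightarrow> 'b::euclidean_space) \<Rightarrow> real" where
  "l2_norm L f = sqrt (LINT x|Omega L. (norm (f x))\<^sup>2)"

definition mean_zero :: "real \<Rightarrow> (real^'n \<Rightarrow> 'b::euclidean_space) \<Rightarrow> bool" where
  "mean_zero L f \<longleftrightarrow> (LINT x|Omega L. f x) = 0"

text \<open>Scalar test functions: continuously differentiable and \<open>L\<close>-periodic, with gradient \<open>D\<phi>\<close>.\<close>

definition periodic_C1 :: "real \<Rightarrow> (real^'n \<Rightarrow> real) \<Rightarrow> (real^'n \<Rightarrow> real^'n) \<Rightarrow> bool" where
  "periodic_C1 L \<phi> D\<phi> \<longleftrightarrow>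
     (\<forall>x i. \<phi> (x + L *\<^sub>R axis i 1) = \<phi> x) \<and>
     (\<forall>x. GDERIV \<phi> x :> D\<phi> x) \<and> continuous_on UNIV D\<phi>"

definition weak_gradient :: "real \<Rightarrow> (real^'n \<Rightarrow> real) \<Rightarrow> (real^'n \<Rightarrow> real^'n) \<Rightarrow> bool" where
  "weak_gradient L f G \<longleftrightarrow> L2_field L f \<and> L2_field L G \<and>
     (\<forall>\<phi> D\<phi>. periodic_C1 L \<phi> D\<phi> \<longrightarrow>
        (LINT x|Omega L. f x *\<^sub>R D\<phi> x) = - (LINT x|Omega L. \<phi> x *\<^sub>R G x))"

definition in_H1 :: "real \<Rightarrow> (real^'n \<Rightarrow> real) \<Rightarrow> bool" where
  "in_H1 L f \<longleftrightarrow> (\<exists>G. weak_gradient L f G)"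

text \<open>
  The weak gradient is determined up to a null set; \<open>grad\<close> picks a representative, and is only
  meaningful for \<open>f\<close> in \<open>H\<^sup>1\<close>.
\<close>

definition grad :: "real \<Rightarrow> (real^'n \<Rightarrow> real) \<Rightarrow> real^'n \<Rightarrow> real^'n" where
  "grad L f = (SOME G. weak_gradient L f G)"

definition jacobian :: "real \<Rightarrow> (real^'n \<Rightarrow> real^'n) \<Rightarrow> real^'n \<Rightarrow> real^'n^'n" where
  "jacobian L u x = (\<chi> i. grad L (\<lambda>y. u y $ i) x)"

definition div_free :: "real \<Rightarrow> (real^'n \<Rightarrow> real^'n) \<Rightarrow> bool" where
  "div_free L u \<longleftrightarrow> (\<forall>\<phi> D\<phi>. periodic_C1 L \<phi> D\<phi> \<longrightarrow> l2_inner L u D\<phi> = 0)"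


section \<open>Fourier series and spectral truncation\<close>

definition wave :: "real \<Rightarrow> int^'n \<Rightarrow> real^'n" where
  "wave L k = (2 * pi / L) *\<^sub>R (\<chi> i. real_of_int (k $ i))"

definition fourier_coeff :: "real \<Rightarrow> (real^'n \<Rightarrow> real) \<Rightarrow> int^'n \<Rightarrow> complex" where
  "fourier_coeff L f k =
     (1 / L ^ CARD('n)) *\<^sub>R (LINT x|Omega L. f x *\<^sub>R cis (- (wave L k \<bullet> x)))"

text \<open>
  The part of the series with wavenumbers \<open>\<kappa>1 \<le> \<kappa>0 |k| < \<kappa>2\<close>, for finite \<open>\<kappa>2\<close>. The sum is finite and
  real-valued (for \<open>L > 0\<close>), so taking the real part only changes the type.
\<close>

definition part :: "real \<Rightarrow> real \<Rightarrow> real \<Rightarrow> (real^'n \<Rightarrow> real) \<Rightarrow> real^'n \<Rightarrow> real" where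
  "part L \<kappa>1 \<kappa>2 f x =
     Re (\<Sum>k | \<kappa>1 \<le> norm (wave L k) \<and> norm (wave L k) < \<kappa>2.
           fourier_coeff L f k * cis (wave L k \<bullet> x))"

text \<open>The part with \<open>\<kappa> \<le> \<kappa>0 |k| < \<infinity>\<close>: what remains of \<open>f\<close> after removing all modes below \<open>\<kappa>\<close>.\<close>

definition part_from :: "real \<Rightarrow> real \<Rightarrow> (real^'n \<Rightarrow> real) \<Rightarrow> real^'n \<Rightarrow> real" where
  "part_from L \<kappa> f x = f x - part L 0 \<kappa> f x"

definition vpart :: "real \<Rightarrow> real \<Rightarrow> real \<Rightarrow> (real^'n \<Rightarrow> real^'n) \<Rightarrow> real^'n \<Rightarrow> real^'n" where
  "vpart L \<kappa>1 \<kappa>2 u x = (\<chi> i. part L \<kappa>1 \<kappa>2 (\<lambda>y. u y $ i) x)"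

definition vpart_from :: "real \<Rightarrow> real \<Rightarrow> (real^'n \<Rightarrow> real^'n) \<Rightarrow> real^'n \<Rightarrow> real^'n" where
  "vpart_from L \<kappa> u x = (\<chi> i. part_from L \<kappa> (\<lambda>y. u y $ i) x)"


section \<open>Weak solutions\<close>

text \<open>
  The class \<open>L\<^sup>\<infinity>(t0,T;L\<^sup>2) \<inter> L\<^sup>2(t0,T;H\<^sup>1)\<close> for all \<open>T\<close>. Weak continuity in time is not listed: it
  follows from the time-integrated weak formulations below, which hold for every \<open>t \<ge> t0\<close>.
\<close>

definition energy_class :: "real \<Rightarrow> real \<Rightarrow> (real \<Rightarrow> real^'n \<Rightarrow> real) \<Rightarrow> bool" where
  "energy_class L t0 f \<longleftrightarrow>
     (\<forall>t\<ge>t0. L2_field L (f t)) \<and>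
     (\<forall>T. \<exists>C. \<forall>t\<in>{t0..T}. l2_norm L (f t) \<le> C) \<and>
     (AE t in lebesgue_on {t0..}. in_H1 L (f t)) \<and>
     (\<forall>T. integrable (lebesgue_on {t0..T}) (\<lambda>t. (l2_norm L (grad L (f t)))\<^sup>2))"

text \<open>Forces in \<open>L\<^sup>2(t0,T;L\<^sup>2)\<close> for all \<open>T\<close>, with zero spatial mean.\<close>

definition admissible_force :: "real \<Rightarrow> real \<Rightarrow> (real \<Rightarrow> real^'n \<Rightarrow> real^'n) \<Rightarrow> bool" where
  "admissible_force L t0 F \<longleftrightarrow>
     (AE t in lebesgue_on {t0..}. L2_field L (F t) \<and> mean_zero L (F t)) \<and>
     (\<forall>h. L2_field L h \<longrightarrow> (\<lambda>t. l2_inner L (F t) h) \<in> borel_measurable (lebesgue_on {t0..})) \<and>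
     (\<forall>T. integrable (lebesgue_on {t0..T}) (\<lambda>t. (l2_norm L (F t))\<^sup>2))"

text \<open>
  Leray-Hopf weak solutions on \<open>[t0,\<infinity>)\<close>; the pressure is eliminated by divergence-free test fields
  \<open>v\<close>, with \<open>Dv i\<close> the gradient of the \<open>i\<close>-th component. In two dimensions the energy inequality is
  automatic and these are the usual weak solutions.
\<close>

definition leray_hopf_solution ::
    "real \<Rightarrow> real \<Rightarrow> real \<Rightarrow> (real \<Rightarrow> real^'n \<Rightarrow> real^'n) \<Rightarrow> (real^'n \<Rightarrow> real^'n) \<Rightarrow>
     (real \<Rightarrow> real^'n \<Rightarrow> real^'n) \<Rightarrow> bool" where
  "leray_hopf_solution L \<nu> t0 F u0 u \<longleftrightarrow>
     admissible_force L t0 F \<and>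
     (\<forall>i. energy_class L t0 (\<lambda>t x. u t x $ i)) \<and>
     (\<forall>t\<ge>t0. mean_zero L (u t) \<and> div_free L (u t)) \<and>
     (AE x in Omega L. u t0 x = u0 x) \<and>
     (\<forall>v Dv. (\<forall>i. periodic_C1 L (\<lambda>x. v x $ i) (Dv i)) \<and> (\<forall>x. (\<Sum>i\<in>UNIV. Dv i x $ i) = 0) \<longrightarrow>
        (let rhs = (\<lambda>s. l2_inner L (F s) v
                      - \<nu> * l2_inner L (jacobian L (u s)) (\<lambda>x. \<chi> i. Dv i x)
                      - l2_inner L (\<lambda>x. jacobian L (u s) x *v u s x) v)
         in \<forall>t\<ge>t0. integrable (lebesgue_on {t0..t}) rhs \<and>
              l2_inner L (u t) v = l2_inner L u0 v + (LINT s|lebesgue_on {t0..t}. rhs s))) \<and>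
     (\<forall>t\<ge>t0. (l2_norm L (u t))\<^sup>2 / 2
              + \<nu> * (LINT s|lebesgue_on {t0..t}. (l2_norm L (jacobian L (u s)))\<^sup>2)
            \<le> (l2_norm L u0)\<^sup>2 / 2 + (LINT s|lebesgue_on {t0..t}. l2_inner L (F s) (u s)))"

definition tracer_solution ::
    "real \<Rightarrow> real \<Rightarrow> real \<Rightarrow> (real \<Rightarrow> real^'n \<Rightarrow> real^'n) \<Rightarrow> (real^'n \<Rightarrow> real) \<Rightarrow>
     (real \<Rightarrow> real^'n \<Rightarrow> real) \<Rightarrow> bool" where
  "tracer_solution L \<mu> t0 u g \<theta> \<longleftrightarrow>
     energy_class L t0 \<theta> \<and>
     (\<forall>t\<ge>t0. mean_zero L (\<theta> t)) \<and>
     (\<forall>\<phi> D\<phi>. periodic_C1 L \<phi> D\<phi> \<longrightarrow>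
        (let rhs = (\<lambda>s. l2_inner L g \<phi>
                      - \<mu> * l2_inner L (grad L (\<theta> s)) D\<phi>
                      - l2_inner L (\<lambda>x. u s x \<bullet> grad L (\<theta> s) x) \<phi>)
         in \<forall>t\<ge>t0. integrable (lebesgue_on {t0..t}) rhs \<and>
              l2_inner L (\<theta> t) \<phi> = l2_inner L (\<theta> t0) \<phi> + (LINT s|lebesgue_on {t0..t}. rhs s)))"


section \<open>Generalised limits and averages\<close>

text \<open>
  A Hahn-Banach extension of the limit at infinity, dominated by the sublinear functional limsup.
  Its domain is the space of functions bounded near infinity rather than on all of \<open>(0,\<infinity>)\<close>, because
  the time means of locally integrable functions can be unbounded as \<open>T \<rightarrow> 0\<close>.
\<close>

definition hahn_banach_limit :: "((real \<Rightarrow> real) \<Rightarrow> real) \<Rightarrow> bool" where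
  "hahn_banach_limit Lm \<longleftrightarrow>
     (\<forall>f h. Bfun f at_top \<longrightarrow> Bfun h at_top \<longrightarrow> Lm (\<lambda>T. f T + h T) = Lm f + Lm h) \<and>
     (\<forall>c f. Bfun f at_top \<longrightarrow> Lm (\<lambda>T. c * f T) = c * Lm f) \<and>
     (\<forall>f l. (f \<longlongrightarrow> l) at_top \<longrightarrow> Lm f = l) \<and>
     (\<forall>f. Bfun f at_top \<longrightarrow> ereal (Lm f) \<le> Limsup at_top (\<lambda>T. ereal (f T)))"

definition time_avg :: "((real \<Rightarrow> real) \<Rightarrow> real) \<Rightarrow> (real \<Rightarrow> real) \<Rightarrow> real" where
  "time_avg Lm \<Phi> = Lm (\<lambda>T. 1 / T * (LINT t|lebesgue_on {0..T}. \<Phi> t))"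

definition tracer_chi ::
    "real \<Rightarrow> real \<Rightarrow> ((real \<Rightarrow> real) \<Rightarrow> real) \<Rightarrow> (real \<Rightarrow> real^'n \<Rightarrow> real) \<Rightarrow> real" where
  "tracer_chi L \<mu> Lm \<theta> =
     \<mu> / L ^ CARD('n) * time_avg Lm (\<lambda>t. (l2_norm L (grad L (\<theta> t)))\<^sup>2)"

definition tracer_wavenumber ::
    "real \<Rightarrow> ((real \<Rightarrow> real) \<Rightarrow> real) \<Rightarrow> (real \<Rightarrow> real^'n \<Rightarrow> real) \<Rightarrow> real" where
  "tracer_wavenumber L Lm \<theta> =
     sqrt (time_avg Lm (\<lambda>t. (l2_norm L (grad L (\<theta> t)))\<^sup>2) / time_avg Lm (\<lambda>t. (l2_norm L (\<theta> t))\<^sup>2))"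

definition tracer_flux ::
    "real \<Rightarrow> real \<Rightarrow> (real^'n \<Rightarrow> real^'n) \<Rightarrow> (real^'n \<Rightarrow> real) \<Rightarrow> real" where
  "tracer_flux L \<kappa> u \<theta> =
     (let \<kappa>0 = 2 * pi / L;
          ul = vpart L \<kappa>0 \<kappa> u; uh = vpart_from L \<kappa> u;
          \<theta>l = part L \<kappa>0 \<kappa> \<theta>; \<theta>h = part_from L \<kappa> \<theta>
      in 1 / L ^ CARD('n) *
         (- l2_inner L (\<lambda>x. ul x \<bullet> grad L \<theta>l x) \<theta>h + l2_inner L (\<lambda>x. uh x \<bullet> grad L \<theta>h x) \<theta>l))"

end

(*
  Testing the tracer equation with the trigonometric polynomial theta^< gives
  L^d <Theta> = <(g, theta)> - mu <|grad theta^<|^2>, because g only has modes below kappa and u is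
  divergence free. If the full energy balance <(g, theta)> = mu <|grad theta|^2> holds, then
  <Theta> / chi = 1 - <|grad theta^<|^2> / <|grad theta|^2>, and
  0 <= |grad theta^<|^2 <= kappa^2 |theta|^2 yields both bounds.

  The energy balance is an equality for every weak solution, also for d = 3, since u . grad theta is in
  L^1 for almost every time: let S_N be the Fejer mean of theta and test with the Fejer mean of
  M sin(S_N / M). Fejer means are symmetric, contract both L^2 and the sup norm, and commute with
  derivatives, so as N tends to infinity the transport term tends to
  (u . grad theta, M sin(theta / M)), which is the limit of (u, grad(-M^2 cos(S_N / M))) = 0. Letting M tend
  to infinity gives the equality. With the Poincare inequality it also bounds |theta(t)| uniformly in
  time, so that the boundary terms vanish in the averages.
*)

theory Submission
  imports Defs
begin

section \<open>Square-integrable functions on the box\<close>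

text \<open>The balance asks for \<theta> itself as a test function, which is neither smooth nor
  bounded, while u . grad \<theta> is controlled only in L1. Hence two parameters: N for smoothness,
  M for boundedness. Sharp Fourier truncation cannot replace the Fejer means, as it does not respect
  sup bounds; they do, since their kernel is nonnegative. The mean is applied twice: by symmetry the
  outer copy falls on \<theta>, so the test gives exactly the increment of the integral of the
  primitive M^2 (1 - cos(S_N / M)). The scaled sine is bounded, 1-Lipschitz and smooth, with
  derivative and primitive in closed form. The transport bound grows with M, so N goes first;
  afterwards that term is gone and the rest is dominated independently of M. For fixed N only
  finitely many Fourier coefficients enter, each an indefinite integral in time, so a chain rule for
  increments replaces differentiation in t. The L2 convergence of the Fejer means is itself proved
  here, from polynomial approximation in one variable and a Dynkin class argument.\<close>

lemma space_Omega: "space (Omega L) = cbox 0 (\<chi> i. L)"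
  by (simp add: Omega_def)

lemma finite_measure_Omega: "finite_measure (Omega L :: (real^'n) measure)"
  unfolding Omega_def by (intro finite_measure_lebesgue_on) (simp add: lmeasurable_cbox)

lemma measure_Omega:
  assumes "0 < L"
  shows "measure (Omega L :: (real^'n) measure) (space (Omega L)) = L ^ CARD('n)"
proof -
  have "measure (Omega L :: (real^'n) measure) (space (Omega L)) = measure lebesgue (cbox 0 (\<chi> i. L) :: (real^'n) set)"
    by (simp add: Omega_def measure_restrict_space)
  also have "\<dots> = L ^ CARD('n)"
    using assms by (subst measure_completion) (auto simp: content_cbox_cart interval_eq_empty_cart)
  finally show ?thesis .
qed

lemma borel_measurable_Omega_continuous:
  "continuous_on UNIV f \<Longrightarrow> f \<in> borel_measurable (Omega L)"
  unfolding Omega_def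
  by (intro continuous_imp_measurable_on_sets_lebesgue) (auto intro: continuous_on_subset)

lemma integrable_Omega_bounded:
  fixes f :: "real^'n \<Rightarrow> 'b::{banach,second_countable_topology}"
  assumes "f \<in> borel_measurable (Omega L)" "\<And>x. x \<in> cbox 0 (\<chi> i. L) \<Longrightarrow> norm (f x) \<le> B"
  shows "integrable (Omega L) f"
  by (rule finite_measure.integrable_const_bound[OF finite_measure_Omega AE_I2 assms(1)])
     (use assms(2) in \<open>simp add: space_Omega\<close>)

lemma integrable_Omega_const: "integrable (Omega L :: (real^'n) measure) (\<lambda>x. c :: real)"
  by (rule integrable_Omega_bounded[of _ _ "\<bar>c\<bar>"]) auto

lemma integrable_Omega_continuous:
  fixes f :: "real^'n \<Rightarrow> 'b::euclidean_space"
  assumes "continuous_on UNIV f"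
  shows "integrable (Omega L) f"
proof -
  have "compact (f ` cbox 0 (\<chi> i. L))"
    using assms by (intro compact_continuous_image compact_cbox) (auto intro: continuous_on_subset)
  then obtain B where "\<forall>y\<in>f ` cbox 0 (\<chi> i. L). norm y \<le> B"
    using compact_imp_bounded bounded_iff by metis
  then show ?thesis
    by (intro integrable_Omega_bounded[of _ _ B] borel_measurable_Omega_continuous assms) auto
qed

lemma L2_field_measurable: "L2_field L f \<Longrightarrow> f \<in> borel_measurable (Omega L)"
  by (simp add: L2_field_def)

lemma L2_field_square: "L2_field L f \<Longrightarrow> integrable (Omega L) (\<lambda>x. (norm (f x))\<^sup>2)"
  by (simp add: L2_field_def)

lemma L2_field_inner_integrable:
  fixes f h :: "real^'n \<Rightarrow> 'b::euclidean_space"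
  assumes "L2_field L f" "L2_field L h"
  shows "integrable (Omega L) (\<lambda>x. f x \<bullet> h x)"
proof (rule Bochner_Integration.integrable_bound)
  show "integrable (Omega L) (\<lambda>x. (norm (f x))\<^sup>2 + (norm (h x))\<^sup>2)"
    using assms by (intro Bochner_Integration.integrable_add L2_field_square)
  show "(\<lambda>x. f x \<bullet> h x) \<in> borel_measurable (Omega L)"
    using assms by (intro borel_measurable_inner L2_field_measurable)
  show "AE x in Omega L. norm (f x \<bullet> h x) \<le> norm ((norm (f x))\<^sup>2 + (norm (h x))\<^sup>2)"
  proof (rule AE_I2)
    fix x
    have "\<bar>f x \<bullet> h x\<bar> \<le> norm (f x) * norm (h x)" by (rule Cauchy_Schwarz_ineq2)
    also have "\<dots> \<le> (norm (f x))\<^sup>2 + (norm (h x))\<^sup>2"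
      using sum_squares_bound[of "norm (f x)" "norm (h x)"] mult_nonneg_nonneg[OF norm_ge_zero norm_ge_zero, of "f x" "h x"]
      by linarith
    finally show "norm (f x \<bullet> h x) \<le> norm ((norm (f x))\<^sup>2 + (norm (h x))\<^sup>2)" by simp
  qed
qed

lemma L2_field_mult_integrable:
  fixes f h :: "real^'n \<Rightarrow> real"
  shows "L2_field L f \<Longrightarrow> L2_field L h \<Longrightarrow> integrable (Omega L) (\<lambda>x. f x * h x)"
  using L2_field_inner_integrable[of L f h] by simp

lemma L2_field_bounded:
  fixes f :: "real^'n \<Rightarrow> 'b::euclidean_space"
  assumes "f \<in> borel_measurable (Omega L)" "\<And>x. x \<in> cbox 0 (\<chi> i. L) \<Longrightarrow> norm (f x) \<le> B"
  shows "L2_field L f"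
  unfolding L2_field_def
proof (intro conjI assms integrable_Omega_bounded[of _ _ "B\<^sup>2"])
  show "(\<lambda>x. (norm (f x))\<^sup>2) \<in> borel_measurable (Omega L)" using assms(1) by simp
  show "norm ((norm (f x))\<^sup>2) \<le> B\<^sup>2" if "x \<in> cbox 0 (\<chi> i. L)" for x
    using assms(2)[OF that] by (simp add: power_mono)
qed

lemma L2_field_continuous:
  fixes f :: "real^'n \<Rightarrow> 'b::euclidean_space"
  assumes "continuous_on UNIV f"
  shows "L2_field L f"
  unfolding L2_field_def
  by (intro conjI borel_measurable_Omega_continuous integrable_Omega_continuous continuous_intros assms)

lemma L2_field_integrable:
  fixes f :: "real^'n \<Rightarrow> 'b::euclidean_space"
  assumes "L2_field L f"
  shows "integrable (Omega L) f"
proof (rule Bochner_Integration.integrable_bound)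
  show "integrable (Omega L) (\<lambda>x. 1 + (norm (f x))\<^sup>2)"
    using assms by (intro Bochner_Integration.integrable_add integrable_Omega_const) (simp add: L2_field_def)
  show "f \<in> borel_measurable (Omega L)"
    using assms by (simp add: L2_field_def)
  show "AE x in Omega L. norm (f x) \<le> norm (1 + (norm (f x))\<^sup>2)"
  proof (rule AE_I2)
    fix x
    have "norm (f x) \<le> 1 + (norm (f x))\<^sup>2"
      using sum_squares_bound[of "norm (f x)" 1] norm_ge_zero[of "f x"] unfolding mult_1_right power_one by linarith
    then show "norm (f x) \<le> norm (1 + (norm (f x))\<^sup>2)" by simp
  qed
qed

lemma L2_field_dominated:
  fixes f :: "real^'n \<Rightarrow> 'b::euclidean_space" and h :: "real^'n \<Rightarrow> 'c::euclidean_space"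
  assumes "L2_field L f" "h \<in> borel_measurable (Omega L)" "\<And>x. norm (h x) \<le> B * norm (f x)"
  shows "L2_field L h"
  unfolding L2_field_def
proof (rule conjI[OF assms(2) Bochner_Integration.integrable_bound])
  show "integrable (Omega L) (\<lambda>x. B\<^sup>2 * (norm (f x))\<^sup>2)"
    using L2_field_square[OF assms(1)] by simp
  show "(\<lambda>x. (norm (h x))\<^sup>2) \<in> borel_measurable (Omega L)" using assms(2) by simp
  show "AE x in Omega L. norm ((norm (h x))\<^sup>2) \<le> norm (B\<^sup>2 * (norm (f x))\<^sup>2)"
  proof (rule AE_I2)
    fix x
    show "norm ((norm (h x))\<^sup>2) \<le> norm (B\<^sup>2 * (norm (f x))\<^sup>2)"
      using power_mono[OF assms(3)[of x] norm_ge_zero, of 2] by (simp add: power_mult_distrib)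
  qed
qed

lemma L2_field_scale:
  fixes f :: "real^'n \<Rightarrow> 'b::euclidean_space"
  assumes "L2_field L f"
  shows "L2_field L (\<lambda>x. c *\<^sub>R f x)"
  by (rule L2_field_dominated[OF assms, of _ "\<bar>c\<bar>"]) (use assms in \<open>auto simp: L2_field_def\<close>)

lemma L2_field_cmult:
  fixes f :: "real^'n \<Rightarrow> real"
  shows "L2_field L f \<Longrightarrow> L2_field L (\<lambda>x. c * f x)"
  using L2_field_scale[of L f c] by simp

lemma L2_field_minus:
  fixes f :: "real^'n \<Rightarrow> 'b::euclidean_space"
  shows "L2_field L f \<Longrightarrow> L2_field L (\<lambda>x. - f x)"
  using L2_field_scale[of L f "-1"] by simp

lemma L2_field_add:
  fixes f h :: "real^'n \<Rightarrow> 'b::euclidean_space"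
  assumes "L2_field L f" "L2_field L h"
  shows "L2_field L (\<lambda>x. f x + h x)"
  unfolding L2_field_def
proof
  show "(\<lambda>x. f x + h x) \<in> borel_measurable (Omega L)"
    using assms by (intro borel_measurable_add L2_field_measurable)
  have "(\<lambda>x. (norm (f x + h x))\<^sup>2) = (\<lambda>x. (norm (f x))\<^sup>2 + (norm (h x))\<^sup>2 + 2 * (f x \<bullet> h x))"
    by (auto simp: power2_norm_eq_inner inner_add inner_commute)
  then show "integrable (Omega L) (\<lambda>x. (norm (f x + h x))\<^sup>2)"
    using assms L2_field_inner_integrable[OF assms] by (simp add: L2_field_def)
qed

lemma L2_field_diff:
  fixes f h :: "real^'n \<Rightarrow> 'b::euclidean_space"
  shows "L2_field L f \<Longrightarrow> L2_field L h \<Longrightarrow> L2_field L (\<lambda>x. f x - h x)"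
  using L2_field_add[OF _ L2_field_minus, of L f h] by simp

lemma L2_field_sum:
  fixes f :: "'i \<Rightarrow> real^'n \<Rightarrow> 'b::euclidean_space"
  shows "(\<And>i. i \<in> I \<Longrightarrow> L2_field L (f i)) \<Longrightarrow> L2_field L (\<lambda>x. \<Sum>i\<in>I. f i x)"
proof (induction I rule: infinite_finite_induct)
  case (insert i I)
  then show ?case using L2_field_add[of L "f i" "\<lambda>x. \<Sum>i\<in>I. f i x"] by simp
qed (auto intro: L2_field_continuous)

lemma L2_field_component:
  fixes f :: "real^'n \<Rightarrow> real^'m"
  assumes "L2_field L f"
  shows "L2_field L (\<lambda>x. f x $ i)"
proof (rule L2_field_dominated[OF assms, of _ 1])
  show "(\<lambda>x. f x $ i) \<in> borel_measurable (Omega L)"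
    using assms borel_measurable_continuous_on[of "\<lambda>y. y $ i" f] by (simp add: L2_field_def continuous_on_component)
  show "norm (f x $ i) \<le> 1 * norm (f x)" for x by (simp add: component_le_norm_cart)
qed

lemma L2_field_vec:
  fixes f :: "real^'n \<Rightarrow> real^'m"
  assumes "\<And>i. L2_field L (\<lambda>x. f x $ i)"
  shows "L2_field L f"
proof -
  have f: "f = (\<lambda>x. \<Sum>i\<in>UNIV. f x $ i *\<^sub>R axis i 1)"
    using basis_expansion[of "f _"] by (simp flip: scalar_mult_eq_scaleR)
  have "L2_field L (\<lambda>x. f x $ i *\<^sub>R axis i (1::real) :: real^'m)" for i
    by (rule L2_field_dominated[OF assms[of i], of _ 1]) (use assms[of i] in \<open>auto simp: L2_field_def\<close>)
  then show ?thesis by (subst f) (rule L2_field_sum)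
qed

section \<open>The L2 inner product, its norm and the Cauchy-Schwarz inequality\<close>

lemma l2_inner_commute: "l2_inner L f h = l2_inner L h f"
  by (simp add: l2_inner_def inner_commute)

lemma l2_norm_sq: "(l2_norm L f)\<^sup>2 = l2_inner L f f"
  by (simp add: l2_norm_def l2_inner_def dot_square_norm)

lemma l2_norm_nonneg: "0 \<le> l2_norm L f"
  by (simp add: l2_norm_def)

lemma l2_inner_self_nonneg: "0 \<le> l2_inner L f f"
  by (simp add: l2_inner_def)

lemma l2_inner_add_left:
  fixes f g h :: "real^'n \<Rightarrow> 'b::euclidean_space"
  assumes "L2_field L f" "L2_field L g" "L2_field L h"
  shows "l2_inner L (\<lambda>x. f x + g x) h = l2_inner L f h + l2_inner L g h"
  unfolding l2_inner_def inner_add_left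
  by (intro Bochner_Integration.integral_add L2_field_inner_integrable assms)

lemma l2_inner_diff_left:
  fixes f g h :: "real^'n \<Rightarrow> 'b::euclidean_space"
  assumes "L2_field L f" "L2_field L g" "L2_field L h"
  shows "l2_inner L (\<lambda>x. f x - g x) h = l2_inner L f h - l2_inner L g h"
  unfolding l2_inner_def inner_diff_left
  by (intro Bochner_Integration.integral_diff L2_field_inner_integrable assms)

lemma l2_inner_cmult_left:
  fixes f h :: "real^'n \<Rightarrow> real"
  shows "l2_inner L (\<lambda>x. c * f x) h = c * l2_inner L f h"
  by (simp add: l2_inner_def mult.assoc)

lemma l2_inner_sum_left:
  fixes f :: "'i \<Rightarrow> real^'n \<Rightarrow> 'b::euclidean_space"
  assumes "\<And>i. i \<in> I \<Longrightarrow> L2_field L (f i)" "L2_field L h"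
  shows "l2_inner L (\<lambda>x. \<Sum>i\<in>I. f i x) h = (\<Sum>i\<in>I. l2_inner L (f i) h)"
  unfolding l2_inner_def inner_sum_left
  by (intro Bochner_Integration.integral_sum L2_field_inner_integrable assms)

lemma l2_inner_diff_right:
  fixes f g h :: "real^'n \<Rightarrow> 'b::euclidean_space"
  assumes "L2_field L f" "L2_field L g" "L2_field L h"
  shows "l2_inner L h (\<lambda>x. f x - g x) = l2_inner L h f - l2_inner L h g"
  using l2_inner_diff_left[OF assms] by (simp only: l2_inner_commute[of L h])

lemma l2_inner_cmult_right:
  fixes f h :: "real^'n \<Rightarrow> real"
  shows "l2_inner L h (\<lambda>x. c * f x) = c * l2_inner L h f"
  using l2_inner_cmult_left[of L c f h] by (simp only: l2_inner_commute[of L h])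

lemma l2_inner_sum_right:
  fixes f :: "'i \<Rightarrow> real^'n \<Rightarrow> 'b::euclidean_space"
  assumes "\<And>i. i \<in> I \<Longrightarrow> L2_field L (f i)" "L2_field L h"
  shows "l2_inner L h (\<lambda>x. \<Sum>i\<in>I. f i x) = (\<Sum>i\<in>I. l2_inner L h (f i))"
  using l2_inner_sum_left[OF assms] by (simp only: l2_inner_commute[of L h])

lemma l2_inner_add_right:
  fixes f g h :: "real^'n \<Rightarrow> 'b::euclidean_space"
  assumes "L2_field L f" "L2_field L g" "L2_field L h"
  shows "l2_inner L h (\<lambda>x. f x + g x) = l2_inner L h f + l2_inner L h g"
  using l2_inner_add_left[OF assms] by (simp only: l2_inner_commute[of L h])

lemma l2_inner_vec:
  fixes f h :: "real^'n \<Rightarrow> real^'m"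
  assumes "L2_field L f" "L2_field L h"
  shows "l2_inner L f h = (\<Sum>i\<in>UNIV. l2_inner L (\<lambda>x. f x $ i) (\<lambda>x. h x $ i))"
  unfolding l2_inner_def inner_vec_def
  by (intro Bochner_Integration.integral_sum L2_field_inner_integrable L2_field_component assms)

text \<open>Discriminant argument: the square norm of f + t h is a quadratic polynomial in t without
  negative values.\<close>

lemma l2_inner_Cauchy_Schwarz_sq:
  fixes f h :: "real^'n \<Rightarrow> 'b::euclidean_space"
  assumes "L2_field L f" "L2_field L h"
  shows "(l2_inner L f h)\<^sup>2 \<le> l2_inner L f f * l2_inner L h h"
proof -
  have q: "0 \<le> l2_inner L f f + 2 * t * l2_inner L f h + t\<^sup>2 * l2_inner L h h" for t
  proof -
    let ?k = "\<lambda>x. f x + t *\<^sub>R h x"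
    have "0 \<le> l2_inner L ?k ?k" by (rule l2_inner_self_nonneg)
    also have "l2_inner L ?k ?k = (LINT x|Omega L. f x \<bullet> f x + (2 * t) * (f x \<bullet> h x) + t\<^sup>2 * (h x \<bullet> h x))"
      unfolding l2_inner_def
      by (intro Bochner_Integration.integral_cong refl)
         (simp add: inner_add inner_commute algebra_simps power2_eq_square)
    also have "\<dots> = l2_inner L f f + 2 * t * l2_inner L f h + t\<^sup>2 * l2_inner L h h"
      unfolding l2_inner_def using assms by (simp add: L2_field_inner_integrable)
    finally show ?thesis .
  qed
  have disc: "b\<^sup>2 \<le> a * c" if "\<And>t::real. 0 \<le> a + 2 * t * b + t\<^sup>2 * c" "0 \<le> c" "0 \<le> a" for a b c :: real
  proof (cases "c = 0")
    case True
    have "b = 0"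
    proof (rule ccontr)
      assume "b \<noteq> 0"
      \<comment> \<open>For c = 0 the polynomial is affine, and at this point it takes the value
        -1.\<close>
      with that(1)[of "- (a + 1) / (2 * b)"] True show False by (simp add: field_simps)
    qed
    with True show ?thesis by simp
  next
    case False
    with that have c: "0 < c" by simp
    \<comment> \<open>The minimum of the quadratic, multiplied by c so that the discriminant
      appears.\<close>
    from that(1)[of "- b / c"] c have "0 \<le> c * (a + 2 * (- b / c) * b + (- b / c)\<^sup>2 * c)"
      by (intro mult_nonneg_nonneg) auto
    also have "\<dots> = a * c - b\<^sup>2" using c by (simp add: field_simps power2_eq_square)
    finally show ?thesis by simp
  qed
  show ?thesis by (rule disc[OF q l2_inner_self_nonneg l2_inner_self_nonneg])
qed

lemma l2_inner_Cauchy_Schwarz: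
  fixes f h :: "real^'n \<Rightarrow> 'b::euclidean_space"
  assumes "L2_field L f" "L2_field L h"
  shows "\<bar>l2_inner L f h\<bar> \<le> l2_norm L f * l2_norm L h"
proof (rule power2_le_imp_le)
  show "\<bar>l2_inner L f h\<bar>\<^sup>2 \<le> (l2_norm L f * l2_norm L h)\<^sup>2"
    using l2_inner_Cauchy_Schwarz_sq[OF assms] by (simp add: power_mult_distrib l2_norm_sq)
qed (simp add: l2_norm_nonneg)

lemma integral_norm_mult_le:
  fixes f :: "real^'n \<Rightarrow> 'b::euclidean_space" and h :: "real^'n \<Rightarrow> 'c::euclidean_space"
  assumes "L2_field L f" "L2_field L h"
  shows "integrable (Omega L) (\<lambda>x. norm (f x) * norm (h x))"
    and "(LINT x|Omega L. norm (f x) * norm (h x)) \<le> l2_norm L f * l2_norm L h"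
proof -
  have n: "L2_field L (\<lambda>x. norm (f x))" "L2_field L (\<lambda>x. norm (h x))"
    using assms by (auto simp: L2_field_def)
  show "integrable (Omega L) (\<lambda>x. norm (f x) * norm (h x))" by (rule L2_field_mult_integrable[OF n])
  show "(LINT x|Omega L. norm (f x) * norm (h x)) \<le> l2_norm L f * l2_norm L h"
    using l2_inner_Cauchy_Schwarz[OF n] by (simp add: l2_inner_def l2_norm_def)
qed

lemma l2_norm_triangle:
  fixes f h :: "real^'n \<Rightarrow> 'b::euclidean_space"
  assumes "L2_field L f" "L2_field L h"
  shows "l2_norm L (\<lambda>x. f x + h x) \<le> l2_norm L f + l2_norm L h"
proof (rule power2_le_imp_le)
  have "(l2_norm L (\<lambda>x. f x + h x))\<^sup>2 = (l2_norm L f)\<^sup>2 + 2 * l2_inner L f h + (l2_norm L h)\<^sup>2"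
    unfolding l2_norm_sq using assms
    by (simp add: l2_inner_def inner_add inner_commute L2_field_inner_integrable)
  then show "(l2_norm L (\<lambda>x. f x + h x))\<^sup>2 \<le> (l2_norm L f + l2_norm L h)\<^sup>2"
    using l2_inner_Cauchy_Schwarz[OF assms] by (simp add: power2_sum)
qed (simp add: l2_norm_nonneg)

lemma l2_norm_minus: "l2_norm L (\<lambda>x. - f x) = l2_norm L f"
  by (simp add: l2_norm_def)

lemma l2_norm_minus_commute: "l2_norm L (\<lambda>x. f x - h x) = l2_norm L (\<lambda>x. h x - f x)"
  by (simp add: l2_norm_def norm_minus_commute)

lemma l2_norm_cmult:
  fixes f :: "real^'n \<Rightarrow> real"
  shows "l2_norm L (\<lambda>x. c * f x) = \<bar>c\<bar> * l2_norm L f"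
  by (simp add: l2_norm_def power_mult_distrib real_sqrt_mult)

lemma l2_norm_mono:
  fixes f :: "real^'n \<Rightarrow> 'b::euclidean_space" and h :: "real^'n \<Rightarrow> 'c::euclidean_space"
  assumes "L2_field L f" "L2_field L h" "\<And>x. norm (f x) \<le> B * norm (h x)" "0 \<le> B"
  shows "l2_norm L f \<le> B * l2_norm L h"
proof -
  have "(LINT x|Omega L. (norm (f x))\<^sup>2) \<le> (LINT x|Omega L. B\<^sup>2 * (norm (h x))\<^sup>2)"
  proof (rule integral_mono)
    fix x
    show "(norm (f x))\<^sup>2 \<le> B\<^sup>2 * (norm (h x))\<^sup>2"
      using power_mono[OF assms(3)[of x] norm_ge_zero, of 2] by (simp add: power_mult_distrib)
  qed (use assms in \<open>auto simp: L2_field_def\<close>)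
  then have "sqrt (LINT x|Omega L. (norm (f x))\<^sup>2) \<le> sqrt (B\<^sup>2 * (LINT x|Omega L. (norm (h x))\<^sup>2))"
    by simp
  then show ?thesis using assms(4) by (simp add: l2_norm_def real_sqrt_mult)
qed

lemma l2_norm_cong_AE:
  fixes f h :: "real^'n \<Rightarrow> 'b::euclidean_space"
  assumes "L2_field L f" "L2_field L h" "AE x in Omega L. f x = h x"
  shows "l2_norm L f = l2_norm L h"
  unfolding l2_norm_def
  by (rule arg_cong[where f=sqrt], rule integral_cong_AE) (use assms in \<open>auto simp: L2_field_def\<close>)

lemma l2_norm_eq_0_AE:
  fixes f :: "real^'n \<Rightarrow> 'b::euclidean_space"
  assumes "L2_field L f" "l2_norm L f = 0"
  shows "AE x in Omega L. f x = 0"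
  using assms integral_nonneg_eq_0_iff_AE[OF L2_field_square[OF assms(1)]]
  by (simp add: l2_norm_def)

text \<open>Cauchy-Schwarz against the constant 1, whose norm is the square root of the volume of
  the cell.\<close>

lemma integral_abs_le_l2_norm:
  fixes f :: "real^'n \<Rightarrow> 'b::euclidean_space"
  assumes L: "0 < L" and "L2_field L f"
  shows "(LINT x|Omega L. norm (f x)) \<le> sqrt (L ^ CARD('n)) * l2_norm L f"
proof -
  have "l2_norm L (\<lambda>x::real^'n. 1::real) = sqrt (L ^ CARD('n))"
    using measure_Omega[OF L, where 'n='n] by (simp add: l2_norm_def)
  moreover have "L2_field L (\<lambda>x::real^'n. 1::real)" by (rule L2_field_continuous) auto
  ultimately show ?thesis
    using integral_norm_mult_le(2)[OF assms(2), of "\<lambda>x. 1::real"] by (simp add: mult.commute)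
qed

section \<open>Periodic test functions\<close>

lemma periodic_C1_continuous: "periodic_C1 L \<phi> D\<phi> \<Longrightarrow> continuous_on UNIV \<phi>"
  unfolding periodic_C1_def gderiv_def
  by (meson continuous_at_imp_continuous_on has_derivative_continuous)

lemma periodic_C1_continuous_grad: "periodic_C1 L \<phi> D\<phi> \<Longrightarrow> continuous_on UNIV D\<phi>"
  by (simp add: periodic_C1_def)

lemma periodic_C1_GDERIV: "periodic_C1 L \<phi> D\<phi> \<Longrightarrow> GDERIV \<phi> x :> D\<phi> x"
  by (simp add: periodic_C1_def)

lemma periodic_C1_periodic: "periodic_C1 L \<phi> D\<phi> \<Longrightarrow> \<phi> (x + L *\<^sub>R axis i 1) = \<phi> x"
  by (simp add: periodic_C1_def)

lemma periodic_C1_L2: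
  "periodic_C1 L \<phi> D\<phi> \<Longrightarrow> L2_field L \<phi>" "periodic_C1 L \<phi> D\<phi> \<Longrightarrow> L2_field L D\<phi>"
  by (auto intro: L2_field_continuous periodic_C1_continuous periodic_C1_continuous_grad)

lemma periodic_C1_add:
  "periodic_C1 L \<phi> D\<phi> \<Longrightarrow> periodic_C1 L \<psi> D\<psi> \<Longrightarrow>
    periodic_C1 L (\<lambda>x. \<phi> x + \<psi> x) (\<lambda>x. D\<phi> x + D\<psi> x)"
  unfolding periodic_C1_def by (auto intro!: GDERIV_add continuous_intros)

lemma periodic_C1_const: "periodic_C1 L (\<lambda>x. c) (\<lambda>x. 0)"
  unfolding periodic_C1_def by (auto intro!: GDERIV_const)

lemma periodic_C1_mult:
  assumes "periodic_C1 L \<phi> D\<phi>" "periodic_C1 L \<psi> D\<psi>"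
  shows "periodic_C1 L (\<lambda>x. \<phi> x * \<psi> x) (\<lambda>x. \<phi> x *\<^sub>R D\<psi> x + \<psi> x *\<^sub>R D\<phi> x)"
  using assms periodic_C1_continuous[OF assms(1)] periodic_C1_continuous[OF assms(2)]
  unfolding periodic_C1_def by (auto intro!: GDERIV_mult continuous_intros)

lemma periodic_C1_cmult:
  "periodic_C1 L \<phi> D\<phi> \<Longrightarrow> periodic_C1 L (\<lambda>x. c * \<phi> x) (\<lambda>x. c *\<^sub>R D\<phi> x)"
  using periodic_C1_mult[OF periodic_C1_const[of L c]] by simp

lemma periodic_C1_sum:
  "(\<And>i. i \<in> I \<Longrightarrow> periodic_C1 L (\<phi> i) (D\<phi> i)) \<Longrightarrow>
    periodic_C1 L (\<lambda>x. \<Sum>i\<in>I. \<phi> i x) (\<lambda>x. \<Sum>i\<in>I. D\<phi> i x)"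
  by (induction I rule: infinite_finite_induct) (auto intro!: periodic_C1_const periodic_C1_add)

lemma periodic_C1_compose:
  assumes "periodic_C1 L \<phi> D\<phi>" "\<And>s. (\<beta> has_real_derivative \<beta>' s) (at s)" "continuous_on UNIV \<beta>'"
  shows "periodic_C1 L (\<lambda>x. \<beta> (\<phi> x)) (\<lambda>x. \<beta>' (\<phi> x) *\<^sub>R D\<phi> x)"
proof -
  have "continuous_on UNIV (\<lambda>x. \<beta>' (\<phi> x))"
    using continuous_on_compose2[OF assms(3) periodic_C1_continuous[OF assms(1)]] by simp
  then show ?thesis
    using assms unfolding periodic_C1_def
    by (auto intro!: GDERIV_DERIV_compose[where g=\<beta>] continuous_intros)
qed

text \<open>The cell is cut by the hyperplane \<open>x $ i = L - h\<close>. The shift moves the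
  lower piece onto the part of the cell above height h; the upper piece, moved back by one period,
  covers the part below h.\<close>

lemma integral_shift_periodic:
  fixes \<psi> :: "real^'n \<Rightarrow> real"
  assumes cont: "continuous_on UNIV \<psi>" and per: "\<And>x. \<psi> (x + L *\<^sub>R axis i 1) = \<psi> x"
    and h: "0 \<le> h" "h \<le> L"
  shows "(LINT x|Omega L. \<psi> (x + h *\<^sub>R axis i 1)) = (LINT x|Omega L. \<psi> x)"
proof -
  let ?e = "axis i 1 :: real^'n" and ?b = "(\<chi> i. L) :: real^'n"
  have e: "?e \<in> Basis" by (simp add: axis_in_Basis_iff)
  have xe: "x \<bullet> ?e = x $ i" for x :: "real^'n" by (simp add: cart_eq_inner_axis)
  have cont_shift: "continuous_on UNIV (\<lambda>x. \<psi> (x + c))" for c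
    by (rule continuous_on_compose2[OF cont]) (auto intro: continuous_intros)
  have io: "f integrable_on cbox a b" if "continuous_on UNIV f" for f :: "real^'n \<Rightarrow> real" and a b
    using that by (intro integrable_continuous) (auto intro: continuous_on_subset)
  have L: "(LINT x|Omega L. f x) = integral (cbox 0 ?b) f" if "continuous_on UNIV f" for f :: "real^'n \<Rightarrow> real"
    unfolding Omega_def
    by (rule lebesgue_integral_eq_integral) (use integrable_Omega_continuous[OF that] in \<open>simp_all add: Omega_def\<close>)
  have lo: "cbox 0 ?b \<inter> {x. x \<bullet> ?e \<le> c} = cbox 0 (\<chi> j. if j = i then c else L)" if "c \<le> L" for c
    using that by (auto simp: xe mem_box_cart split: if_splits) (metis order_trans)+
  have hi: "cbox 0 ?b \<inter> {x. x \<bullet> ?e \<ge> c} = cbox (\<chi> j. if j = i then c else 0) ?b" if "0 \<le> c" for c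
    using that by (auto simp: xe mem_box_cart split: if_splits) (metis order_trans)+
  have shift: "integral (cbox a b) (\<lambda>x. \<psi> (x + c)) = integral (cbox (a + c) (b + c)) \<psi>" for a b c
    using has_integral_shift_cbox_iff[of \<psi> c "integral (cbox (a + c) (b + c)) \<psi>" a b] io[OF cont]
    by (auto simp: o_def add.commute intro!: integral_unique integrable_integral)
  have "integral (cbox 0 ?b) (\<lambda>x. \<psi> (x + h *\<^sub>R ?e))
      = integral (cbox 0 ?b \<inter> {x. x \<bullet> ?e \<le> L - h}) (\<lambda>x. \<psi> (x + h *\<^sub>R ?e))
        + integral (cbox 0 ?b \<inter> {x. x \<bullet> ?e \<ge> L - h}) (\<lambda>x. \<psi> (x + h *\<^sub>R ?e))"
    by (rule integral_split[OF io[OF cont_shift] e])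
  also have "integral (cbox 0 ?b \<inter> {x. x \<bullet> ?e \<le> L - h}) (\<lambda>x. \<psi> (x + h *\<^sub>R ?e))
      = integral (cbox 0 ?b \<inter> {x. x \<bullet> ?e \<ge> h}) \<psi>"
  proof -
    have "(\<chi> j. if j = i then L - h else L) + h *\<^sub>R ?e = ?b" "0 + h *\<^sub>R ?e = (\<chi> j. if j = i then h else 0)"
      by (auto simp: vec_eq_iff axis_def)
    then show ?thesis using h by (simp add: lo hi shift)
  qed
  also have "integral (cbox 0 ?b \<inter> {x. x \<bullet> ?e \<ge> L - h}) (\<lambda>x. \<psi> (x + h *\<^sub>R ?e))
      = integral (cbox 0 ?b \<inter> {x. x \<bullet> ?e \<le> h}) \<psi>"
  proof -
    have "(\<lambda>x. \<psi> (x + h *\<^sub>R ?e)) = (\<lambda>x. \<psi> (x + (h - L) *\<^sub>R ?e))"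
      using per[of "_ + (h - L) *\<^sub>R ?e"] by (simp add: algebra_simps)
    moreover have "(\<chi> j. if j = i then L - h else 0) + (h - L) *\<^sub>R ?e = 0"
        "?b + (h - L) *\<^sub>R ?e = (\<chi> j. if j = i then h else L)"
      by (auto simp: vec_eq_iff axis_def)
    ultimately show ?thesis using h by (simp add: lo hi shift)
  qed
  finally have "integral (cbox 0 ?b) (\<lambda>x. \<psi> (x + h *\<^sub>R ?e)) = integral (cbox 0 ?b) \<psi>"
    using integral_split[OF io[OF cont] e, of 0 ?b h] by simp
  then show ?thesis using L[OF cont] L[OF cont_shift] by simp
qed

text \<open>By \<open>integral_shift_periodic\<close> the difference quotients in direction i have
  integral zero, and they converge boundedly to the derivative.\<close>

lemma integral_gradient_periodic:
  fixes \<psi> :: "real^'n \<Rightarrow> real"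
  assumes L: "0 < L" and \<psi>: "periodic_C1 L \<psi> D\<psi>"
  shows "(LINT x|Omega L. D\<psi> x $ i) = 0"
proof -
  let ?e = "axis i 1 :: real^'n"
  \<comment> \<open>Step sizes in (0, L], the range in which the shift invariance applies.\<close>
  define h where "h n = L / real (Suc n)" for n
  have h: "0 < h n" "h n \<le> L" for n
    using L by (auto simp: h_def field_simps)
  have h0: "h \<longlonglongrightarrow> 0"
    unfolding h_def by (rule real_tendsto_divide_at_top[OF tendsto_const filterlim_compose[OF filterlim_real_sequentially filterlim_Suc]])
  define q where "q n x = (\<psi> (x + h n *\<^sub>R ?e) - \<psi> x) / h n" for n x
  have contD: "continuous_on UNIV (\<lambda>x. D\<psi> x $ i)"
    by (intro continuous_intros periodic_C1_continuous_grad[OF \<psi>])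
  have cont: "continuous_on UNIV \<psi>" by (rule periodic_C1_continuous[OF \<psi>])
  have cont_shift: "continuous_on UNIV (\<lambda>x. \<psi> (x + c))" for c
    by (rule continuous_on_compose2[OF cont]) (auto intro: continuous_intros)
  have der: "((\<lambda>t. \<psi> (x + t *\<^sub>R ?e)) has_real_derivative D\<psi> (x + t *\<^sub>R ?e) $ i) (at t)" for x t
  proof -
    have "((\<lambda>t. \<psi> (x + t *\<^sub>R ?e)) has_derivative (\<lambda>s. (s *\<^sub>R ?e) \<bullet> D\<psi> (x + t *\<^sub>R ?e))) (at t)"
    proof -
      have "((\<lambda>t. x + t *\<^sub>R ?e) has_derivative (\<lambda>s. s *\<^sub>R ?e)) (at t)"
        by (auto intro!: derivative_eq_intros)
      moreover have "(\<psi> has_derivative (\<lambda>s. s \<bullet> D\<psi> (x + t *\<^sub>R ?e))) (at (x + t *\<^sub>R ?e))"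
        using periodic_C1_GDERIV[OF \<psi>] by (simp add: gderiv_def)
      ultimately show ?thesis by (rule has_derivative_compose)
    qed
    then show ?thesis
      by (simp add: has_field_derivative_def inner_axis' mult.commute[of _ "D\<psi> _ $ i"] mult_commute_abs)
  qed
  \<comment> \<open>The intermediate point of the mean value theorem may leave the cell, but by less
    than L; the doubled cell contains it.\<close>
  have "compact ((\<lambda>x. D\<psi> x $ i) ` cbox 0 (\<chi> i. 2 * L))"
    using contD by (intro compact_continuous_image compact_cbox) (auto intro: continuous_on_subset)
  then obtain B where B: "\<And>x. x \<in> cbox 0 (\<chi> i. 2 * L) \<Longrightarrow> \<bar>D\<psi> x $ i\<bar> \<le> B"
    using compact_imp_bounded bounded_iff by (metis (no_types, lifting) imageI real_norm_def)
  have "(\<lambda>n. LINT x|Omega L. q n x) \<longlonglongrightarrow> (LINT x|Omega L. D\<psi> x $ i)"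
  proof (rule integral_dominated_convergence[where w="\<lambda>x. B"])
    show "AE x in Omega L. (\<lambda>n. q n x) \<longlonglongrightarrow> D\<psi> x $ i"
    proof (rule AE_I2)
      fix x
      have "((\<lambda>t. (\<psi> (x + t *\<^sub>R ?e) - \<psi> x) / t) \<longlongrightarrow> D\<psi> x $ i) (at 0)"
        using der[of x 0] by (simp add: has_field_derivative_iff)
      then show "(\<lambda>n. q n x) \<longlonglongrightarrow> D\<psi> x $ i"
        unfolding q_def by (rule filterlim_compose) (use h(1) h0 in \<open>auto simp: filterlim_at less_imp_neq[symmetric]\<close>)
    qed
    show "AE x in Omega L. norm (q n x) \<le> B" for n
    proof (rule AE_I2)
      fix x :: "real^'n" assume x: "x \<in> space (Omega L)"
      obtain z where z: "0 < z" "z < h n" and eq: "\<psi> (x + h n *\<^sub>R ?e) - \<psi> (x + 0 *\<^sub>R ?e) = (h n - 0) * D\<psi> (x + z *\<^sub>R ?e) $ i"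
        using MVT2[OF h(1)[of n], of "\<lambda>t. \<psi> (x + t *\<^sub>R ?e)" "\<lambda>t. D\<psi> (x + t *\<^sub>R ?e) $ i"] der by metis
      have "x + z *\<^sub>R ?e \<in> cbox 0 (\<chi> i. 2 * L)"
        using x z h(2)[of n] L by (auto simp: space_Omega mem_box_cart axis_def intro: order_trans)
           (smt (verit))+
      moreover have "q n x = D\<psi> (x + z *\<^sub>R ?e) $ i"
        using eq h(1)[of n] by (simp add: q_def field_simps)
      ultimately show "norm (q n x) \<le> B" using B by simp
    qed
    show "(\<lambda>x. D\<psi> x $ i) \<in> borel_measurable (Omega L)" by (rule borel_measurable_Omega_continuous[OF contD])
    show "q n \<in> borel_measurable (Omega L)" for n
      unfolding q_def
      by (rule borel_measurable_Omega_continuous) (use h(1)[of n] in \<open>auto intro!: continuous_intros cont cont_shift\<close>)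
  qed (rule integrable_Omega_const)
  moreover have "(LINT x|Omega L. q n x) = 0" for n
    unfolding q_def using integrable_Omega_continuous[OF cont] integrable_Omega_continuous[OF cont_shift]
      integral_shift_periodic[OF cont periodic_C1_periodic[OF \<psi>], of "h n" i] h[of n]
    by simp
  ultimately show ?thesis by (simp add: LIMSEQ_const_iff)
qed

text \<open>Integration by parts: the gradient of the product of two periodic functions has integral
  zero in each component.\<close>

lemma weak_gradient_periodic_C1:
  fixes f :: "real^'n \<Rightarrow> real"
  assumes L: "0 < L" and f: "periodic_C1 L f Df"
  shows "weak_gradient L f Df"
  unfolding weak_gradient_def
proof (intro conjI allI impI periodic_C1_L2[OF f])
  fix \<phi> :: "real^'n \<Rightarrow> real" and D\<phi> assume \<phi>: "periodic_C1 L \<phi> D\<phi>"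
  have i1: "integrable (Omega L) (\<lambda>x. f x *\<^sub>R D\<phi> x)" and i2: "integrable (Omega L) (\<lambda>x. \<phi> x *\<^sub>R Df x)"
    by (intro integrable_Omega_continuous continuous_intros periodic_C1_continuous[OF f] periodic_C1_continuous[OF \<phi>]
        periodic_C1_continuous_grad[OF f] periodic_C1_continuous_grad[OF \<phi>])+
  have int: "integrable (Omega L) (\<lambda>x. f x *\<^sub>R D\<phi> x + \<phi> x *\<^sub>R Df x)"
    using i1 i2 by simp
  have "(LINT x|Omega L. f x *\<^sub>R D\<phi> x + \<phi> x *\<^sub>R Df x) = 0"
  proof (rule vec_eq_iff[THEN iffD2], rule allI)
    fix i
    have "(LINT x|Omega L. f x *\<^sub>R D\<phi> x + \<phi> x *\<^sub>R Df x) $ i = (LINT x|Omega L. (f x *\<^sub>R D\<phi> x + \<phi> x *\<^sub>R Df x) $ i)"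
      by (rule integral_bounded_linear[OF bounded_linear_vec_nth int, symmetric])
    also have "\<dots> = 0"
      by (rule integral_gradient_periodic[OF L periodic_C1_mult[OF f \<phi>]])
    finally show "(LINT x|Omega L. f x *\<^sub>R D\<phi> x + \<phi> x *\<^sub>R Df x) $ i = 0 $ i" by simp
  qed
  then show "(LINT x|Omega L. f x *\<^sub>R D\<phi> x) = - (LINT x|Omega L. \<phi> x *\<^sub>R Df x)"
    using i1 i2 by (simp add: eq_neg_iff_add_eq_0)
qed

lemma weak_gradient_component:
  fixes f :: "real^'n \<Rightarrow> real"
  assumes "weak_gradient L f G" "periodic_C1 L \<phi> D\<phi>"
  shows "l2_inner L f (\<lambda>x. D\<phi> x $ i) = - l2_inner L (\<lambda>x. G x $ i) \<phi>"
proof -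
  have f: "L2_field L f" and G: "L2_field L G"
    using assms by (auto simp: weak_gradient_def)
  have i1: "integrable (Omega L) (\<lambda>x. f x *\<^sub>R D\<phi> x)"
  proof (rule Bochner_Integration.integrable_bound[OF integral_norm_mult_le(1)[OF f periodic_C1_L2(2)[OF assms(2)]]])
    show "(\<lambda>x. f x *\<^sub>R D\<phi> x) \<in> borel_measurable (Omega L)"
      by (intro borel_measurable_scaleR L2_field_measurable f periodic_C1_L2[OF assms(2)])
  qed simp
  have i2: "integrable (Omega L) (\<lambda>x. \<phi> x *\<^sub>R G x)"
  proof (rule Bochner_Integration.integrable_bound[OF integral_norm_mult_le(1)[OF periodic_C1_L2(1)[OF assms(2)] G]])
    show "(\<lambda>x. \<phi> x *\<^sub>R G x) \<in> borel_measurable (Omega L)"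
      by (intro borel_measurable_scaleR L2_field_measurable G periodic_C1_L2[OF assms(2)])
  qed simp
  have "(LINT x|Omega L. (f x *\<^sub>R D\<phi> x) $ i) = - (LINT x|Omega L. (\<phi> x *\<^sub>R G x) $ i)"
    using assms by (simp only: integral_bounded_linear[OF bounded_linear_vec_nth i1]
        integral_bounded_linear[OF bounded_linear_vec_nth i2] weak_gradient_def vector_uminus_component)
  then show ?thesis by (simp add: l2_inner_def mult.commute)
qed

section \<open>Real trigonometric modes and Fourier multipliers\<close>

definition cosw :: "real \<Rightarrow> int^'n \<Rightarrow> real^'n \<Rightarrow> real" where
  "cosw L k x = cos (wave L k \<bullet> x)"

definition sinw :: "real \<Rightarrow> int^'n \<Rightarrow> real^'n \<Rightarrow> real" where
  "sinw L k x = sin (wave L k \<bullet> x)"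

lemma wave_minus: "wave L (- k) = - wave L k"
  by (simp add: wave_def vec_eq_iff)

lemma wave_diff: "wave L (k - l) = wave L k - wave L l"
  by (simp add: wave_def vec_eq_iff algebra_simps)

lemma wave_add: "wave L (k + l) = wave L k + wave L l"
  by (simp add: wave_def vec_eq_iff algebra_simps)

lemma wave_0 [simp]: "wave L 0 = 0"
  by (simp add: wave_def vec_eq_iff)

text \<open>Spectral gap: a nonzero integer vector has a component of modulus at least 1. This gives
  the Poincare constant and isolates the zero mode.\<close>

lemma norm_wave_ge:
  assumes "0 < L" "k \<noteq> 0"
  shows "2 * pi / L \<le> norm (wave L k)"
proof -
  from assms(2) obtain i where i: "k $ i \<noteq> 0" by (auto simp: vec_eq_iff)
  have "2 * pi / L * 1 \<le> 2 * pi / L * \<bar>real_of_int (k $ i)\<bar>"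
    using assms(1) i by (intro mult_left_mono) auto
  also have "\<dots> = \<bar>wave L k $ i\<bar>" using assms(1) by (simp add: wave_def abs_mult)
  also have "\<dots> \<le> norm (wave L k)" by (rule component_le_norm_cart)
  finally show ?thesis by simp
qed

lemma cosw_minus [simp]: "cosw L (- k) = cosw L k"
  by (simp add: cosw_def wave_minus fun_eq_iff)

lemma sinw_minus [simp]: "sinw L (- k) x = - sinw L k x"
  by (simp add: sinw_def wave_minus)

lemma cosw_0 [simp]: "cosw L 0 x = 1" and sinw_0 [simp]: "sinw L 0 x = 0"
  by (simp_all add: cosw_def sinw_def)

lemma GDERIV_inner_left: "GDERIV (\<lambda>x. a \<bullet> x) x :> a"
  unfolding gderiv_def by (auto intro!: derivative_eq_intros simp: inner_commute)

lemma wave_shift: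
  assumes "0 < L"
  shows "wave L k \<bullet> (x + L *\<^sub>R axis i 1) = wave L k \<bullet> x + 2 * pi * of_int (k $ i)"
  using assms by (simp add: inner_add_right wave_def inner_axis)

lemma periodic_C1_cosw:
  assumes "0 < L"
  shows "periodic_C1 L (cosw L k) (\<lambda>x. - sinw L k x *\<^sub>R wave L k)"
  unfolding periodic_C1_def cosw_def sinw_def wave_shift[OF assms]
proof (intro conjI allI)
  show "GDERIV (\<lambda>x. cos (wave L k \<bullet> x)) x :> - sin (wave L k \<bullet> x) *\<^sub>R wave L k" for x
    by (rule GDERIV_DERIV_compose[where g=cos, OF GDERIV_inner_left]) (rule DERIV_cos)
qed (auto intro!: continuous_intros simp: cos_add sin_int_2pin cos_int_2pin)

lemma periodic_C1_sinw:
  assumes "0 < L"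
  shows "periodic_C1 L (sinw L k) (\<lambda>x. cosw L k x *\<^sub>R wave L k)"
  unfolding periodic_C1_def cosw_def sinw_def wave_shift[OF assms]
proof (intro conjI allI)
  show "GDERIV (\<lambda>x. sin (wave L k \<bullet> x)) x :> cos (wave L k \<bullet> x) *\<^sub>R wave L k" for x
    by (rule GDERIV_DERIV_compose[where g=sin, OF GDERIV_inner_left]) (rule DERIV_sin)
qed (auto intro!: continuous_intros simp: sin_add sin_int_2pin cos_int_2pin)

lemma continuous_on_cosw: "continuous_on S (cosw L k)" and continuous_on_sinw: "continuous_on S (sinw L k)"
  by (auto simp: cosw_def[abs_def] sinw_def[abs_def] intro!: continuous_intros)

lemma L2_cosw: "L2_field L (cosw L k)" and L2_sinw: "L2_field L (sinw L k)"
  by (auto intro: L2_field_continuous continuous_on_cosw continuous_on_sinw)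

text \<open>For nonzero k the cosine is, up to a nonzero factor, a partial derivative of the
  periodic sine, so its integral vanishes.\<close>

lemma integral_cosw:
  fixes k :: "int^'n"
  assumes L: "0 < L"
  shows "(LINT x|Omega L. cosw L k x) = (if k = 0 then L ^ CARD('n) else 0)"
proof (cases "k = 0")
  case True
  then show ?thesis using measure_Omega[OF L, where 'n='n] by simp
next
  case False
  then obtain i where i: "k $ i \<noteq> 0" by (auto simp: vec_eq_iff)
  have w: "wave L k $ i \<noteq> 0" using i L by (simp add: wave_def)
  have "(LINT x|Omega L. cosw L k x * wave L k $ i) = 0"
    using integral_gradient_periodic[OF L periodic_C1_sinw[OF L], of k i] by simp
  with w False show ?thesis by simp
qed

lemma integral_sinw:
  fixes k :: "int^'n"
  assumes L: "0 < L"
  shows "(LINT x|Omega L. sinw L k x) = 0"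
proof (cases "k = 0")
  case False
  then obtain i where i: "k $ i \<noteq> 0" by (auto simp: vec_eq_iff)
  have w: "wave L k $ i \<noteq> 0" using i L by (simp add: wave_def)
  have "(LINT x|Omega L. sinw L k x * wave L k $ i) = 0"
    using integral_gradient_periodic[OF L periodic_C1_cosw[OF L], of k i] by simp
  with w False show ?thesis by simp
qed simp

lemma integrable_cosw: "integrable (Omega L) (cosw L k)" and integrable_sinw: "integrable (Omega L) (sinw L k)"
  by (auto intro: L2_field_integrable L2_cosw L2_sinw)

text \<open>Product-to-sum formulas reduce this to the means of single modes. Both indicators count
  exactly when k = l = 0, which gives the whole volume there.\<close>

lemma inner_cosw_cosw:
  fixes k l :: "int^'n"
  assumes L: "0 < L"
  shows "l2_inner L (cosw L k) (cosw L l) = L ^ CARD('n) / 2 * (of_bool (k = l) + of_bool (k = - l))"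
proof -
  have "l2_inner L (cosw L k) (cosw L l) = (LINT x|Omega L. (cosw L (k - l) x + cosw L (k + l) x) / 2)"
    unfolding l2_inner_def cosw_def wave_diff wave_add inner_diff_left inner_add_left
    by (simp add: cos_times_cos)
  also have "\<dots> = ((LINT x|Omega L. cosw L (k - l) x) + (LINT x|Omega L. cosw L (k + l) x)) / 2"
    by (simp add: Bochner_Integration.integral_add[OF integrable_cosw integrable_cosw]
        Bochner_Integration.integral_diff[OF integrable_cosw integrable_cosw])
  finally show ?thesis by (simp add: integral_cosw[OF L] eq_neg_iff_add_eq_0 of_bool_def)
qed

lemma inner_sinw_sinw:
  fixes k l :: "int^'n"
  assumes L: "0 < L"
  shows "l2_inner L (sinw L k) (sinw L l) = L ^ CARD('n) / 2 * (of_bool (k = l) - of_bool (k = - l))"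
proof -
  have "l2_inner L (sinw L k) (sinw L l) = (LINT x|Omega L. (cosw L (k - l) x - cosw L (k + l) x) / 2)"
    unfolding l2_inner_def sinw_def cosw_def wave_diff wave_add inner_diff_left inner_add_left
    by (simp add: sin_times_sin)
  also have "\<dots> = ((LINT x|Omega L. cosw L (k - l) x) - (LINT x|Omega L. cosw L (k + l) x)) / 2"
    by (simp add: Bochner_Integration.integral_add[OF integrable_cosw integrable_cosw]
        Bochner_Integration.integral_diff[OF integrable_cosw integrable_cosw])
  finally show ?thesis by (simp add: integral_cosw[OF L] eq_neg_iff_add_eq_0 of_bool_def)
qed

lemma inner_sinw_cosw:
  fixes k l :: "int^'n"
  assumes L: "0 < L"
  shows "l2_inner L (sinw L k) (cosw L l) = 0"
proof -
  have "l2_inner L (sinw L k) (cosw L l) = (LINT x|Omega L. (sinw L (k + l) x + sinw L (k - l) x) / 2)"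
    unfolding l2_inner_def sinw_def cosw_def wave_diff wave_add inner_diff_left inner_add_left
    by (simp add: sin_times_cos)
  also have "\<dots> = ((LINT x|Omega L. sinw L (k + l) x) + (LINT x|Omega L. sinw L (k - l) x)) / 2"
    by (simp add: Bochner_Integration.integral_add[OF integrable_sinw integrable_sinw])
  finally show ?thesis by (simp add: integral_sinw[OF L])
qed

text \<open>The real form of a Fourier multiplier; Fejer means and sharp truncations are both
  instances. For even weights k and -k contribute the same term, hence the factor 1 / L^d instead of
  2 / L^d, and the zero mode is no special case.\<close>

definition fmult ::
    "real \<Rightarrow> (int^'n) set \<Rightarrow> (int^'n \<Rightarrow> real) \<Rightarrow> (real^'n \<Rightarrow> real) \<Rightarrow> real^'n \<Rightarrow> real" where
  "fmult L A w f x = (\<Sum>k\<in>A. w k / L ^ CARD('n) *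
     (l2_inner L f (cosw L k) * cosw L k x + l2_inner L f (sinw L k) * sinw L k x))"

definition fmult_grad ::
    "real \<Rightarrow> (int^'n) set \<Rightarrow> (int^'n \<Rightarrow> real) \<Rightarrow> (real^'n \<Rightarrow> real) \<Rightarrow> real^'n \<Rightarrow> real^'n" where
  "fmult_grad L A w f x = (\<Sum>k\<in>A. (w k / L ^ CARD('n)) *\<^sub>R
     ((l2_inner L f (sinw L k) * cosw L k x - l2_inner L f (cosw L k) * sinw L k x) *\<^sub>R wave L k))"

lemma periodic_C1_fmult:
  assumes "0 < L"
  shows "periodic_C1 L (fmult L A w f) (fmult_grad L A w f)"
proof -
  have "periodic_C1 L (\<lambda>x. w k / L ^ CARD('n) *
      (l2_inner L f (cosw L k) * cosw L k x + l2_inner L f (sinw L k) * sinw L k x))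
    (\<lambda>x. (w k / L ^ CARD('n)) *\<^sub>R
      ((l2_inner L f (cosw L k)) *\<^sub>R (- sinw L k x *\<^sub>R wave L k) + (l2_inner L f (sinw L k)) *\<^sub>R (cosw L k x *\<^sub>R wave L k)))" for k
    by (intro periodic_C1_cmult periodic_C1_add periodic_C1_cosw periodic_C1_sinw assms)
  also have "(\<lambda>x. (w k / L ^ CARD('n)) *\<^sub>R
      ((l2_inner L f (cosw L k)) *\<^sub>R (- sinw L k x *\<^sub>R wave L k) + (l2_inner L f (sinw L k)) *\<^sub>R (cosw L k x *\<^sub>R wave L k)))
    = (\<lambda>x. (w k / L ^ CARD('n)) *\<^sub>R
     ((l2_inner L f (sinw L k) * cosw L k x - l2_inner L f (cosw L k) * sinw L k x) *\<^sub>R wave L k))" for k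
    by (simp add: fun_eq_iff scaleR_diff_left)
  finally show ?thesis
    unfolding fmult_def[abs_def] fmult_grad_def[abs_def] by (rule periodic_C1_sum)
qed

lemma L2_fmult: "L2_field L (fmult L A w f)" and L2_fmult_grad: "L2_field L (fmult_grad L A w f)"
  unfolding fmult_def[abs_def] fmult_grad_def[abs_def]
  by (intro L2_field_continuous continuous_on_sum continuous_on_scaleR continuous_on_mult continuous_on_add
      continuous_on_diff continuous_on_const continuous_on_cosw continuous_on_sinw)+

lemma l2_inner_fmult:
  fixes f h :: "real^'n \<Rightarrow> real"
  assumes "L2_field L h"
  shows "l2_inner L (fmult L A w f) h = (\<Sum>k\<in>A. w k / L ^ CARD('n) *
     (l2_inner L f (cosw L k) * l2_inner L h (cosw L k) + l2_inner L f (sinw L k) * l2_inner L h (sinw L k)))"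
proof -
  have "l2_inner L (fmult L A w f) h = (\<Sum>k\<in>A. l2_inner L (\<lambda>x. w k / L ^ CARD('n) *
     (l2_inner L f (cosw L k) * cosw L k x + l2_inner L f (sinw L k) * sinw L k x)) h)"
    unfolding fmult_def[abs_def]
    by (intro l2_inner_sum_left assms L2_field_cmult L2_field_add L2_cosw L2_sinw)
  also have "\<dots> = (\<Sum>k\<in>A. w k / L ^ CARD('n) *
     (l2_inner L f (cosw L k) * l2_inner L h (cosw L k) + l2_inner L f (sinw L k) * l2_inner L h (sinw L k)))"
    by (intro sum.cong refl)
       (simp only: l2_inner_cmult_left l2_inner_add_left[OF L2_field_cmult[OF L2_cosw] L2_field_cmult[OF L2_sinw] assms] l2_inner_commute[of L h])
  finally show ?thesis .
qed

text \<open>The bilinear expression in \<open>l2_inner_fmult\<close> is symmetric in the two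
  functions.\<close>

lemma fmult_symmetric:
  fixes f h :: "real^'n \<Rightarrow> real"
  assumes "L2_field L f" "L2_field L h"
  shows "l2_inner L (fmult L A w f) h = l2_inner L f (fmult L A w h)"
  using l2_inner_fmult[OF assms(2), of A w f] l2_inner_fmult[OF assms(1), of A w h]
  by (simp add: l2_inner_commute[of L f] mult.commute)

lemma l2_inner_cong_AE:
  fixes f h k :: "real^'n \<Rightarrow> 'b::euclidean_space"
  assumes "AE x in Omega L. f x = h x" "f \<in> borel_measurable (Omega L)" "h \<in> borel_measurable (Omega L)"
    "k \<in> borel_measurable (Omega L)"
  shows "l2_inner L f k = l2_inner L h k"
  unfolding l2_inner_def
  by (rule integral_cong_AE) (use assms in \<open>auto intro!: borel_measurable_inner\<close>)

lemma fmult_diff: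
  assumes "L2_field L f" "L2_field L h"
  shows "fmult L A w (\<lambda>x. f x - h x) x = fmult L A w f x - fmult L A w h x"
  using assms by (simp add: fmult_def l2_inner_diff_left L2_cosw L2_sinw algebra_simps sum_subtractf)

lemma fmult_cmult: "fmult L A w (\<lambda>x. c * f x) x = c * fmult L A w f x"
  by (simp add: fmult_def l2_inner_cmult_left sum_distrib_left algebra_simps)

text \<open>The modes of k and -k are the same functions up to sign. Invariance of the index set and
  of the weights under this redundancy is what makes a multiplier diagonal.\<close>

definition even_weights :: "(int^'n) set \<Rightarrow> (int^'n \<Rightarrow> real) \<Rightarrow> bool" where
  "even_weights A w \<longleftrightarrow> finite A \<and> (\<forall>k. - k \<in> A \<longleftrightarrow> k \<in> A) \<and> (\<forall>k. w (- k) = w k)"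

text \<open>In the orthogonality relations k = l and k = -l each carry half of the mass. By evenness
  the two halves are equal; for the sines the sign of the relation cancels against the oddness of
  the coefficient.\<close>

lemma fmult_coeff:
  fixes f :: "real^'n \<Rightarrow> real" and l :: "int^'n"
  assumes L: "0 < L" and w: "even_weights A w"
  shows "l2_inner L (fmult L A w f) (cosw L l) = (if l \<in> A then w l * l2_inner L f (cosw L l) else 0)"
    and "l2_inner L (fmult L A w f) (sinw L l) = (if l \<in> A then w l * l2_inner L f (sinw L l) else 0)"
proof -
  have A: "finite A" "- l \<in> A \<longleftrightarrow> l \<in> A" and w: "w (- k) = w k" for k
    using w by (auto simp: even_weights_def)
  have sm: "l2_inner L f (sinw L (- k)) = - l2_inner L f (sinw L k)" for k
  proof -
    have "sinw L (- k) = (\<lambda>x. (- 1) * sinw L k x)" by auto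
    then show ?thesis using l2_inner_cmult_right[of L f "-1" "sinw L k"] by simp
  qed
  have "l2_inner L (fmult L A w f) (cosw L l) = (\<Sum>k\<in>A. w k / L ^ CARD('n) *
     (l2_inner L f (cosw L k) * (L ^ CARD('n) / 2 * (of_bool (l = k) + of_bool (l = - k)))))"
    by (simp add: l2_inner_fmult L2_cosw inner_cosw_cosw[OF L] inner_sinw_cosw[OF L] l2_inner_commute[of L "cosw L l" "sinw L _"])
  also have "\<dots> = (\<Sum>k\<in>A. if k = l then w k * l2_inner L f (cosw L k) / 2 else 0)
      + (\<Sum>k\<in>A. if k = - l then w k * l2_inner L f (cosw L k) / 2 else 0)"
    unfolding sum.distrib[symmetric] of_bool_def eq_commute[of l] minus_equation_iff[of _ l]
    by (intro sum.cong refl) (use L w in simp)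
  also have "\<dots> = (if l \<in> A then w l * l2_inner L f (cosw L l) else 0)"
    using A w by (simp add: sum.delta)
  finally show "l2_inner L (fmult L A w f) (cosw L l) = (if l \<in> A then w l * l2_inner L f (cosw L l) else 0)" .
  have "l2_inner L (fmult L A w f) (sinw L l) = (\<Sum>k\<in>A. w k / L ^ CARD('n) *
     (l2_inner L f (sinw L k) * (L ^ CARD('n) / 2 * (of_bool (l = k) - of_bool (l = - k)))))"
    by (simp add: l2_inner_fmult L2_sinw inner_sinw_sinw[OF L] inner_sinw_cosw[OF L])
  also have "\<dots> = (\<Sum>k\<in>A. if k = l then w k * l2_inner L f (sinw L k) / 2 else 0)
      - (\<Sum>k\<in>A. if k = - l then w k * l2_inner L f (sinw L k) / 2 else 0)"
    unfolding sum_subtractf[symmetric] of_bool_def eq_commute[of l] minus_equation_iff[of _ l]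
    by (intro sum.cong refl) (use L w in simp, metis add_eq_0_iff mult_2)
  also have "\<dots> = (if l \<in> A then w l * l2_inner L f (sinw L l) else 0)"
    using A w sm by (simp add: sum.delta)
  finally show "l2_inner L (fmult L A w f) (sinw L l) = (if l \<in> A then w l * l2_inner L f (sinw L l) else 0)" .
qed

lemma fmult_fmult:
  assumes L: "0 < L" and w: "even_weights A w"
  shows "fmult L A v (fmult L A w f) = fmult L A (\<lambda>k. v k * w k) f"
  by (auto simp: fun_eq_iff fmult_def[of L A v] fmult_def[of L A "\<lambda>k. v k * w k"] fmult_coeff[OF assms]
      algebra_simps intro!: sum.cong)

lemma l2_norm_fmult_sq:
  fixes f :: "real^'n \<Rightarrow> real"
  assumes L: "0 < L" and w: "even_weights A w" and f: "L2_field L f"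
  shows "(l2_norm L (fmult L A w f))\<^sup>2 =
    (\<Sum>k\<in>A. (w k)\<^sup>2 / L ^ CARD('n) * ((l2_inner L f (cosw L k))\<^sup>2 + (l2_inner L f (sinw L k))\<^sup>2))"
proof -
  have "(l2_norm L (fmult L A w f))\<^sup>2 = l2_inner L (fmult L A w (fmult L A w f)) f"
    by (simp add: l2_norm_sq fmult_symmetric[OF L2_fmult f])
  then show ?thesis
    by (simp add: fmult_fmult[OF L w] l2_inner_fmult[OF f] power2_eq_square)
qed

text \<open>With unit weights the multiplier P is a symmetric projection, so |P f|^2 = (P f, f)
  \<le> |P f| |f|. Weights of modulus at most 1 only decrease the sum of squares.\<close>

lemma Bessel_fmult:
  fixes f :: "real^'n \<Rightarrow> real"
  assumes L: "0 < L" and w: "even_weights A w" and w1: "\<And>k. k \<in> A \<Longrightarrow> \<bar>w k\<bar> \<le> 1"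
    and f: "L2_field L f"
  shows "l2_norm L (fmult L A w f) \<le> l2_norm L f"
proof -
  let ?P = "fmult L A (\<lambda>_. 1) f"
  have w': "even_weights A (\<lambda>_. 1)" using w by (simp add: even_weights_def)
  have "(l2_norm L (fmult L A w f))\<^sup>2 \<le> (l2_norm L ?P)\<^sup>2"
    unfolding l2_norm_fmult_sq[OF L w f] l2_norm_fmult_sq[OF L w' f]
    using w1 L by (intro sum_mono mult_right_mono divide_right_mono) (auto simp: abs_square_le_1)
  then have 1: "l2_norm L (fmult L A w f) \<le> l2_norm L ?P"
    by (simp add: l2_norm_nonneg power2_le_iff_abs_le)
  have "(l2_norm L ?P)\<^sup>2 = l2_inner L (fmult L A (\<lambda>_. 1) ?P) f"
    by (simp add: l2_norm_sq fmult_symmetric[OF L2_fmult f])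
  also have "\<dots> = l2_inner L ?P f" by (simp add: fmult_fmult[OF L w'])
  also have "\<dots> \<le> l2_norm L ?P * l2_norm L f"
    using l2_inner_Cauchy_Schwarz[OF L2_fmult f] abs_le_iff by blast
  finally have "l2_norm L ?P \<le> l2_norm L f"
    using l2_norm_nonneg[of L ?P] l2_norm_nonneg[of L f]
    by (cases "l2_norm L ?P = 0") (auto simp: power2_eq_square)
  with 1 show ?thesis by simp
qed

lemma weak_gradient_coeff:
  fixes f :: "real^'n \<Rightarrow> real"
  assumes L: "0 < L" and G: "weak_gradient L f G"
  shows "l2_inner L (\<lambda>x. G x $ i) (cosw L k) = wave L k $ i * l2_inner L f (sinw L k)"
    and "l2_inner L (\<lambda>x. G x $ i) (sinw L k) = - (wave L k $ i * l2_inner L f (cosw L k))"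
  using weak_gradient_component[OF G periodic_C1_cosw[OF L], of k i] weak_gradient_component[OF G periodic_C1_sinw[OF L], of k i]
    l2_inner_cmult_right[of L f "- wave L k $ i" "sinw L k"] l2_inner_cmult_right[of L f "wave L k $ i" "cosw L k"]
  by (simp_all add: mult.commute)

text \<open>Multipliers commute with weak derivatives, because differentiation acts on the
  coefficients of each mode pair separately.\<close>

lemma fmult_weak_gradient:
  fixes f :: "real^'n \<Rightarrow> real"
  assumes L: "0 < L" and G: "weak_gradient L f G"
  shows "fmult L A w (\<lambda>x. G x $ i) = (\<lambda>x. fmult_grad L A w f x $ i)"
  by (auto simp: fun_eq_iff fmult_def fmult_grad_def weak_gradient_coeff[OF assms] algebra_simps intro!: sum.cong)

lemma l2_norm_fmult_grad_sq:
  fixes f :: "real^'n \<Rightarrow> real"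
  assumes L: "0 < L" and w: "even_weights A w" and G: "weak_gradient L f G"
  shows "(l2_norm L (fmult_grad L A w f))\<^sup>2 =
    (\<Sum>k\<in>A. (w k)\<^sup>2 * (norm (wave L k))\<^sup>2 / L ^ CARD('n) * ((l2_inner L f (cosw L k))\<^sup>2 + (l2_inner L f (sinw L k))\<^sup>2))"
proof -
  have Gi: "L2_field L (\<lambda>x. G x $ i)" for i
    using G by (auto simp: weak_gradient_def intro: L2_field_component)
  have "(l2_norm L (fmult_grad L A w f))\<^sup>2 = (\<Sum>i\<in>UNIV. (l2_norm L (fmult L A w (\<lambda>x. G x $ i)))\<^sup>2)"
    by (simp add: l2_norm_sq l2_inner_vec[OF L2_fmult_grad L2_fmult_grad] fmult_weak_gradient[OF L G])
  also have "\<dots> = (\<Sum>i\<in>UNIV. \<Sum>k\<in>A. (wave L k $ i)\<^sup>2 * ((w k)\<^sup>2 / L ^ CARD('n) * ((l2_inner L f (cosw L k))\<^sup>2 + (l2_inner L f (sinw L k))\<^sup>2)))"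
    by (simp add: l2_norm_fmult_sq[OF L w Gi] weak_gradient_coeff[OF L G] power_mult_distrib algebra_simps)
  also have "\<dots> = (\<Sum>k\<in>A. (\<Sum>i\<in>UNIV. (wave L k $ i)\<^sup>2) * ((w k)\<^sup>2 / L ^ CARD('n) * ((l2_inner L f (cosw L k))\<^sup>2 + (l2_inner L f (sinw L k))\<^sup>2)))"
    by (subst sum.swap) (simp only: sum_distrib_right)
  also have "\<dots> = (\<Sum>k\<in>A. (norm (wave L k))\<^sup>2 * ((w k)\<^sup>2 / L ^ CARD('n) * ((l2_inner L f (cosw L k))\<^sup>2 + (l2_inner L f (sinw L k))\<^sup>2)))"
    by (simp add: norm_eq_sqrt_inner inner_vec_def power2_eq_square sum_nonneg)
  finally show ?thesis by (simp add: algebra_simps)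
qed

section \<open>The Fejer kernel\<close>

definition fejer_box :: "nat \<Rightarrow> (int^'n) set" where
  "fejer_box N = {a. \<forall>i. 0 \<le> a $ i \<and> a $ i < int N}"

definition fejer_set :: "nat \<Rightarrow> (int^'n) set" where
  "fejer_set N = {k. \<forall>i. \<bar>k $ i\<bar> < int N}"

text \<open>
  The coefficients of the product Fejer kernel, i.e. of the square modulus of the Dirichlet-type sum
  over \<open>fejer_box N\<close>, which makes the nonnegativity of the kernel immediate.
\<close>

definition fejer_weight :: "nat \<Rightarrow> int^'n \<Rightarrow> real" where
  "fejer_weight N k =
     real (card {p \<in> fejer_box N \<times> fejer_box N. fst p - snd p = k}) / real N ^ CARD('n)"

definition fejer :: "real \<Rightarrow> nat \<Rightarrow> (real^'n \<Rightarrow> real) \<Rightarrow> real^'n \<Rightarrow> real" where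
  "fejer L N = fmult L (fejer_set N) (fejer_weight N)"

definition fejer_grad :: "real \<Rightarrow> nat \<Rightarrow> (real^'n \<Rightarrow> real) \<Rightarrow> real^'n \<Rightarrow> real^'n" where
  "fejer_grad L N = fmult_grad L (fejer_set N) (fejer_weight N)"

lemma card_vec_Pi:
  fixes S :: "'n::finite \<Rightarrow> int set"
  assumes "\<And>i. finite (S i)"
  shows "finite {a :: int^'n. \<forall>i. a $ i \<in> S i}"
    and "card {a :: int^'n. \<forall>i. a $ i \<in> S i} = (\<Prod>i\<in>UNIV. card (S i))"
proof -
  have bij: "bij_betw (\<lambda>f. \<chi> i. f i) (PiE UNIV S) {a :: int^'n. \<forall>i. a $ i \<in> S i}"
    by (rule bij_betw_byWitness[where f'="vec_nth"]) auto
  have "finite (PiE UNIV S)" using assms by (intro finite_PiE) auto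
  with bij show "finite {a :: int^'n. \<forall>i. a $ i \<in> S i}" using bij_betw_finite by blast
  show "card {a :: int^'n. \<forall>i. a $ i \<in> S i} = (\<Prod>i\<in>UNIV. card (S i))"
    using bij_betw_same_card[OF bij] by (simp add: card_PiE)
qed

lemma fejer_box_eq: "fejer_box N = {a. \<forall>i. a $ i \<in> {0..<int N}}"
  by (simp add: fejer_box_def)

lemma finite_fejer_box: "finite (fejer_box N)"
  unfolding fejer_box_eq by (rule card_vec_Pi) simp

lemma card_fejer_box: "card (fejer_box N :: (int^'n) set) = N ^ CARD('n)"
  unfolding fejer_box_eq by (subst card_vec_Pi) simp_all

lemma fejer_set_eq: "fejer_set N = {k. \<forall>i. k $ i \<in> {- int N<..<int N}}"
  by (auto simp: fejer_set_def abs_less_iff minus_less_iff[of _ "int N"])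

lemma finite_fejer_set: "finite (fejer_set N)"
  unfolding fejer_set_eq by (rule card_vec_Pi) simp

lemma fejer_even_weights: "even_weights (fejer_set N) (fejer_weight N)"
  unfolding even_weights_def
proof (intro conjI allI finite_fejer_set)
  fix k :: "int^'n"
  show "(- k \<in> fejer_set N) = (k \<in> fejer_set N)" by (simp add: fejer_set_def)
  have eq: "a - b = - k \<longleftrightarrow> b - a = k" for a b :: "int^'n"
    by (metis minus_diff_eq minus_minus)
  have bij: "bij_betw prod.swap {p \<in> fejer_box N \<times> fejer_box N. fst p - snd p = - k}
      {p \<in> fejer_box N \<times> fejer_box N. fst p - snd p = k}"
    by (rule bij_betw_byWitness[where f'=prod.swap]) (auto simp: eq)
  show "fejer_weight N (- k) = fejer_weight N k"
    unfolding fejer_weight_def bij_betw_same_card[OF bij] by (rule refl)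
qed

text \<open>The relative overlap of the box with its translate by k. This form allows the weight to
  be estimated and computed, while the count of pairs serves the positivity of the kernel.\<close>

lemma fejer_weight_eq_card:
  fixes k :: "int^'n"
  shows "fejer_weight N k = real (card {b \<in> fejer_box N. b + k \<in> fejer_box N}) / real N ^ CARD('n)"
proof -
  have bij: "bij_betw snd {p \<in> fejer_box N \<times> fejer_box N. fst p - snd p = k} {b \<in> fejer_box N. b + k \<in> fejer_box N}"
    by (rule bij_betw_byWitness[where f'="\<lambda>b. (b + k, b)"]) auto
  show ?thesis
    unfolding fejer_weight_def bij_betw_same_card[OF bij] by (rule refl)
qed

lemma fejer_weight_abs_le:
  fixes k :: "int^'n"
  shows "\<bar>fejer_weight N k\<bar> \<le> 1"
proof -
  have "card {b \<in> fejer_box N. b + k \<in> fejer_box N} \<le> card (fejer_box N :: (int^'n) set)"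
    by (rule card_mono[OF finite_fejer_box]) auto
  then have "real (card {b \<in> fejer_box N. b + k \<in> fejer_box N}) \<le> real (N ^ CARD('n))"
    unfolding card_fejer_box of_nat_le_iff .
  then have "real (card {b \<in> fejer_box N. b + k \<in> fejer_box N}) / real N ^ CARD('n) \<le> 1"
    by (intro divide_le_eq_1[THEN iffD2]) (auto simp: not_less)
  then show ?thesis by (simp add: fejer_weight_eq_card)
qed

text \<open>Once N exceeds all components of k in modulus, the overlap is a box with sides N -
  |k_i|, so the weight is the product of the factors 1 - |k_i| / N.\<close>

lemma fejer_weight_tendsto:
  fixes k :: "int^'n"
  shows "(\<lambda>N. fejer_weight N k) \<longlonglongrightarrow> 1"
proof -
  have lower: "max 0 (- m) \<le> b \<longleftrightarrow> 0 \<le> b \<and> 0 \<le> b + m" for b m :: int by linarith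
  have upper: "b < min N (N - m) \<longleftrightarrow> b < N \<and> b + m < N" for b m N :: int by linarith
  have eq: "fejer_weight N k = (\<Prod>i\<in>UNIV. 1 - \<bar>real_of_int (k $ i)\<bar> / real N)"
    if N: "0 < N" "\<And>i. \<bar>k $ i\<bar> \<le> int N" for N
  proof -
    have eq: "{b \<in> fejer_box N. b + k \<in> fejer_box N} = {b. \<forall>i. b $ i \<in> {max 0 (- k $ i)..<min (int N) (int N - k $ i)}}"
      unfolding fejer_box_def mem_Collect_eq vector_add_component atLeastLessThan_iff lower upper all_conj_distrib
      by (rule Collect_cong) blast
    have "card {b \<in> fejer_box N. b + k \<in> fejer_box N}
        = (\<Prod>i\<in>UNIV. card {max 0 (- k $ i)..<min (int N) (int N - k $ i)})"
      unfolding eq by (rule card_vec_Pi(2)) simp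
    also have "\<dots> = (\<Prod>i\<in>UNIV. nat (int N - \<bar>k $ i\<bar>))"
      unfolding card_atLeastLessThan_int by (intro prod.cong refl arg_cong[where f=nat]) linarith
    finally have cd: "card {b \<in> fejer_box N. b + k \<in> fejer_box N} = (\<Prod>i\<in>UNIV. nat (int N - \<bar>k $ i\<bar>))" .
    have "real (card {b \<in> fejer_box N. b + k \<in> fejer_box N}) = (\<Prod>i\<in>UNIV. real N - \<bar>real_of_int (k $ i)\<bar>)"
    proof -
      have "real (nat (int N - \<bar>k $ i\<bar>)) = real N - \<bar>real_of_int (k $ i)\<bar>" for i
        using N(2)[of i] by simp
      then show ?thesis unfolding cd of_nat_prod by (intro prod.cong refl)
    qed
    then have "fejer_weight N k = (\<Prod>i\<in>(UNIV::'n set). (real N - \<bar>real_of_int (k $ i)\<bar>) / real N)"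
      by (simp only: fejer_weight_eq_card prod_dividef prod_constant)
    moreover have "(real N - r) / real N = 1 - r / real N" for r
      using N(1) by (simp add: field_simps)
    ultimately show ?thesis by (simp only:)
  qed
  have "\<forall>\<^sub>F N in sequentially. \<bar>k $ i\<bar> \<le> int N" for i
    using eventually_ge_at_top[of "nat \<bar>k $ i\<bar>"] by eventually_elim linarith
  then have "\<forall>\<^sub>F N in sequentially. \<forall>i. \<bar>k $ i\<bar> \<le> int N"
    by (rule eventually_all_finite)
  then have ev: "\<forall>\<^sub>F N in sequentially. (\<Prod>i\<in>UNIV. 1 - \<bar>real_of_int (k $ i)\<bar> / real N) = fejer_weight N k"
    using eventually_gt_at_top[of 0] by eventually_elim (simp add: eq)
  have "(\<lambda>N. \<Prod>i\<in>(UNIV::'n set). 1 - \<bar>real_of_int (k $ i)\<bar> / real N) \<longlonglongrightarrow> (\<Prod>i\<in>(UNIV::'n set). 1 - 0)"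
    by (intro tendsto_prod tendsto_diff tendsto_const real_tendsto_divide_at_top[OF tendsto_const filterlim_real_sequentially])
  then show ?thesis using Lim_transform_eventually[OF _ ev] by simp
qed

text \<open>Grouping the pairs (a, b) by their difference shows that the kernel is, up to the
  normalisation, the square modulus of the sum of exp(i a . z) over the box: a sum of two real
  squares.\<close>

lemma fejer_kernel_nonneg:
  fixes z :: "real^'n"
  shows "0 \<le> (\<Sum>k\<in>fejer_set N. fejer_weight N k * cos (wave L k \<bullet> z))"
proof -
  let ?B = "fejer_box N :: (int^'n) set"
  have fin: "finite (?B \<times> ?B)" by (intro finite_cartesian_product finite_fejer_box)
  have sub: "(\<lambda>p. fst p - snd p) ` (?B \<times> ?B) \<subseteq> fejer_set N"
    by (auto simp: fejer_box_def fejer_set_def abs_less_iff) (smt (verit))+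
  have "(\<Sum>k\<in>fejer_set N. fejer_weight N k * cos (wave L k \<bullet> z))
      = (\<Sum>k\<in>fejer_set N. \<Sum>p\<in>{p \<in> ?B \<times> ?B. fst p - snd p = k}. cos (wave L (fst p - snd p) \<bullet> z)) / real N ^ CARD('n)"
    unfolding sum_divide_distrib by (intro sum.cong refl) (simp add: fejer_weight_def)
  also have "(\<Sum>k\<in>fejer_set N. \<Sum>p\<in>{p \<in> ?B \<times> ?B. fst p - snd p = k}. cos (wave L (fst p - snd p) \<bullet> z))
      = (\<Sum>p\<in>?B \<times> ?B. cos (wave L (fst p - snd p) \<bullet> z))"
    by (rule sum.group[OF fin finite_fejer_set sub])
  also have "\<dots> = (\<Sum>a\<in>?B. \<Sum>b\<in>?B. cos (wave L a \<bullet> z) * cos (wave L b \<bullet> z) + sin (wave L a \<bullet> z) * sin (wave L b \<bullet> z))"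
    by (simp add: sum.cartesian_product case_prod_beta wave_diff inner_diff_left cos_diff)
  also have "\<dots> = (\<Sum>a\<in>?B. cos (wave L a \<bullet> z))\<^sup>2 + (\<Sum>a\<in>?B. sin (wave L a \<bullet> z))\<^sup>2"
    by (simp add: sum.distrib power2_eq_square sum_product)
  finally show ?thesis by simp
qed

text \<open>A multiplier as a convolution, by the cosine of a difference. Through this form the sign
  of the kernel becomes a sup bound.\<close>

lemma fmult_eq_kernel:
  fixes f :: "real^'n \<Rightarrow> real"
  assumes "L2_field L f"
  shows "fmult L A w f x = l2_inner L f (\<lambda>y. \<Sum>k\<in>A. w k * cos (wave L k \<bullet> (x - y))) / L ^ CARD('n)"
proof -
  have "l2_inner L f (\<lambda>y. \<Sum>k\<in>A. w k * cos (wave L k \<bullet> (x - y)))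
    = l2_inner L f (\<lambda>y. \<Sum>k\<in>A. w k * cosw L k x * cosw L k y + w k * sinw L k x * sinw L k y)"
    by (simp add: inner_diff_right cos_diff cosw_def sinw_def algebra_simps)
  also have "\<dots> = (\<Sum>k\<in>A. l2_inner L f (\<lambda>y. w k * cosw L k x * cosw L k y + w k * sinw L k x * sinw L k y))"
    by (intro l2_inner_sum_right L2_field_add L2_field_cmult L2_cosw L2_sinw assms)
  also have "\<dots> = (\<Sum>k\<in>A. w k * cosw L k x * l2_inner L f (cosw L k) + w k * sinw L k x * l2_inner L f (sinw L k))"
    by (simp only: l2_inner_cmult_right l2_inner_add_right[OF L2_field_cmult[OF L2_cosw] L2_field_cmult[OF L2_sinw] assms])
  finally show ?thesis
    by (simp add: fmult_def sum_divide_distrib algebra_simps add_divide_distrib)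
qed

text \<open>The kernel is nonnegative and its mass is the volume times the weight of the zero mode,
  which is at most 1. So the mean is an average with total weight at most 1.\<close>

lemma fejer_bounded:
  fixes f :: "real^'n \<Rightarrow> real"
  assumes L: "0 < L" and f: "f \<in> borel_measurable (Omega L)" and M: "\<And>x. \<bar>f x\<bar> \<le> M"
  shows "\<bar>fejer L N f x\<bar> \<le> M"
proof -
  let ?K = "\<lambda>y. \<Sum>k\<in>fejer_set N. fejer_weight N k * cos (wave L k \<bullet> (x - y))"
  have f2: "L2_field L f" using f M by (intro L2_field_bounded[of f L M]) auto
  have M0: "0 \<le> M" using M[of 0] by simp
  have K: "0 \<le> ?K y" for y by (rule fejer_kernel_nonneg)
  have K2: "L2_field L ?K" by (intro L2_field_continuous continuous_intros)
  have one: "L2_field L (\<lambda>_::real^'n. 1::real)" by (intro L2_field_continuous continuous_intros)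
  have "l2_inner L (\<lambda>_. 1) ?K \<le> L ^ CARD('n)"
  proof -
    \<comment> \<open>The mass of the kernel is read off from the multiplier applied to the constant
      1, which sees only the zero mode.\<close>
    have "l2_inner L (\<lambda>_. 1) ?K = L ^ CARD('n) * fmult L (fejer_set N) (fejer_weight N) (\<lambda>_. 1) x"
      using L by (simp add: fmult_eq_kernel[OF one])
    also have "fmult L (fejer_set N) (fejer_weight N) (\<lambda>_::real^'n. 1) x
       = (\<Sum>k\<in>(fejer_set N :: (int^'n) set). if k = 0 then fejer_weight N k else 0)"
      unfolding fmult_def l2_inner_def using L
      by (intro sum.cong refl) (simp add: integral_cosw[OF L] integral_sinw[OF L])
    also have "\<dots> \<le> 1"
      using fejer_weight_abs_le[of N "0 :: int^'n"] by (simp add: sum.delta[OF finite_fejer_set] abs_le_iff)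
    finally show ?thesis using L by simp
  qed
  moreover have "\<bar>l2_inner L f ?K\<bar> \<le> M * l2_inner L (\<lambda>_. 1) ?K"
  proof -
    have "\<bar>l2_inner L f ?K\<bar> \<le> (LINT y|Omega L. \<bar>f y * ?K y\<bar>)"
      unfolding l2_inner_def inner_real_def by (rule integral_abs_bound)
    also have "\<dots> \<le> (LINT y|Omega L. M * ?K y)"
    proof (rule integral_mono)
      show "integrable (Omega L) (\<lambda>y. \<bar>f y * ?K y\<bar>)"
        by (intro Bochner_Integration.integrable_abs L2_field_mult_integrable f2 K2)
      show "integrable (Omega L) (\<lambda>y. M * ?K y)"
        by (intro integrable_mult_right L2_field_integrable K2)
      show "\<bar>f y * ?K y\<bar> \<le> M * ?K y" for y
        unfolding abs_mult abs_of_nonneg[OF K] by (rule mult_right_mono[OF M K])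
    qed
    finally show ?thesis by (simp add: l2_inner_def)
  qed
  ultimately have "\<bar>l2_inner L f ?K\<bar> \<le> M * L ^ CARD('n)"
    using M0 by (meson mult_left_mono order_trans)
  then show ?thesis
    using L by (simp add: fejer_def fmult_eq_kernel[OF f2] pos_divide_le_eq)
qed

lemma L2_fejer: "L2_field L (fejer L N f)"
  by (simp add: fejer_def L2_fmult)

lemma l2_norm_fejer_le:
  assumes "0 < L" "L2_field L f"
  shows "l2_norm L (fejer L N f) \<le> l2_norm L f"
  unfolding fejer_def by (intro Bessel_fmult fejer_even_weights fejer_weight_abs_le assms)

section \<open>Convergence of the Fejer means\<close>

lemma l2_norm_dominated_convergence:
  fixes f :: "real^'n \<Rightarrow> 'b::euclidean_space" and h :: "real^'n \<Rightarrow> real"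
  assumes meas: "\<And>n. F n \<in> borel_measurable (Omega L)" "f \<in> borel_measurable (Omega L)"
    and h: "L2_field L h" and dom: "\<And>n x. x \<in> cbox 0 (\<chi> i. L) \<Longrightarrow> norm (F n x - f x) \<le> h x"
    and lim: "AE x in Omega L. (\<lambda>n. F n x) \<longlonglongrightarrow> f x"
  shows "(\<lambda>n. l2_norm L (\<lambda>x. F n x - f x)) \<longlonglongrightarrow> 0"
proof -
  have "(\<lambda>n. LINT x|Omega L. (norm (F n x - f x))\<^sup>2) \<longlonglongrightarrow> (LINT x|(Omega L :: (real^'n) measure). 0)"
  proof (rule integral_dominated_convergence[where w="\<lambda>x. (h x)\<^sup>2"])
    show "integrable (Omega L) (\<lambda>x. (h x)\<^sup>2)" using h by (simp add: L2_field_def)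
    show "(\<lambda>x. (norm (F n x - f x))\<^sup>2) \<in> borel_measurable (Omega L)" for n using meas by simp
    show "AE x in Omega L. (\<lambda>n. (norm (F n x - f x))\<^sup>2) \<longlonglongrightarrow> 0"
      using lim
    proof eventually_elim
      case (elim x)
      then have "(\<lambda>n. (norm (F n x - f x))\<^sup>2) \<longlonglongrightarrow> (norm (f x - f x))\<^sup>2" by (intro tendsto_intros)
      then show ?case by simp
    qed
    show "AE x in Omega L. norm ((norm (F n x - f x))\<^sup>2) \<le> (h x)\<^sup>2" for n
      using dom by (auto intro!: AE_I2 power_mono simp: space_Omega)
  qed simp
  then have "(\<lambda>n. sqrt (LINT x|Omega L. (norm (F n x - f x))\<^sup>2)) \<longlonglongrightarrow> sqrt (LINT x|(Omega L :: (real^'n) measure). 0)"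
    by (rule tendsto_real_sqrt)
  then show ?thesis by (simp add: l2_norm_def)
qed

text \<open>Convergence is made a predicate so that it can be carried through linear combinations,
  L2 limits and the induction over Borel sets.\<close>

definition fejer_converges :: "real \<Rightarrow> (real^'n \<Rightarrow> real) \<Rightarrow> bool" where
  "fejer_converges L f \<longleftrightarrow> L2_field L f \<and> (\<lambda>N. l2_norm L (\<lambda>x. fejer L N f x - f x)) \<longlonglongrightarrow> 0"

lemma fejer_converges_add:
  assumes "fejer_converges L f" "fejer_converges L h"
  shows "fejer_converges L (\<lambda>x. f x + h x)"
  unfolding fejer_converges_def
proof
  have f: "L2_field L f" and h: "L2_field L h" using assms by (auto simp: fejer_converges_def)
  show "L2_field L (\<lambda>x. f x + h x)" by (rule L2_field_add[OF f h])
  have lim: "(\<lambda>N. l2_norm L (\<lambda>x. fejer L N f x - f x) + l2_norm L (\<lambda>x. fejer L N h x - h x)) \<longlonglongrightarrow> 0 + 0"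
    using assms by (intro tendsto_add) (auto simp: fejer_converges_def)
  have bd: "l2_norm L (\<lambda>x. fejer L N (\<lambda>x. f x + h x) x - (f x + h x))
      \<le> l2_norm L (\<lambda>x. fejer L N f x - f x) + l2_norm L (\<lambda>x. fejer L N h x - h x)" for N
  proof -
    have eq: "fejer L N (\<lambda>x. f x + h x) x - (f x + h x) = (fejer L N f x - f x) + (fejer L N h x - h x)" for x
      by (simp add: fejer_def fmult_def l2_inner_add_left[OF f h L2_cosw] l2_inner_add_left[OF f h L2_sinw]
          algebra_simps add_divide_distrib sum.distrib)
    show ?thesis
      unfolding eq by (rule l2_norm_triangle[OF L2_field_diff[OF L2_fejer f] L2_field_diff[OF L2_fejer h]])
  qed
  show "(\<lambda>N. l2_norm L (\<lambda>x. fejer L N (\<lambda>x. f x + h x) x - (f x + h x))) \<longlonglongrightarrow> 0"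
  proof (rule Lim_null_comparison[OF always_eventually lim[simplified]], rule allI)
    fix N
    show "norm (l2_norm L (\<lambda>x. fejer L N (\<lambda>x. f x + h x) x - (f x + h x)))
        \<le> l2_norm L (\<lambda>x. fejer L N f x - f x) + l2_norm L (\<lambda>x. fejer L N h x - h x)"
      using bd[of N] unfolding real_norm_def abs_of_nonneg[OF l2_norm_nonneg] .
  qed
qed

lemma fejer_converges_cmult:
  assumes "fejer_converges L f"
  shows "fejer_converges L (\<lambda>x. c * f x)"
  unfolding fejer_converges_def
proof
  show "L2_field L (\<lambda>x. c * f x)" using assms by (auto simp: fejer_converges_def intro: L2_field_cmult)
  have "(\<lambda>N. \<bar>c\<bar> * l2_norm L (\<lambda>x. fejer L N f x - f x)) \<longlonglongrightarrow> \<bar>c\<bar> * 0"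
    using assms by (intro tendsto_intros) (auto simp: fejer_converges_def)
  then show "(\<lambda>N. l2_norm L (\<lambda>x. fejer L N (\<lambda>x. c * f x) x - c * f x)) \<longlonglongrightarrow> 0"
    by (simp add: fejer_def fmult_cmult l2_norm_cmult flip: right_diff_distrib)
qed

text \<open>The class is closed in L2 by an \<epsilon> / 3 argument: the Fejer means contract the
  norm uniformly in N.\<close>

lemma fejer_converges_limit:
  fixes f :: "real^'n \<Rightarrow> real"
  assumes L: "0 < L" and F: "\<And>n. fejer_converges L (F n)" and f: "L2_field L f"
    and lim: "(\<lambda>n. l2_norm L (\<lambda>x. F n x - f x)) \<longlonglongrightarrow> 0"
  shows "fejer_converges L f"
  unfolding fejer_converges_def
proof (intro conjI f LIMSEQ_I)
  fix \<epsilon> :: real assume e: "0 < \<epsilon>"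
  from LIMSEQ_D[OF lim, of "\<epsilon> / 3"] e obtain n where n: "l2_norm L (\<lambda>x. F n x - f x) < \<epsilon> / 3"
    by (auto simp: l2_norm_nonneg)
  have Fn: "L2_field L (F n)" using F by (simp add: fejer_converges_def)
  have "(\<lambda>N. l2_norm L (\<lambda>x. fejer L N (F n) x - F n x)) \<longlonglongrightarrow> 0" using F by (simp add: fejer_converges_def)
  from LIMSEQ_D[OF this, of "\<epsilon> / 3"] e obtain N0 where
    N0: "\<And>N. N \<ge> N0 \<Longrightarrow> l2_norm L (\<lambda>x. fejer L N (F n) x - F n x) < \<epsilon> / 3"
    by (auto simp: l2_norm_nonneg)
  show "\<exists>N0. \<forall>N\<ge>N0. norm (l2_norm L (\<lambda>x. fejer L N f x - f x) - 0) < \<epsilon>"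
  proof (intro exI allI impI)
    fix N assume "N0 \<le> N"
    let ?a = "\<lambda>x. fejer L N (\<lambda>y. f y - F n y) x" and ?b = "\<lambda>x. fejer L N (F n) x - F n x" and ?c = "\<lambda>x. F n x - f x"
    have b: "L2_field L ?b" and c: "L2_field L ?c" by (intro L2_field_diff L2_fejer Fn f)+
    have "l2_norm L (\<lambda>x. fejer L N f x - f x) = l2_norm L (\<lambda>x. ?a x + (?b x + ?c x))"
      by (simp add: fejer_def fmult_diff[OF f Fn])
    also have "\<dots> \<le> l2_norm L ?a + (l2_norm L ?b + l2_norm L ?c)"
      using l2_norm_triangle[OF L2_fejer L2_field_add[OF b c]] l2_norm_triangle[OF b c] by (meson add_left_mono order_trans)
    also have "l2_norm L ?a \<le> l2_norm L ?c"
      using l2_norm_fejer_le[OF L L2_field_diff[OF f Fn]] l2_norm_minus_commute[of L f "F n"] by simp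
    finally show "norm (l2_norm L (\<lambda>x. fejer L N f x - f x) - 0) < \<epsilon>"
      using n N0[OF \<open>N0 \<le> N\<close>] by (simp add: l2_norm_nonneg)
  qed
qed

text \<open>On a cell of finite measure, bounded convergence almost everywhere implies L2
  convergence; this is the form of the closure used for indicators.\<close>

lemma fejer_converges_bounded_limit:
  fixes f :: "real^'n \<Rightarrow> real"
  assumes L: "0 < L" and F: "\<And>n. fejer_converges L (F n)" and f: "f \<in> borel_measurable (Omega L)"
    and bd: "\<And>n x. x \<in> cbox 0 (\<chi> i. L) \<Longrightarrow> \<bar>F n x\<bar> \<le> B" "\<And>x. x \<in> cbox 0 (\<chi> i. L) \<Longrightarrow> \<bar>f x\<bar> \<le> B"
    and lim: "AE x in Omega L. (\<lambda>n. F n x) \<longlonglongrightarrow> f x"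
  shows "fejer_converges L f"
proof (rule fejer_converges_limit[OF L F])
  show "L2_field L f" using f bd(2) by (intro L2_field_bounded[of f L B]) auto
  show "(\<lambda>n. l2_norm L (\<lambda>x. F n x - f x)) \<longlonglongrightarrow> 0"
  proof (rule l2_norm_dominated_convergence[OF _ f _ _ lim])
    show "F n \<in> borel_measurable (Omega L)" for n using F by (simp add: fejer_converges_def L2_field_def)
    show "L2_field L (\<lambda>x::real^'n. 2 * B)" by (intro L2_field_continuous continuous_intros)
    show "norm (F n x - f x) \<le> 2 * B" if "x \<in> cbox 0 (\<chi> i. L)" for n x
      using bd(1)[OF that, of n] bd(2)[OF that] by simp
  qed
qed

text \<open>As soon as l lies in the index set, the mean multiplies the mode by its weight, and the
  weight tends to 1.\<close>

lemma fejer_converges_wave: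
  fixes l :: "int^'n"
  assumes L: "0 < L"
  shows "fejer_converges L (cosw L l)" and "fejer_converges L (sinw L l)"
proof -
  have S: "\<forall>\<^sub>F N in sequentially. l \<in> fejer_set N"
  proof -
    have "\<forall>\<^sub>F N in sequentially. \<bar>l $ i\<bar> < int N" for i
      using eventually_gt_at_top[of "nat \<bar>l $ i\<bar>"] by eventually_elim linarith
    then show ?thesis unfolding fejer_set_def mem_Collect_eq by (rule eventually_all_finite)
  qed
  have ew: "\<And>N. even_weights (fejer_set N) (fejer_weight N :: int^'n \<Rightarrow> real)" by (rule fejer_even_weights)
  have mem: "- l \<in> fejer_set N \<longleftrightarrow> l \<in> fejer_set N" and wm: "fejer_weight N (- l) = fejer_weight N l" for N
    using ew[of N] by (auto simp: even_weights_def)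
  have c: "fejer L N (cosw L l) x = fejer_weight N l * cosw L l x" if "l \<in> fejer_set N" for N x
  proof -
    have "fejer L N (cosw L l) x = (\<Sum>k\<in>fejer_set N. (if k = l then fejer_weight N l * cosw L l x / 2 else 0))
        + (\<Sum>k\<in>fejer_set N. (if k = - l then fejer_weight N l * cosw L l x / 2 else 0))"
      unfolding fejer_def fmult_def sum.distrib[symmetric] l2_inner_commute[of L "cosw L l" "sinw L _"]
        inner_cosw_cosw[OF L] inner_sinw_cosw[OF L] of_bool_def eq_commute[of l] minus_equation_iff[of _ l]
      by (intro sum.cong refl) (use L in \<open>auto simp: wm\<close>)
    also have "\<dots> = fejer_weight N l * cosw L l x"
      using that by (simp add: sum.delta[OF finite_fejer_set] mem)
    finally show ?thesis .
  qed
  have s: "fejer L N (sinw L l) x = fejer_weight N l * sinw L l x" if "l \<in> fejer_set N" for N x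
  proof -
    \<comment> \<open>When l and -l coincide the two index conditions agree but have opposite signs
      in the sine relation; the sine itself vanishes then.\<close>
    have self: "sinw L l x = 0" if "2 * l = 0"
    proof -
      have "l + l = 0" using that by (simp only: mult_2)
      then have eq: "- l = l" by (simp only: neg_eq_iff_add_eq_0)
      show ?thesis using sinw_minus[of L l x] unfolding eq by simp
    qed
    have "fejer L N (sinw L l) x = (\<Sum>k\<in>fejer_set N. (if k = l then fejer_weight N l * sinw L l x / 2 else 0))
        + (\<Sum>k\<in>fejer_set N. (if k = - l then fejer_weight N l * sinw L l x / 2 else 0))"
      unfolding fejer_def fmult_def sum.distrib[symmetric]
        inner_sinw_sinw[OF L] inner_sinw_cosw[OF L] of_bool_def eq_commute[of l] minus_equation_iff[of _ l]
      by (intro sum.cong refl) (use L sinw_minus[of L l x] self in \<open>auto simp: wm\<close>)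
    also have "\<dots> = fejer_weight N l * sinw L l x"
      using that by (simp add: sum.delta[OF finite_fejer_set] mem)
    finally show ?thesis .
  qed
  have lim: "(\<lambda>N. \<bar>fejer_weight N l - 1\<bar> * n) \<longlonglongrightarrow> 0" for n
  proof -
    have "(\<lambda>N. \<bar>fejer_weight N l - 1\<bar> * n) \<longlonglongrightarrow> \<bar>1 - 1\<bar> * n"
      by (intro tendsto_intros fejer_weight_tendsto)
    then show ?thesis by simp
  qed
  have "\<forall>\<^sub>F N in sequentially. \<bar>fejer_weight N l - 1\<bar> * l2_norm L (cosw L l) = l2_norm L (\<lambda>x. fejer L N (cosw L l) x - cosw L l x)"
    using S
  proof eventually_elim
    case (elim N)
    have eq: "fejer L N (cosw L l) x - cosw L l x = (fejer_weight N l - 1) * cosw L l x" for x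
      unfolding c[OF elim] by (simp add: left_diff_distrib)
    show ?case unfolding eq l2_norm_cmult by (rule refl)
  qed
  from Lim_transform_eventually[OF lim this] show "fejer_converges L (cosw L l)"
    by (simp add: fejer_converges_def L2_cosw)
  have "\<forall>\<^sub>F N in sequentially. \<bar>fejer_weight N l - 1\<bar> * l2_norm L (sinw L l) = l2_norm L (\<lambda>x. fejer L N (sinw L l) x - sinw L l x)"
    using S
  proof eventually_elim
    case (elim N)
    have eq: "fejer L N (sinw L l) x - sinw L l x = (fejer_weight N l - 1) * sinw L l x" for x
      unfolding s[OF elim] by (simp add: left_diff_distrib)
    show ?case unfolding eq l2_norm_cmult by (rule refl)
  qed
  from Lim_transform_eventually[OF lim this] show "fejer_converges L (sinw L l)"
    by (simp add: fejer_converges_def L2_sinw)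
qed

section \<open>Trigonometric polynomials and the passage from them to all of L2\<close>

inductive trig_poly :: "real \<Rightarrow> (real^'n \<Rightarrow> real) \<Rightarrow> bool" for L where
  cosw: "trig_poly L (cosw L k)"
| sinw: "trig_poly L (sinw L k)"
| add: "trig_poly L f \<Longrightarrow> trig_poly L h \<Longrightarrow> trig_poly L (\<lambda>x. f x + h x)"
| cmult: "trig_poly L f \<Longrightarrow> trig_poly L (\<lambda>x. c * f x)"

lemma trig_poly_const: "trig_poly L (\<lambda>x. c)"
  using trig_poly.cmult[OF trig_poly.cosw[of L 0], of c] by simp

lemma trig_poly_lincomb2:
  "trig_poly L f \<Longrightarrow> trig_poly L h \<Longrightarrow> trig_poly L (\<lambda>x. a * f x + b * h x)"
  by (intro trig_poly.add trig_poly.cmult)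

text \<open>Closure under products is not built into the inductive definition. It comes from the
  product-to-sum formulas, one factor being a single mode here.\<close>

lemma trig_poly_mult_wave:
  assumes "trig_poly L f"
  shows "trig_poly L (\<lambda>x. cosw L k x * f x)" and "trig_poly L (\<lambda>x. sinw L k x * f x)"
  using assms
proof (induction f)
  case (cosw l)
  have eq: "cosw L k x * cosw L l x = 1/2 * cosw L (k - l) x + 1/2 * cosw L (k + l) x"
    "sinw L k x * cosw L l x = 1/2 * sinw L (k + l) x + 1/2 * sinw L (k - l) x" for x
    by (simp_all add: cosw_def sinw_def cos_times_cos sin_times_cos wave_add wave_diff inner_add_left inner_diff_left)
  show "trig_poly L (\<lambda>x. cosw L k x * cosw L l x)" "trig_poly L (\<lambda>x. sinw L k x * cosw L l x)"
    unfolding eq by (intro trig_poly_lincomb2 trig_poly.cosw trig_poly.sinw)+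
next
  case (sinw l)
  have eq: "cosw L k x * sinw L l x = 1/2 * sinw L (k + l) x + (- 1/2) * sinw L (k - l) x"
    "sinw L k x * sinw L l x = 1/2 * cosw L (k - l) x + (- 1/2) * cosw L (k + l) x" for x
    by (simp_all add: cosw_def sinw_def cos_times_sin sin_times_sin wave_add wave_diff inner_add_left inner_diff_left)
  show "trig_poly L (\<lambda>x. cosw L k x * sinw L l x)" "trig_poly L (\<lambda>x. sinw L k x * sinw L l x)"
    unfolding eq by (intro trig_poly_lincomb2 trig_poly.cosw trig_poly.sinw)+
next
  case (add f h)
  show "trig_poly L (\<lambda>x. cosw L k x * (f x + h x))" "trig_poly L (\<lambda>x. sinw L k x * (f x + h x))"
    unfolding distrib_left by (intro trig_poly.add add.IH)+
next
  case (cmult f c)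
  show "trig_poly L (\<lambda>x. cosw L k x * (c * f x))" "trig_poly L (\<lambda>x. sinw L k x * (c * f x))"
    unfolding mult.left_commute[of _ c] by (intro trig_poly.cmult cmult.IH)+
qed

lemma trig_poly_mult:
  assumes "trig_poly L f" "trig_poly L h"
  shows "trig_poly L (\<lambda>x. f x * h x)"
  using assms
proof (induction f)
  case (add f1 f2)
  then show ?case unfolding distrib_right by (intro trig_poly.add)
next
  case (cmult f c)
  then show ?case unfolding mult.assoc by (intro trig_poly.cmult)
qed (simp_all add: trig_poly_mult_wave)

lemma trig_poly_prod:
  "(\<And>i. i \<in> I \<Longrightarrow> trig_poly L (f i)) \<Longrightarrow> trig_poly L (\<lambda>x. \<Prod>i\<in>I. f i x)"
  by (induction I rule: infinite_finite_induct) (auto intro: trig_poly_const trig_poly_mult)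

lemma trig_poly_compose_polynomial:
  fixes p :: "real \<Rightarrow> real"
  assumes "real_polynomial_function p" "trig_poly L f"
  shows "trig_poly L (\<lambda>x. p (f x))"
  using assms
proof (induction p)
  case (linear p)
  \<comment> \<open>A linear function on the line is multiplication by its value at 1.\<close>
  then have "p y = p 1 * y" for y
    using linear_simps(5)[of p y 1] by simp
  with linear show ?case by (metis (no_types, lifting) ext trig_poly.cmult)
qed (auto intro: trig_poly_const trig_poly.add trig_poly_mult)

lemma trig_poly_cos_coordinate:
  fixes i :: "'n::finite"
  shows "trig_poly L (\<lambda>x::real^'n. cos (2 * pi / L * (x $ i - c)))"
proof -
  have w: "wave L (axis i 1) \<bullet> x = 2 * pi / L * x $ i" for x :: "real^'n"
  proof -
    have "wave L (axis i 1) = (2 * pi / L) *\<^sub>R axis i 1"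
      by (simp add: wave_def vec_eq_iff axis_def)
    then show ?thesis by (simp add: inner_axis')
  qed
  have "cos (2 * pi / L * (x $ i - c))
    = cos (2 * pi / L * c) * cosw L (axis i 1) x + sin (2 * pi / L * c) * sinw L (axis i 1) x" for x :: "real^'n"
    unfolding cosw_def sinw_def w right_diff_distrib cos_diff by simp
  then show ?thesis
    by (simp only: trig_poly_lincomb2 trig_poly.cosw trig_poly.sinw)
qed

lemma fejer_converges_trig_poly:
  assumes L: "0 < L" and f: "trig_poly L f"
  shows "fejer_converges L f"
  using f by induction (simp_all add: L fejer_converges_wave fejer_converges_add fejer_converges_cmult)

lemma cos_mult_abs: "cos (a * \<bar>y\<bar>) = cos (a * y :: real)"
  by (cases "0 \<le> y") simp_all

text \<open>
  An open subinterval of the period is a superlevel set of a shifted cosine, so its indicator is a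
  bounded limit of polynomials in that cosine.
\<close>

lemma interval_indicator_trig_limit:
  fixes i :: "'n::finite"
  assumes L: "0 < L" and ab: "0 \<le> a" "a \<le> b" "b \<le> L"
  shows "\<exists>F :: nat \<Rightarrow> real^'n \<Rightarrow> real. (\<forall>n. trig_poly L (F n)) \<and> (\<forall>n x. \<bar>F n x\<bar> \<le> 2) \<and>
    (\<forall>x\<in>cbox 0 (\<chi> i. L). (\<lambda>n. F n x) \<longlonglongrightarrow> indicator {x. a < x $ i \<and> x $ i < b} x)"
proof -
  \<comment> \<open>Centre and half-width of the interval; y0 will be the value of the shifted
    cosine at its endpoints.\<close>
  define c r where "c = (a + b) / 2" and "r = (b - a) / 2"
  define y0 where "y0 = cos (2 * pi / L * r)"
  \<comment> \<open>Ramps of slope n that vanish up to y0 and are capped at 1. They tend pointwise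
    to the indicator of y > y0 and are continuous, so that Weierstrass approximation applies to
    each.\<close>
  define S where "S n y = max 0 (min 1 (real n * (y - y0)))" for n y
  have "\<exists>p. real_polynomial_function p \<and> (\<forall>y\<in>{-1..1}. \<bar>S n y - p y\<bar> < 1 / real (Suc n))" for n
  proof -
    have "continuous_on {-1..1} (S n)" unfolding S_def by (intro continuous_intros)
    from Stone_Weierstrass_real_polynomial_function[OF compact_Icc this, of "1 / real (Suc n)"]
    show ?thesis by (metis of_nat_0_less_iff zero_less_Suc zero_less_divide_1_iff)
  qed
  then obtain p where p: "\<And>n. real_polynomial_function (p n)"
    and pS: "\<And>n y. y \<in> {-1..1} \<Longrightarrow> \<bar>S n y - p n y\<bar> < 1 / real (Suc n)" by metis
  define C where "C x = cos (2 * pi / L * (x $ i - c))" for x :: "real^'n"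
  have C1: "C x \<in> {-1..1}" for x by (simp add: C_def)
  show ?thesis
  proof (intro exI[of _ "\<lambda>n x. p n (C x)"] conjI allI ballI)
    show "trig_poly L (\<lambda>x. p n (C x))" for n
      unfolding C_def by (intro trig_poly_compose_polynomial[OF p] trig_poly_cos_coordinate)
    show "\<bar>p n (C x)\<bar> \<le> 2" for n x
    proof -
      have "1 / real (Suc n) \<le> 1" by simp
      moreover have "\<bar>S n (C x)\<bar> \<le> 1" by (simp add: S_def)
      ultimately show ?thesis using pS[OF C1[of x], of n] by linarith
    qed
    fix x :: "real^'n" assume "x \<in> cbox 0 (\<chi> i. L)"
    then have xi: "0 \<le> x $ i" "x $ i \<le> L" by (simp_all add: mem_box_cart)
    have iff: "y0 < C x \<longleftrightarrow> a < x $ i \<and> x $ i < b"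
    proof -
      define d where "d = \<bar>x $ i - c\<bar>"
      \<comment> \<open>The distance to the centre may exceed half a period, where the cosine
        increases again. Since d is at most L - r, the reflected distance L - d is still at least r,
        so the cosine stays at or below y0.\<close>
      have d: "0 \<le> d" "d \<le> L - r" and r: "0 \<le> r" "r \<le> L / 2"
        using xi ab by (auto simp: d_def c_def r_def abs_le_iff field_simps)
      have Cd: "C x = cos (2 * pi / L * d)"
        unfolding C_def d_def by (rule cos_mult_abs[symmetric])
      have L0: "0 < 2 * pi / L" using L by simp
      have le_pi: "2 * pi / L * s \<le> pi" if "s \<le> L / 2" for s
      proof -
        have "2 * pi / L * s \<le> 2 * pi / L * (L / 2)" using L0 that by (intro mult_left_mono) auto
        then show ?thesis using L by simp
      qed
      have mono: "cos (2 * pi / L * s) \<le> cos (2 * pi / L * r)" if "r \<le> s" "s \<le> L / 2" for s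
        using mult_nonneg_nonneg[OF less_imp_le[OF L0] r(1)] mult_left_mono[OF that(1) less_imp_le[OF L0]] le_pi[OF that(2)]
        by (rule cos_monotone_0_pi_le)
      have "y0 < C x \<longleftrightarrow> d < r"
      proof
        assume "d < r"
        then show "y0 < C x"
          unfolding Cd y0_def
          by (intro cos_monotone_0_pi mult_nonneg_nonneg[OF less_imp_le[OF L0] d(1)] le_pi[OF r(2)]
              mult_strict_left_mono[OF _ L0])
      next
        assume less: "y0 < C x"
        show "d < r"
        proof (rule ccontr)
          assume nd: "\<not> d < r"
          have "C x \<le> y0"
          proof (cases "d \<le> L / 2")
            case True
            then show ?thesis using mono[of d] nd by (simp add: Cd y0_def)
          next
            case False
            have "cos (2 * pi / L * d) = cos (2 * pi / L * (L - d))"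
              using L by (simp add: right_diff_distrib cos_diff)
            then show ?thesis using mono[of "L - d"] False d by (simp add: Cd y0_def)
          qed
          with less show False by simp
        qed
      qed
      also have "d < r \<longleftrightarrow> a < x $ i \<and> x $ i < b"
        unfolding d_def c_def r_def abs_less_iff by (intro iffI conjI; elim conjE; simp add: field_simps)
      finally show ?thesis .
    qed
    have S_lim: "(\<lambda>n. S n (C x)) \<longlonglongrightarrow> indicator {x. a < x $ i \<and> x $ i < b} x"
    proof (cases "y0 < C x")
      case True
      obtain N :: nat where N: "1 / (C x - y0) < real N" using reals_Archimedean2 by blast
      have "S n (C x) = 1" if "N \<le> n" for n
      proof -
        have "1 \<le> real N * (C x - y0)" using N True by (simp add: field_simps)
        also have "\<dots> \<le> real n * (C x - y0)" using that True by (intro mult_right_mono) auto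
        finally show ?thesis by (simp add: S_def)
      qed
      then have "\<forall>\<^sub>F n in sequentially. S n (C x) = 1" unfolding eventually_sequentially by blast
      then show ?thesis using True iff by (simp add: tendsto_eventually)
    next
      case False
      then have "real n * (C x - y0) \<le> 0" for n by (intro mult_nonneg_nonpos) auto
      then have "S n (C x) = 0" for n unfolding S_def by (meson max.absorb1 min.coboundedI2)
      then show ?thesis using False iff by simp
    qed
    have "(\<lambda>n. S n (C x) - p n (C x)) \<longlonglongrightarrow> 0"
    proof (rule Lim_null_comparison[OF always_eventually LIMSEQ_inverse_real_of_nat], rule allI)
      show "norm (S n (C x) - p n (C x)) \<le> inverse (real (Suc n))" for n
        using pS[OF C1[of x], of n] by (simp add: inverse_eq_divide)
    qed
    from tendsto_diff[OF S_lim this]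
    show "(\<lambda>n. p n (C x)) \<longlonglongrightarrow> indicator {x. a < x $ i \<and> x $ i < b} x" by simp
  qed
qed

lemma AE_Omega_interior: "AE x in Omega L. x \<in> box 0 (\<chi> i. L)"
proof -
  have "negligible (cbox 0 (\<chi> i. L) - box 0 (\<chi> i. L) :: (real^'a) set)"
    by (rule negligible_frontier_interval)
  then have "AE x in lebesgue. x \<notin> (cbox 0 (\<chi> i. L) - box 0 (\<chi> i. L) :: (real^'a) set)"
    by (intro AE_not_in) (simp add: negligible_iff_null_sets)
  then show ?thesis
    unfolding Omega_def by (auto simp: AE_restrict_space_iff elim!: eventually_mono)
qed

lemma fejer_converges_0: "0 < L \<Longrightarrow> fejer_converges L (\<lambda>x. 0)"
  by (intro fejer_converges_trig_poly trig_poly_const)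

lemma borel_imp_measurable_Omega:
  "f \<in> borel_measurable borel \<Longrightarrow> f \<in> borel_measurable (Omega L)"
  unfolding Omega_def by (intro measurable_restrict_space1 measurable_completion) simp

text \<open>Clipping the box to the cell changes nothing in the interior, and its indicator becomes
  a product of one-variable indicators. If a clipped side is reversed, the box misses the interior
  altogether.\<close>

lemma fejer_converges_box:
  fixes a b :: "real^'n"
  assumes L: "0 < L"
  shows "fejer_converges L (indicator (box a b) :: real^'n \<Rightarrow> real)"
proof -
  define a' b' where "a' i = max (a $ i) 0" and "b' i = min (b $ i) L" for i
  have meas: "(indicator (box a b) :: real^'n \<Rightarrow> real) \<in> borel_measurable (Omega L)"
    by (intro borel_imp_measurable_Omega) simp
  have mem: "x \<in> box a b \<longleftrightarrow> (\<forall>i. a' i < x $ i \<and> x $ i < b' i)" if "x \<in> box 0 (\<chi> i. L)" for x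
    using that by (auto simp: mem_box_cart a'_def b'_def)
  show ?thesis
  proof (cases "\<forall>i. a' i \<le> b' i")
    case True
    have "\<exists>F :: nat \<Rightarrow> real^'n \<Rightarrow> real. (\<forall>n. trig_poly L (F n)) \<and> (\<forall>n x. \<bar>F n x\<bar> \<le> 2) \<and>
        (\<forall>x\<in>cbox 0 (\<chi> i. L). (\<lambda>n. F n x) \<longlonglongrightarrow> indicator {x. a' i < x $ i \<and> x $ i < b' i} x)" for i
      by (rule interval_indicator_trig_limit[OF L]) (use True in \<open>auto simp: a'_def b'_def\<close>)
    from choice[OF allI[OF this]] obtain F :: "'n \<Rightarrow> nat \<Rightarrow> real^'n \<Rightarrow> real" where
      "\<forall>i. (\<forall>n. trig_poly L (F i n)) \<and> (\<forall>n x. \<bar>F i n x\<bar> \<le> 2) \<and>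
        (\<forall>x\<in>cbox 0 (\<chi> i. L). (\<lambda>n. F i n x) \<longlonglongrightarrow> indicator {x. a' i < x $ i \<and> x $ i < b' i} x)" ..
    then have F: "\<And>i n. trig_poly L (F i n)" "\<And>i n x. \<bar>F i n x\<bar> \<le> 2"
      "\<And>i x. x \<in> cbox 0 (\<chi> i. L) \<Longrightarrow> (\<lambda>n. F i n x) \<longlonglongrightarrow> indicator {x. a' i < x $ i \<and> x $ i < b' i} x"
      by blast+
    show ?thesis
    proof (rule fejer_converges_bounded_limit[OF L, where F="\<lambda>n x. \<Prod>i\<in>UNIV. F i n x" and B="2 ^ CARD('n)"])
      show "fejer_converges L (\<lambda>x. \<Prod>i\<in>UNIV. F i n x)" for n
        by (intro fejer_converges_trig_poly[OF L] trig_poly_prod F)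
      show "\<bar>\<Prod>i\<in>UNIV. F i n x\<bar> \<le> 2 ^ CARD('n)" for n x
        unfolding abs_prod using prod_mono[of UNIV "\<lambda>i. \<bar>F i n x\<bar>" "\<lambda>_. 2"] F(2) by simp
      show "\<bar>indicator (box a b) x\<bar> \<le> (2 ^ CARD('n) :: real)" for x :: "real^'n"
        by (simp add: indicator_def)
      show "AE x in Omega L. (\<lambda>n. \<Prod>i\<in>UNIV. F i n x) \<longlonglongrightarrow> indicator (box a b) x"
        using AE_Omega_interior
      proof eventually_elim
        case (elim x)
        have "(\<lambda>n. \<Prod>i\<in>UNIV. F i n x) \<longlonglongrightarrow> (\<Prod>i\<in>UNIV. indicator {x. a' i < x $ i \<and> x $ i < b' i} x)"
          using elim box_subset_cbox by (intro tendsto_prod F) auto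
        also have "(\<Prod>i\<in>UNIV. indicator {x. a' i < x $ i \<and> x $ i < b' i} x) = (indicator (box a b) x :: real)"
        proof (cases "x \<in> box a b")
          case False
          then obtain i where "\<not> (a' i < x $ i \<and> x $ i < b' i)" using mem[OF elim] by blast
          then have "(\<Prod>i\<in>UNIV. indicator {x. a' i < x $ i \<and> x $ i < b' i} x) = (0::real)"
            by (intro prod_zero bexI[of _ i]) (auto simp: indicator_def)
          then show ?thesis using False by simp
        qed (use mem[OF elim] in simp)
        finally show ?case .
      qed
    qed (rule meas)
  next
    case False
    show ?thesis
    proof (rule fejer_converges_bounded_limit[OF L fejer_converges_0[OF L] meas, where B=1])
      show "AE x in Omega L. (\<lambda>n. 0) \<longlonglongrightarrow> (indicator (box a b) x :: real)"
        using AE_Omega_interior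
      proof eventually_elim
        case (elim x)
        have "x \<notin> box a b" using mem[OF elim] False by (meson less_trans less_imp_le)
        then show ?case by simp
      qed
    qed (auto simp: indicator_def)
  qed
qed

text \<open>Open boxes are closed under intersection and generate the Borel sets. The class is
  stable under complements, by linearity, and under disjoint unions, as bounded limits of partial
  sums.\<close>

lemma fejer_converges_borel_set:
  fixes A :: "(real^'n) set"
  assumes L: "0 < L" and A: "A \<in> sets borel"
  shows "fejer_converges L (indicator A :: real^'n \<Rightarrow> real)"
proof -
  let ?G = "range (\<lambda>(a, b). box a b) :: (real^'n) set set"
  have sig: "sets (borel :: (real^'n) measure) = sigma_sets UNIV ?G"
    by (subst borel_eq_box) simp
  have "Int_stable ?G" "?G \<subseteq> Pow UNIV" by (auto simp: Int_stable_def box_Int_box)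
  then show ?thesis
    using A[unfolded sig]
  proof (induction A rule: sigma_sets_induct_disjoint)
    case (basic A)
    then show ?case using fejer_converges_box[OF L] by auto
  next
    case empty
    have "(indicator {} :: real^'n \<Rightarrow> real) = (\<lambda>x. 0)" by (simp add: fun_eq_iff)
    then show ?case using fejer_converges_0[OF L] by simp
  next
    case (compl A)
    have "indicator (UNIV - A) = (\<lambda>x::real^'n. (1::real) + (- 1) * indicator A x)"
      by (auto simp: fun_eq_iff indicator_def)
    moreover have "fejer_converges L \<dots>"
      by (intro fejer_converges_add fejer_converges_cmult compl.IH fejer_converges_trig_poly[OF L] trig_poly_const)
    ultimately show ?case by simp
  next
    case (union A)
    have sum: "fejer_converges L (\<lambda>x. \<Sum>i<n. indicator (A i) x :: real)" for n
      by (induction n) (simp_all add: fejer_converges_0[OF L] fejer_converges_add union.IH)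
    have eq: "(\<Sum>i<n. indicator (A i) x :: real) = indicator (\<Union>i<n. A i) x" for n x
      by (rule indicator_UN_disjoint[symmetric]) (use union.hyps(1) in \<open>auto simp: disjoint_family_on_def\<close>)
    show ?case
    proof (rule fejer_converges_bounded_limit[OF L sum, where B=1])
      have "(\<Union>i. A i) \<in> sets borel" using union.hyps(2) unfolding sig[symmetric] by blast
      then show "(indicator (\<Union>i. A i) :: real^'n \<Rightarrow> real) \<in> borel_measurable (Omega L)"
        by (intro borel_imp_measurable_Omega) simp
      show "AE x in Omega L. (\<lambda>n. \<Sum>i<n. indicator (A i) x :: real) \<longlonglongrightarrow> indicator (\<Union>i. A i) x"
        unfolding eq by (intro AE_I2 LIMSEQ_indicator_UN)
    qed (unfold eq, auto simp: indicator_def)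
  qed
qed

text \<open>Simple functions are finite combinations of indicators of Borel sets, and they
  approximate f in L2; closedness of the class then gives the limit.\<close>

theorem fejer_tendsto:
  fixes f :: "real^'n \<Rightarrow> real"
  assumes L: "0 < L" and f: "L2_field L f"
  shows "(\<lambda>N. l2_norm L (\<lambda>x. fejer L N f x - f x)) \<longlonglongrightarrow> 0"
proof -
  let ?\<Omega> = "cbox 0 (\<chi> i. L) :: (real^'n) set"
  \<comment> \<open>f is only Lebesgue measurable, whereas the class is known for Borel sets; f is
    replaced by a Borel function equal to it almost everywhere.\<close>
  have "(\<lambda>x. indicator ?\<Omega> x *\<^sub>R f x) \<in> borel_measurable lebesgue"
    using L2_field_measurable[OF f] unfolding Omega_def by (subst (asm) borel_measurable_restrict_space_iff) auto
  then obtain f' where f': "f' \<in> borel_measurable lborel" and ae: "AE x in lborel. indicator ?\<Omega> x *\<^sub>R f x = f' x"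
    using completion_ex_borel_measurable_real by blast
  have ae': "AE x in Omega L. f' x = f x"
    using AE_completion[OF ae] unfolding Omega_def by (auto simp: AE_restrict_space_iff elim!: eventually_mono)
  have meas': "f' \<in> borel_measurable (Omega L)"
    using f' by (intro borel_imp_measurable_Omega) simp
  have "integrable (Omega L) (\<lambda>x. (norm (f' x))\<^sup>2)"
    by (rule integrable_cong_AE_imp[OF L2_field_square[OF f]]) (use meas' ae' in \<open>auto elim!: eventually_mono\<close>)
  then have f'2: "L2_field L f'" using meas' by (simp add: L2_field_def)
  obtain s where s: "\<And>n. simple_function borel (s n)" "\<And>x. (\<lambda>n. s n x) \<longlonglongrightarrow> f' x" "\<And>n x. \<bar>s n x\<bar> \<le> 2 * \<bar>f' x\<bar>"
    using borel_measurable_implies_sequence_metric[of f' borel 0] f' by (auto simp: dist_real_def)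
  have conv: "fejer_converges L (s n)" for n
  proof -
    have fin: "finite (range (s n))" using simple_functionD(1)[OF s(1)[of n]] by simp
    have "s n x = (\<Sum>y\<in>range (s n). y * indicator (s n -` {y}) x)" for x
      using fin by (simp add: indicator_def of_bool_def if_distrib sum.delta cong: if_cong)
    then have "s n = (\<lambda>x. \<Sum>y\<in>range (s n). y * indicator (s n -` {y}) x)" by (rule ext)
    moreover have "fejer_converges L (\<lambda>x. \<Sum>y\<in>Y. y * indicator (s n -` {y}) x)" if "finite Y" for Y
      using that
    proof induction
      case (insert y Y)
      have "s n -` {y} \<in> sets borel" using simple_functionD(2)[OF s(1)[of n], of "{y}"] by simp
      then show ?case
        unfolding sum.insert[OF insert.hyps]
        by (intro fejer_converges_add fejer_converges_cmult fejer_converges_borel_set[OF L] insert.IH)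
    qed (simp add: fejer_converges_0[OF L])
    ultimately show ?thesis using fin by metis
  qed
  have "fejer_converges L f"
  proof (rule fejer_converges_limit[OF L conv f])
    have "(\<lambda>n. l2_norm L (\<lambda>x. s n x - f' x)) \<longlonglongrightarrow> 0"
    proof (rule l2_norm_dominated_convergence[OF _ meas'])
      show "s n \<in> borel_measurable (Omega L)" for n
        using conv by (simp add: fejer_converges_def L2_field_def)
      \<comment> \<open>The approximants are bounded by twice the modulus of the limit; the limit
        itself adds the third copy.\<close>
      show "L2_field L (\<lambda>x. 3 * \<bar>f' x\<bar>)"
        by (rule L2_field_dominated[OF f'2, of _ 3]) (use meas' in auto)
      show "norm (s n x - f' x) \<le> 3 * \<bar>f' x\<bar>" for n x using s(3)[of n x] by simp
    qed (use s(2) in auto)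
    moreover have "l2_norm L (\<lambda>x. s n x - f' x) = l2_norm L (\<lambda>x. s n x - f x)" for n
      by (rule l2_norm_cong_AE)
         (use conv f f'2 ae' in \<open>auto simp: fejer_converges_def intro!: L2_field_diff elim!: eventually_mono\<close>)
    ultimately show "(\<lambda>n. l2_norm L (\<lambda>x. s n x - f x)) \<longlonglongrightarrow> 0" by simp
  qed
  then show ?thesis by (simp add: fejer_converges_def)
qed

text \<open>Uniqueness of Fourier coefficients: all Fejer means vanish, and they converge to
  f.\<close>

lemma zero_coeff_AE_zero:
  fixes f :: "real^'n \<Rightarrow> real"
  assumes L: "0 < L" and f: "L2_field L f"
    and c: "\<And>k. l2_inner L f (cosw L k) = 0" and s: "\<And>k. l2_inner L f (sinw L k) = 0"
  shows "AE x in Omega L. f x = 0"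
proof (rule l2_norm_eq_0_AE[OF f])
  have "fejer L N f x = 0" for N x by (simp add: fejer_def fmult_def c s)
  then show "l2_norm L f = 0"
    using fejer_tendsto[OF L f] by (simp add: l2_norm_minus LIMSEQ_const_iff)
qed

text \<open>The coefficients of a weak gradient are determined by those of f. This is needed because
  \<open>grad\<close> is an arbitrary choice among weak gradients.\<close>

lemma weak_gradient_unique:
  fixes f :: "real^'n \<Rightarrow> real"
  assumes L: "0 < L" and G: "weak_gradient L f G" and H: "weak_gradient L f H"
  shows "AE x in Omega L. G x = H x"
proof -
  have G2: "L2_field L (\<lambda>x. G x $ i)" and H2: "L2_field L (\<lambda>x. H x $ i)" for i
    using G H by (auto simp: weak_gradient_def intro: L2_field_component)
  have "AE x in Omega L. G x $ i - H x $ i = 0" for i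
    by (rule zero_coeff_AE_zero[OF L L2_field_diff[OF G2 H2]])
       (simp_all add: l2_inner_diff_left[OF G2 H2] L2_cosw L2_sinw weak_gradient_coeff[OF L G] weak_gradient_coeff[OF L H])
  then have "AE x in Omega L. \<forall>i\<in>UNIV. G x $ i - H x $ i = 0" by (intro AE_finite_allI) auto
  then show ?thesis by eventually_elim (simp add: vec_eq_iff)
qed

lemma weak_gradient_grad: "in_H1 L f \<Longrightarrow> weak_gradient L f (grad L f)"
  unfolding in_H1_def grad_def using someI_ex[of "weak_gradient L f"] by simp

section \<open>Spectral truncation as a multiplier\<close>

text \<open>The real part is taken in each term of the series, so the complex truncation turns into
  the real multiplier without pairing k with -k.\<close>

lemma fourier_coeff_real:
  fixes f :: "real^'n \<Rightarrow> real"
  assumes f: "L2_field L f"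
  shows "Re (fourier_coeff L f k * cis (wave L k \<bullet> x)) =
    1 / L ^ CARD('n) * (l2_inner L f (cosw L k) * cosw L k x + l2_inner L f (sinw L k) * sinw L k x)"
proof -
  let ?I = "LINT x|Omega L. f x *\<^sub>R cis (- (wave L k \<bullet> x))"
  have ic: "integrable (Omega L) (\<lambda>x. f x * cosw L k x)" and isn: "integrable (Omega L) (\<lambda>x. f x * sinw L k x)"
    by (intro L2_field_mult_integrable f L2_cosw L2_sinw)+
  have eq: "f x *\<^sub>R cis (- (wave L k \<bullet> x)) = of_real (f x * cosw L k x) - \<i> * of_real (f x * sinw L k x)" for x
    by (simp add: complex_eq_iff cosw_def sinw_def)
  have "?I = of_real (LINT x|Omega L. f x * cosw L k x) - \<i> * of_real (LINT x|Omega L. f x * sinw L k x)"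
    unfolding eq
    by (simp only: Bochner_Integration.integral_diff[OF integrable_of_real[OF ic] integrable_mult_right[OF integrable_of_real[OF isn]]]
        integral_mult_right_zero integral_complex_of_real)
  then have "?I = of_real (l2_inner L f (cosw L k)) - \<i> * of_real (l2_inner L f (sinw L k))"
    by (simp add: l2_inner_def)
  then have ReI: "Re ?I = l2_inner L f (cosw L k)" and ImI: "Im ?I = - l2_inner L f (sinw L k)" by simp_all
  show ?thesis
    unfolding fourier_coeff_def times_complex.sel scaleR_complex.sel cis.sel ReI ImI
    by (simp add: cosw_def sinw_def algebra_simps)
qed

lemma part_eq_fmult:
  fixes f :: "real^'n \<Rightarrow> real"
  assumes f: "L2_field L f"
  shows "part L \<kappa>1 \<kappa>2 f = fmult L {k. \<kappa>1 \<le> norm (wave L k) \<and> norm (wave L k) < \<kappa>2} (\<lambda>_. 1) f"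
  by (rule ext) (simp only: part_def fmult_def Re_sum fourier_coeff_real[OF f])

text \<open>The zero mode is included, as it is in the part removed by
  \<open>part_from\<close>.\<close>

definition low_modes :: "real \<Rightarrow> real \<Rightarrow> (int^'n) set" where
  "low_modes L \<kappa> = {k. norm (wave L k) < \<kappa>}"

definition low_pass :: "real \<Rightarrow> real \<Rightarrow> (real^'n \<Rightarrow> real) \<Rightarrow> real^'n \<Rightarrow> real" where
  "low_pass L \<kappa> = fmult L (low_modes L \<kappa>) (\<lambda>_. 1)"

definition low_pass_grad :: "real \<Rightarrow> real \<Rightarrow> (real^'n \<Rightarrow> real) \<Rightarrow> real^'n \<Rightarrow> real^'n" where
  "low_pass_grad L \<kappa> = fmult_grad L (low_modes L \<kappa>) (\<lambda>_. 1)"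

lemma finite_low_modes:
  assumes L: "0 < L"
  shows "finite (low_modes L \<kappa> :: (int^'n) set)"
proof -
  obtain m :: nat where m: "\<kappa> * L / (2 * pi) \<le> real m" using real_arch_simple by blast
  have "\<bar>k $ i\<bar> < int (Suc m)" if "k \<in> low_modes L \<kappa>" for k :: "int^'n" and i
  proof -
    have "2 * pi / L * \<bar>real_of_int (k $ i)\<bar> = \<bar>wave L k $ i\<bar>"
      using L by (simp add: wave_def abs_mult)
    also have "\<dots> \<le> norm (wave L k)" by (rule component_le_norm_cart)
    also have "\<dots> < \<kappa>" using that by (simp add: low_modes_def)
    finally have "\<bar>real_of_int (k $ i)\<bar> < \<kappa> * L / (2 * pi)"
      using L by (simp add: field_simps)
    with m have "\<bar>real_of_int (k $ i)\<bar> < real m" by linarith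
    then show ?thesis by linarith
  qed
  then have "low_modes L \<kappa> \<subseteq> (fejer_set (Suc m) :: (int^'n) set)"
    by (auto simp: fejer_set_def)
  then show ?thesis using finite_fejer_set finite_subset by blast
qed

lemma low_modes_even_weights: "0 < L \<Longrightarrow> even_weights (low_modes L \<kappa>) (\<lambda>_. 1)"
  by (simp add: even_weights_def finite_low_modes) (simp add: low_modes_def wave_minus)

lemma mean_zero_coeff:
  fixes f :: "real^'n \<Rightarrow> real"
  shows "mean_zero L f \<Longrightarrow> l2_inner L f (cosw L 0) = 0" "mean_zero L f \<Longrightarrow> l2_inner L f (sinw L 0) = 0"
  by (simp_all add: mean_zero_def l2_inner_def)

lemma part_0_eq_low_pass:
  fixes f :: "real^'n \<Rightarrow> real"
  assumes "L2_field L f"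
  shows "part L 0 \<kappa> f = low_pass L \<kappa> f"
  by (simp add: part_eq_fmult[OF assms] low_pass_def low_modes_def)

text \<open>By the spectral gap only k = 0 lies below the first wavenumber, and its coefficient is
  the mean. So both conventions for the lower cutoff agree on mean-zero functions.\<close>

lemma part_eq_low_pass:
  fixes f :: "real^'n \<Rightarrow> real"
  assumes L: "0 < L" and f: "L2_field L f" and mz: "mean_zero L f"
  shows "part L (2 * pi / L) \<kappa> f = low_pass L \<kappa> f"
proof
  fix x
  let ?B = "{k :: int^'n. 2 * pi / L \<le> norm (wave L k) \<and> norm (wave L k) < \<kappa>}"
  have "fmult L (low_modes L \<kappa>) (\<lambda>_. 1) f x = fmult L ?B (\<lambda>_. 1) f x"
    unfolding fmult_def
  proof (rule sum.mono_neutral_right[OF finite_low_modes[OF L]])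
    show "?B \<subseteq> low_modes L \<kappa>" by (auto simp: low_modes_def)
    show "\<forall>k\<in>low_modes L \<kappa> - ?B. 1 / L ^ CARD('n) *
        (l2_inner L f (cosw L k) * cosw L k x + l2_inner L f (sinw L k) * sinw L k x) = 0"
    proof
      fix k :: "int^'n" assume k: "k \<in> low_modes L \<kappa> - ?B"
      then have "k = 0" using norm_wave_ge[OF L, of k] by (auto simp: low_modes_def)
      then show "1 / L ^ CARD('n) *
        (l2_inner L f (cosw L k) * cosw L k x + l2_inner L f (sinw L k) * sinw L k x) = 0"
        by (simp add: mean_zero_coeff[OF mz])
    qed
  qed
  then show "part L (2 * pi / L) \<kappa> f x = low_pass L \<kappa> f x"
    by (simp add: part_eq_fmult[OF f] low_pass_def)
qed

lemma L2_low_pass: "L2_field L (low_pass L \<kappa> f)" and L2_low_pass_grad: "L2_field L (low_pass_grad L \<kappa> f)"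
  by (simp_all add: low_pass_def low_pass_grad_def L2_fmult L2_fmult_grad)

lemma periodic_C1_low_pass: "0 < L \<Longrightarrow> periodic_C1 L (low_pass L \<kappa> f) (low_pass_grad L \<kappa> f)"
  by (simp add: low_pass_def low_pass_grad_def periodic_C1_fmult)

text \<open>g coincides with its own truncation at the smaller wavenumber \<kappa>g, and on those
  modes the truncation at \<kappa> acts as the identity.\<close>

lemma l2_inner_low_pass_source:
  fixes g \<theta> :: "real^'n \<Rightarrow> real"
  assumes L: "0 < L" and g: "L2_field L g" "mean_zero L g" and \<theta>: "L2_field L \<theta>"
    and le: "\<kappa>g \<le> \<kappa>" and band: "AE x in Omega L. g x = part L (2 * pi / L) \<kappa>g g x"
  shows "l2_inner L g (low_pass L \<kappa> \<theta>) = l2_inner L g \<theta>"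
proof -
  have sub: "low_modes L \<kappa>g \<subseteq> (low_modes L \<kappa> :: (int^'n) set)" using le by (auto simp: low_modes_def)
  have band': "AE x in Omega L. g x = low_pass L \<kappa>g g x"
    using band by (simp add: part_eq_low_pass[OF L g])
  have eq: "l2_inner L g h = l2_inner L (low_pass L \<kappa>g g) h" if "L2_field L h" for h
    by (rule l2_inner_cong_AE[OF band']) (use g that in \<open>auto intro: L2_field_measurable L2_low_pass\<close>)
  have "l2_inner L g (low_pass L \<kappa> \<theta>) = l2_inner L (low_pass L \<kappa>g g) (low_pass L \<kappa> \<theta>)"
    by (rule eq[OF L2_low_pass])
  also have "\<dots> = l2_inner L (low_pass L \<kappa>g g) \<theta>"
    unfolding low_pass_def l2_inner_fmult[OF L2_fmult] l2_inner_fmult[OF \<theta>]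
    using sub by (intro sum.cong refl) (auto simp: fmult_coeff[OF L low_modes_even_weights[OF L]])
  also have "\<dots> = l2_inner L g \<theta>" by (rule eq[OF \<theta>, symmetric])
  finally show ?thesis .
qed

lemma low_pass_idem:
  assumes "0 < L"
  shows "low_pass L \<kappa> (low_pass L \<kappa> f) = low_pass L \<kappa> f"
  unfolding low_pass_def by (simp add: fmult_fmult[OF assms low_modes_even_weights[OF assms]])

lemma l2_norm_low_pass_le:
  "0 < L \<Longrightarrow> L2_field L f \<Longrightarrow> l2_norm L (low_pass L \<kappa> f) \<le> l2_norm L f"
  unfolding low_pass_def by (intro Bessel_fmult low_modes_even_weights) auto

section \<open>The flux through a wavenumber\<close>

text \<open>Incompressibility in Fourier variables: the coefficient vectors are orthogonal to the
  wave vector. The gradient of a sine tests the cosine coefficients, and conversely.\<close>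

lemma div_free_coeff:
  fixes u :: "real^'n \<Rightarrow> real^'n"
  assumes L: "0 < L" and u: "L2_field L u" and df: "div_free L u"
  shows "(\<Sum>i\<in>UNIV. wave L k $ i * l2_inner L (\<lambda>x. u x $ i) (cosw L k)) = 0"
    and "(\<Sum>i\<in>UNIV. wave L k $ i * l2_inner L (\<lambda>x. u x $ i) (sinw L k)) = 0"
proof -
  have "l2_inner L u (\<lambda>x. cosw L k x *\<^sub>R wave L k) = 0"
    using df periodic_C1_sinw[OF L, of k] by (simp add: div_free_def)
  then have "(\<Sum>i\<in>UNIV. l2_inner L (\<lambda>x. u x $ i) (\<lambda>x. wave L k $ i * cosw L k x)) = 0"
    by (simp add: l2_inner_vec[OF u periodic_C1_L2(2)[OF periodic_C1_sinw[OF L]]] mult.commute)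
  then show "(\<Sum>i\<in>UNIV. wave L k $ i * l2_inner L (\<lambda>x. u x $ i) (cosw L k)) = 0"
    by (simp only: l2_inner_cmult_right)
  have "l2_inner L u (\<lambda>x. - sinw L k x *\<^sub>R wave L k) = 0"
    using df periodic_C1_cosw[OF L, of k] by (simp add: div_free_def)
  then have "(\<Sum>i\<in>UNIV. l2_inner L (\<lambda>x. u x $ i) (\<lambda>x. (- wave L k $ i) * sinw L k x)) = 0"
    unfolding l2_inner_vec[OF u periodic_C1_L2(2)[OF periodic_C1_cosw[OF L]]] by (simp add: mult.commute)
  then show "(\<Sum>i\<in>UNIV. wave L k $ i * l2_inner L (\<lambda>x. u x $ i) (sinw L k)) = 0"
    using l2_inner_cmult_right[of L "\<lambda>x. u x $ _" "- wave L k $ _" "sinw L k"] by (simp add: sum_negf)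
qed

text \<open>Truncation preserves incompressibility mode by mode; this permits integration by parts
  against u^< in the flux.\<close>

lemma divergence_low_pass:
  fixes u :: "real^'n \<Rightarrow> real^'n"
  assumes L: "0 < L" and u: "L2_field L u" and df: "div_free L u"
  shows "(\<Sum>i\<in>UNIV. low_pass_grad L \<kappa> (\<lambda>y. u y $ i) x $ i) = 0"
proof -
  have "(\<Sum>i\<in>UNIV. low_pass_grad L \<kappa> (\<lambda>y. u y $ i) x $ i)
    = (\<Sum>k\<in>low_modes L \<kappa>. \<Sum>i\<in>UNIV. 1 / L ^ CARD('n) *
        (cosw L k x * (wave L k $ i * l2_inner L (\<lambda>x. u x $ i) (sinw L k))
          - sinw L k x * (wave L k $ i * l2_inner L (\<lambda>x. u x $ i) (cosw L k))))"
    unfolding low_pass_grad_def fmult_grad_def sum_component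
    by (subst sum.swap) (intro sum.cong refl, simp add: algebra_simps)
  also have "\<dots> = 0"
    by (simp only: sum_distrib_left[symmetric] sum_subtractf div_free_coeff[OF L u df] mult_zero_right diff_zero sum.neutral_const)
  finally show ?thesis .
qed

text \<open>The basic trilinear bound. A product of two L2 fields is only integrable, so the third
  factor has to be bounded.\<close>

lemma integrable_inner_mult_bounded:
  fixes u G :: "real^'n \<Rightarrow> 'b::euclidean_space" and \<phi> :: "real^'n \<Rightarrow> real"
  assumes u: "L2_field L u" and G: "L2_field L G" and \<phi>: "\<phi> \<in> borel_measurable (Omega L)"
    and B: "\<And>x. x \<in> cbox 0 (\<chi> i. L) \<Longrightarrow> \<bar>\<phi> x\<bar> \<le> B" and B0: "0 \<le> B"
  shows "integrable (Omega L) (\<lambda>x. (u x \<bullet> G x) * \<phi> x)"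
    and "\<bar>LINT x|Omega L. (u x \<bullet> G x) * \<phi> x\<bar> \<le> B * (l2_norm L u * l2_norm L G)"
proof -
  have bd: "\<bar>(u x \<bullet> G x) * \<phi> x\<bar> \<le> B * (norm (u x) * norm (G x))" if "x \<in> cbox 0 (\<chi> i. L)" for x
  proof -
    have "\<bar>u x \<bullet> G x\<bar> * \<bar>\<phi> x\<bar> \<le> (norm (u x) * norm (G x)) * B"
      by (intro mult_mono Cauchy_Schwarz_ineq2 B that) auto
    then show ?thesis by (simp add: abs_mult mult.commute)
  qed
  have int: "integrable (Omega L) (\<lambda>x. B * (norm (u x) * norm (G x)))"
    using integral_norm_mult_le(1)[OF u G] by simp
  show i: "integrable (Omega L) (\<lambda>x. (u x \<bullet> G x) * \<phi> x)"
  proof (rule Bochner_Integration.integrable_bound[OF int])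
    show "(\<lambda>x. (u x \<bullet> G x) * \<phi> x) \<in> borel_measurable (Omega L)"
      by (intro borel_measurable_times borel_measurable_inner L2_field_measurable u G \<phi>)
    show "AE x in Omega L. norm ((u x \<bullet> G x) * \<phi> x) \<le> norm (B * (norm (u x) * norm (G x)))"
    proof (rule AE_I2)
      fix x :: "real^'n" assume "x \<in> space (Omega L)"
      then show "norm ((u x \<bullet> G x) * \<phi> x) \<le> norm (B * (norm (u x) * norm (G x)))"
        using bd[of x] abs_ge_self[of "B * (norm (u x) * norm (G x))"] unfolding space_Omega real_norm_def by linarith
    qed
  qed
  have "\<bar>LINT x|Omega L. (u x \<bullet> G x) * \<phi> x\<bar> \<le> (LINT x|Omega L. \<bar>(u x \<bullet> G x) * \<phi> x\<bar>)"
    by (rule integral_abs_bound)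
  also have "\<dots> \<le> (LINT x|Omega L. B * (norm (u x) * norm (G x)))"
    by (intro integral_mono_AE integrable_abs i int AE_I2) (use bd in \<open>simp add: space_Omega\<close>)
  also have "\<dots> = B * (LINT x|Omega L. norm (u x) * norm (G x))" by simp
  also have "\<dots> \<le> B * (l2_norm L u * l2_norm L G)"
    by (intro mult_left_mono integral_norm_mult_le(2) u G B0)
  finally show "\<bar>LINT x|Omega L. (u x \<bullet> G x) * \<phi> x\<bar> \<le> B * (l2_norm L u * l2_norm L G)" .
qed

lemma weak_gradient_diff:
  fixes f h :: "real^'n \<Rightarrow> real"
  assumes f: "weak_gradient L f G" and h: "weak_gradient L h H"
  shows "weak_gradient L (\<lambda>x. f x - h x) (\<lambda>x. G x - H x)"
  unfolding weak_gradient_def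
proof (intro conjI allI impI)
  have f2: "L2_field L f" "L2_field L G" and h2: "L2_field L h" "L2_field L H"
    using f h by (auto simp: weak_gradient_def)
  show "L2_field L (\<lambda>x. f x - h x)" "L2_field L (\<lambda>x. G x - H x)" by (intro L2_field_diff f2 h2)+
  fix \<phi> :: "real^'n \<Rightarrow> real" and D\<phi> assume \<phi>: "periodic_C1 L \<phi> D\<phi>"
  have int: "integrable (Omega L) (\<lambda>x. p x *\<^sub>R q x)" if "L2_field L p" "L2_field L q"
    for p :: "real^'n \<Rightarrow> real" and q :: "real^'n \<Rightarrow> real^'n"
  proof (rule Bochner_Integration.integrable_bound[OF integral_norm_mult_le(1)[OF that]])
    show "(\<lambda>x. p x *\<^sub>R q x) \<in> borel_measurable (Omega L)"
      by (intro borel_measurable_scaleR L2_field_measurable that)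
  qed simp
  note \<phi>2 = periodic_C1_L2[OF \<phi>]
  have "(LINT x|Omega L. f x *\<^sub>R D\<phi> x) = - (LINT x|Omega L. \<phi> x *\<^sub>R G x)"
    "(LINT x|Omega L. h x *\<^sub>R D\<phi> x) = - (LINT x|Omega L. \<phi> x *\<^sub>R H x)"
    using f h \<phi> by (auto simp: weak_gradient_def)
  then show "(LINT x|Omega L. (f x - h x) *\<^sub>R D\<phi> x) = - (LINT x|Omega L. \<phi> x *\<^sub>R (G x - H x))"
    by (simp add: scaleR_diff_left scaleR_diff_right int f2 h2 \<phi>2)
qed

lemma continuous_bounded_on_Omega:
  fixes \<phi> :: "real^'n \<Rightarrow> real"
  assumes "continuous_on UNIV \<phi>"
  obtains B where "0 \<le> B" "\<And>x. x \<in> cbox 0 (\<chi> i. L) \<Longrightarrow> \<bar>\<phi> x\<bar> \<le> B"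
proof -
  have "compact (\<phi> ` cbox 0 (\<chi> i. L))"
    using assms by (intro compact_continuous_image compact_cbox) (auto intro: continuous_on_subset)
  then obtain B where "\<forall>y\<in>\<phi> ` cbox 0 (\<chi> i. L). norm y \<le> B"
    using compact_imp_bounded bounded_iff by metis
  then have "0 \<le> max B 0" "\<And>x. x \<in> cbox 0 (\<chi> i. L) \<Longrightarrow> \<bar>\<phi> x\<bar> \<le> max B 0"
    by (auto simp: le_max_iff_disj)
  then show ?thesis by (rule that)
qed

lemma integrable_inner_mult_continuous:
  fixes u G :: "real^'n \<Rightarrow> 'b::euclidean_space" and \<phi> :: "real^'n \<Rightarrow> real"
  assumes "L2_field L u" "L2_field L G" "continuous_on UNIV \<phi>"
  shows "integrable (Omega L) (\<lambda>x. (u x \<bullet> G x) * \<phi> x)"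
  using continuous_bounded_on_Omega[OF assms(3), of L]
    integrable_inner_mult_bounded(1)[OF assms(1,2) borel_measurable_Omega_continuous[OF assms(3)]]
  by metis

text \<open>The integrand is u . grad of \<beta>(\<phi>), and u is orthogonal to gradients of
  periodic functions.\<close>

lemma div_free_transport_C1:
  fixes u :: "real^'n \<Rightarrow> real^'n"
  assumes \<phi>: "periodic_C1 L \<phi> D\<phi>" and df: "div_free L u"
    and \<beta>: "\<And>s. (\<beta> has_real_derivative \<beta>' s) (at s)" "continuous_on UNIV \<beta>'"
  shows "(LINT x|Omega L. (u x \<bullet> D\<phi> x) * \<beta>' (\<phi> x)) = 0"
proof -
  have "l2_inner L u (\<lambda>x. \<beta>' (\<phi> x) *\<^sub>R D\<phi> x) = 0"
    using df periodic_C1_compose[OF \<phi> \<beta>] by (auto simp: div_free_def)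
  then show ?thesis by (simp add: l2_inner_def mult.commute)
qed

text \<open>With u^> = u - u^< and \<theta>^> = \<theta> - \<theta>^<, the second flux term becomes
  (u . grad \<theta>, \<theta>^<) - (u . grad \<theta>^<, \<theta>^<) - (u^< . grad \<theta>^>,
  \<theta>^<). The middle term vanishes, and the last cancels the first flux term after integration
  by parts. The flux is thus the transport term tested with \<theta>^<.\<close>

lemma tracer_flux_eq:
  fixes u :: "real^'n \<Rightarrow> real^'n" and \<theta> :: "real^'n \<Rightarrow> real"
  assumes L: "0 < L" and u: "L2_field L u" "mean_zero L u" "div_free L u"
    and H1: "in_H1 L \<theta>" and mz: "mean_zero L \<theta>"
  shows "tracer_flux L \<kappa> u \<theta> =
    1 / L ^ CARD('n) * l2_inner L (\<lambda>x. u x \<bullet> grad L \<theta> x) (low_pass L \<kappa> \<theta>)"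
proof -
  define G where "G = grad L \<theta>"
  have wG: "weak_gradient L \<theta> G" unfolding G_def by (rule weak_gradient_grad[OF H1])
  have \<theta>: "L2_field L \<theta>" and G2: "L2_field L G" using wG by (auto simp: weak_gradient_def)
  have ui: "L2_field L (\<lambda>x. u x $ i)" for i by (rule L2_field_component[OF u(1)])
  have umz: "mean_zero L (\<lambda>x. u x $ i)" for i
    using u(2) integral_bounded_linear[OF bounded_linear_vec_nth L2_field_integrable[OF u(1)], of i]
    by (simp add: mean_zero_def)
  define ul where "ul x = (\<chi> i. low_pass L \<kappa> (\<lambda>y. u y $ i) x)" for x
  define \<theta>l where "\<theta>l = low_pass L \<kappa> \<theta>"
  define D where "D = low_pass_grad L \<kappa> \<theta>"
  define H where "H x = G x - D x" for x
  define \<theta>h where "\<theta>h x = \<theta> x - \<theta>l x" for x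
  have C1: "periodic_C1 L \<theta>l D" unfolding \<theta>l_def D_def by (rule periodic_C1_low_pass[OF L])
  have ulC1: "periodic_C1 L (\<lambda>x. ul x $ i) (low_pass_grad L \<kappa> (\<lambda>y. u y $ i))" for i
    unfolding ul_def by (simp add: periodic_C1_low_pass[OF L])
  have wD: "weak_gradient L \<theta>l D" by (rule weak_gradient_periodic_C1[OF L C1])
  have wH: "weak_gradient L \<theta>h H" unfolding \<theta>h_def H_def by (rule weak_gradient_diff[OF wG wD])
  have D2: "L2_field L D" and H2: "L2_field L H" and \<theta>h2: "L2_field L \<theta>h"
    using wD wH by (auto simp: weak_gradient_def)
  have ul2: "L2_field L ul" by (rule L2_field_vec) (rule periodic_C1_L2(1)[OF ulC1])
  have c\<theta>l: "continuous_on UNIV \<theta>l" by (rule periodic_C1_continuous[OF C1])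
  \<comment> \<open>The flux is defined through \<open>grad\<close>, which agrees with the explicit
    gradients only almost everywhere.\<close>
  have aeD: "AE x in Omega L. grad L \<theta>l x = D x"
    by (rule weak_gradient_unique[OF L weak_gradient_grad wD]) (use wD in \<open>auto simp: in_H1_def\<close>)
  have aeH: "AE x in Omega L. grad L \<theta>h x = H x"
    by (rule weak_gradient_unique[OF L weak_gradient_grad wH]) (use wH in \<open>auto simp: in_H1_def\<close>)
  have g2: "L2_field L (grad L \<theta>l)" "L2_field L (grad L \<theta>h)"
    using weak_gradient_grad[of L \<theta>l] weak_gradient_grad[of L \<theta>h] wD wH by (auto simp: weak_gradient_def in_H1_def)
  have flux: "tracer_flux L \<kappa> u \<theta> = 1 / L ^ CARD('n) *
      (- l2_inner L (\<lambda>x. ul x \<bullet> grad L \<theta>l x) \<theta>h + l2_inner L (\<lambda>x. (u x - ul x) \<bullet> grad L \<theta>h x) \<theta>l)"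
  proof -
    have "vpart L (2 * pi / L) \<kappa> u = ul"
      by (simp add: fun_eq_iff vpart_def ul_def part_eq_low_pass[OF L ui umz])
    moreover have "vpart_from L \<kappa> u = (\<lambda>x. u x - ul x)"
      by (simp add: fun_eq_iff vec_eq_iff vpart_from_def part_from_def ul_def part_0_eq_low_pass[OF ui])
    moreover have "part L (2 * pi / L) \<kappa> \<theta> = \<theta>l"
      by (simp add: \<theta>l_def part_eq_low_pass[OF L \<theta> mz])
    moreover have "part_from L \<kappa> \<theta> = \<theta>h"
      by (simp add: fun_eq_iff part_from_def \<theta>h_def \<theta>l_def part_0_eq_low_pass[OF \<theta>])
    ultimately show ?thesis by (simp add: tracer_flux_def Let_def)
  qed
  have e1: "l2_inner L (\<lambda>x. ul x \<bullet> grad L \<theta>l x) \<theta>h = (LINT x|Omega L. (ul x \<bullet> D x) * \<theta>h x)"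
    unfolding l2_inner_def inner_real_def
  proof (rule integral_cong_AE)
    show "AE x in Omega L. (ul x \<bullet> grad L \<theta>l x) * \<theta>h x = (ul x \<bullet> D x) * \<theta>h x"
      using aeD by eventually_elim simp
  qed (intro borel_measurable_times borel_measurable_inner L2_field_measurable ul2 g2 D2 \<theta>h2)+
  have uul: "L2_field L (\<lambda>x. u x - ul x)" by (rule L2_field_diff[OF u(1) ul2])
  have e2: "l2_inner L (\<lambda>x. (u x - ul x) \<bullet> grad L \<theta>h x) \<theta>l = (LINT x|Omega L. ((u x - ul x) \<bullet> H x) * \<theta>l x)"
    unfolding l2_inner_def inner_real_def
  proof (rule integral_cong_AE)
    show "AE x in Omega L. ((u x - ul x) \<bullet> grad L \<theta>h x) * \<theta>l x = ((u x - ul x) \<bullet> H x) * \<theta>l x"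
      using aeH by eventually_elim simp
  qed (intro borel_measurable_times borel_measurable_inner L2_field_measurable uul g2 H2 borel_measurable_Omega_continuous c\<theta>l)+
  \<comment> \<open>Antisymmetry of the transport term on the smooth part, with \<beta>(s) = s^2 /
    2.\<close>
  have a: "(LINT x|Omega L. (u x \<bullet> D x) * \<theta>l x) = 0"
    by (rule div_free_transport_C1[OF C1 u(3), of "\<lambda>s. s\<^sup>2 / 2" "\<lambda>s. s"]) (auto intro!: derivative_eq_intros)
  have iuG: "integrable (Omega L) (\<lambda>x. (u x \<bullet> G x) * \<theta>l x)" and iuD: "integrable (Omega L) (\<lambda>x. (u x \<bullet> D x) * \<theta>l x)"
    and iulH: "integrable (Omega L) (\<lambda>x. (ul x \<bullet> H x) * \<theta>l x)"
    by (intro integrable_inner_mult_continuous u(1) ul2 G2 D2 H2 c\<theta>l)+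
  have "(LINT x|Omega L. ((u x - ul x) \<bullet> H x) * \<theta>l x)
    = (LINT x|Omega L. ((u x \<bullet> G x) * \<theta>l x - (u x \<bullet> D x) * \<theta>l x) - (ul x \<bullet> H x) * \<theta>l x)"
    by (intro Bochner_Integration.integral_cong refl) (simp add: H_def inner_diff_left inner_diff_right algebra_simps)
  also have "\<dots> = (LINT x|Omega L. (u x \<bullet> G x) * \<theta>l x) - (LINT x|Omega L. (ul x \<bullet> H x) * \<theta>l x)"
    using iuG iuD iulH a by simp
  finally have e3: "(LINT x|Omega L. ((u x - ul x) \<bullet> H x) * \<theta>l x)
    = (LINT x|Omega L. (u x \<bullet> G x) * \<theta>l x) - (LINT x|Omega L. (ul x \<bullet> H x) * \<theta>l x)" .
  let ?Du = "\<lambda>i. low_pass_grad L \<kappa> (\<lambda>y. u y $ i)"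
  \<comment> \<open>\<theta>^> has only a weak gradient, so its i-th component is tested with the
    smooth product of \<theta>^< and the i-th component of u^<. In the sum over i the divergence of
    u^< drops out.\<close>
  have Pi: "periodic_C1 L (\<lambda>x. \<theta>l x * ul x $ i) (\<lambda>x. \<theta>l x *\<^sub>R ?Du i x + ul x $ i *\<^sub>R D x)" for i
    by (rule periodic_C1_mult[OF C1 ulC1])
  have Pi2: "L2_field L (\<lambda>x. (\<theta>l x *\<^sub>R ?Du i x + ul x $ i *\<^sub>R D x) $ i)" "L2_field L (\<lambda>x. \<theta>l x * ul x $ i)" for i
    by (rule L2_field_component[OF periodic_C1_L2(2)[OF Pi]], rule periodic_C1_L2(1)[OF Pi])
  have "(\<Sum>i\<in>UNIV. l2_inner L \<theta>h (\<lambda>x. (\<theta>l x *\<^sub>R ?Du i x + ul x $ i *\<^sub>R D x) $ i))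
      = (\<Sum>i\<in>UNIV. - l2_inner L (\<lambda>x. H x $ i) (\<lambda>x. \<theta>l x * ul x $ i))"
    by (intro sum.cong refl weak_gradient_component[OF wH Pi])
  also have "(\<Sum>i\<in>UNIV. l2_inner L \<theta>h (\<lambda>x. (\<theta>l x *\<^sub>R ?Du i x + ul x $ i *\<^sub>R D x) $ i))
      = l2_inner L \<theta>h (\<lambda>x. \<Sum>i\<in>UNIV. (\<theta>l x *\<^sub>R ?Du i x + ul x $ i *\<^sub>R D x) $ i)"
    by (rule l2_inner_sum_right[OF Pi2(1) \<theta>h2, symmetric])
  also have "(\<lambda>x. \<Sum>i\<in>UNIV. (\<theta>l x *\<^sub>R ?Du i x + ul x $ i *\<^sub>R D x) $ i) = (\<lambda>x. ul x \<bullet> D x)"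
    using divergence_low_pass[OF L u(1) u(3)]
    by (simp add: fun_eq_iff sum.distrib inner_vec_def flip: sum_distrib_left)
  also have "(\<Sum>i\<in>UNIV. - l2_inner L (\<lambda>x. H x $ i) (\<lambda>x. \<theta>l x * ul x $ i))
      = - (\<Sum>i\<in>UNIV. LINT x|Omega L. H x $ i * (\<theta>l x * ul x $ i))"
    by (simp add: sum_negf l2_inner_def)
  also have "(\<Sum>i\<in>UNIV. LINT x|Omega L. H x $ i * (\<theta>l x * ul x $ i))
      = (LINT x|Omega L. (\<Sum>i\<in>UNIV. H x $ i * (\<theta>l x * ul x $ i)))"
    by (intro Bochner_Integration.integral_sum[symmetric] L2_field_mult_integrable L2_field_component[OF H2] Pi2)
  also have "\<dots> = (LINT x|Omega L. (ul x \<bullet> H x) * \<theta>l x)"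
    by (intro Bochner_Integration.integral_cong refl) (simp add: inner_vec_def sum_distrib_left algebra_simps)
  finally have e4: "(LINT x|Omega L. (ul x \<bullet> D x) * \<theta>h x) = - (LINT x|Omega L. (ul x \<bullet> H x) * \<theta>l x)"
    by (simp add: l2_inner_def mult.commute)
  show ?thesis
    unfolding flux e1 e2 e3 e4 by (simp add: l2_inner_def G_def \<theta>l_def)
qed

section \<open>Nonlinear tests with Fejer means\<close>

text \<open>F is merely integrable while \<psi> converges in L2, so Cauchy-Schwarz does not apply
  directly. F is cut at height K: the remainder is small in L1 and meets the uniform bound B, the
  bounded part is paired with the L2 convergence.\<close>

lemma tendsto_integral_mult_bounded:
  fixes F :: "real^'n \<Rightarrow> real"
  assumes F: "integrable (Omega L) F"
    and \<psi>: "\<And>n. \<psi> n \<in> borel_measurable (Omega L)" "\<And>n x. \<bar>\<psi> n x\<bar> \<le> B"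
    and \<phi>: "\<phi> \<in> borel_measurable (Omega L)" "\<And>x. \<bar>\<phi> x\<bar> \<le> B"
    and lim: "(\<lambda>n. l2_norm L (\<lambda>x. \<psi> n x - \<phi> x)) \<longlonglongrightarrow> 0"
  shows "(\<lambda>n. LINT x|Omega L. F x * \<psi> n x) \<longlonglongrightarrow> (LINT x|Omega L. F x * \<phi> x)"
proof (rule LIMSEQ_I)
  fix \<epsilon> :: real assume e: "0 < \<epsilon>"
  have B0: "0 \<le> B" using \<phi>(2)[of 0] by simp
  define FK where "FK K x = (if \<bar>F x\<bar> \<le> real K then F x else 0)" for K :: nat and x
  have Fm: "F \<in> borel_measurable (Omega L)" using F by simp
  have FKm: "FK K \<in> borel_measurable (Omega L)" for K
    unfolding FK_def by (intro measurable_If Fm) (use Fm in measurable)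
  have "(\<lambda>K. LINT x|Omega L. \<bar>F x - FK K x\<bar>) \<longlonglongrightarrow> (LINT x|(Omega L :: (real^'n) measure). 0)"
  proof (rule integral_dominated_convergence[where w="\<lambda>x. \<bar>F x\<bar>"])
    show "AE x in Omega L. (\<lambda>K. \<bar>F x - FK K x\<bar>) \<longlonglongrightarrow> 0"
    proof (rule AE_I2)
      fix x
      obtain K0 :: nat where "\<bar>F x\<bar> \<le> real K0" using real_arch_simple by blast
      then have "\<bar>F x - FK K x\<bar> = 0" if "K0 \<le> K" for K using that by (simp add: FK_def)
      then have "\<forall>\<^sub>F K in sequentially. \<bar>F x - FK K x\<bar> = 0" unfolding eventually_sequentially by blast
      then show "(\<lambda>K. \<bar>F x - FK K x\<bar>) \<longlonglongrightarrow> 0" by (rule tendsto_eventually)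
    qed
    show "integrable (Omega L) (\<lambda>x. \<bar>F x\<bar>)" using F by simp
    show "(\<lambda>x. \<bar>F x - FK K x\<bar>) \<in> borel_measurable (Omega L)" for K using Fm FKm by simp
    show "AE x in Omega L. norm \<bar>F x - FK K x\<bar> \<le> \<bar>F x\<bar>" for K by (rule AE_I2) (simp add: FK_def)
  qed simp
  then have "(\<lambda>K. LINT x|Omega L. \<bar>F x - FK K x\<bar>) \<longlonglongrightarrow> 0" by simp
  \<comment> \<open>The remainder is multiplied by differences of size at most 2 B, which leaves at
    most \<epsilon> / 2; the added 1 keeps the denominator positive when B = 0.\<close>
  from LIMSEQ_D[OF this, of "\<epsilon> / (4 * (B + 1))"] e B0 obtain K where
    K: "(LINT x|Omega L. \<bar>F x - FK K x\<bar>) < \<epsilon> / (4 * (B + 1))" by fastforce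
  have FK2: "L2_field L (FK K)" by (rule L2_field_bounded[OF FKm, of _ "real K"]) (simp add: FK_def)
  have \<psi>2: "L2_field L (\<psi> n)" for n using \<psi> by (intro L2_field_bounded[of _ L B]) auto
  have \<phi>2: "L2_field L \<phi>" using \<phi> by (intro L2_field_bounded[of _ L B]) auto
  have "(\<lambda>n. l2_norm L (FK K) * l2_norm L (\<lambda>x. \<psi> n x - \<phi> x)) \<longlonglongrightarrow> l2_norm L (FK K) * 0"
    by (intro tendsto_mult tendsto_const lim)
  then have "(\<lambda>n. l2_norm L (FK K) * l2_norm L (\<lambda>x. \<psi> n x - \<phi> x)) \<longlonglongrightarrow> 0" by simp
  from LIMSEQ_D[OF this, of "\<epsilon> / 2"] e obtain N where
    N: "\<And>n. N \<le> n \<Longrightarrow> \<bar>l2_norm L (FK K) * l2_norm L (\<lambda>x. \<psi> n x - \<phi> x)\<bar> < \<epsilon> / 2" by auto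
  show "\<exists>N. \<forall>n\<ge>N. norm ((LINT x|Omega L. F x * \<psi> n x) - (LINT x|Omega L. F x * \<phi> x)) < \<epsilon>"
  proof (intro exI allI impI)
    fix n assume "N \<le> n"
    have iF: "integrable (Omega L) (\<lambda>x. F x * h x)" if "h \<in> borel_measurable (Omega L)" "\<And>x. \<bar>h x\<bar> \<le> C" for h C
    proof (rule Bochner_Integration.integrable_bound[of _ "\<lambda>x. C * F x"])
      show "AE x in Omega L. norm (F x * h x) \<le> norm (C * F x)"
      proof (rule AE_I2)
        fix x
        have "\<bar>F x\<bar> * \<bar>h x\<bar> \<le> \<bar>F x\<bar> * \<bar>C\<bar>" using that(2)[of x] by (intro mult_left_mono) auto
        then show "norm (F x * h x) \<le> norm (C * F x)" by (simp add: abs_mult mult.commute)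
      qed
    qed (use F Fm that in auto)
    have d: "(\<lambda>x. \<psi> n x - \<phi> x) \<in> borel_measurable (Omega L)" "\<bar>\<psi> n x - \<phi> x\<bar> \<le> 2 * B" for x
      using \<psi>(1)[of n] \<psi>(2)[of n x] \<phi>(1) \<phi>(2)[of x] by auto
    have d2: "L2_field L (\<lambda>x. \<psi> n x - \<phi> x)" by (rule L2_field_diff[OF \<psi>2 \<phi>2])
    have iFd: "integrable (Omega L) (\<lambda>x. F x * (\<psi> n x - \<phi> x))" by (rule iF[OF d])
    have iKd: "integrable (Omega L) (\<lambda>x. FK K x * (\<psi> n x - \<phi> x))" by (rule L2_field_mult_integrable[OF FK2 d2])
    have "(LINT x|Omega L. F x * \<psi> n x) - (LINT x|Omega L. F x * \<phi> x) = (LINT x|Omega L. F x * (\<psi> n x - \<phi> x))"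
      using iF[OF \<psi>(1) \<psi>(2)] iF[OF \<phi>] by (simp add: right_diff_distrib)
    also have "\<dots> = (LINT x|Omega L. F x * (\<psi> n x - \<phi> x) - FK K x * (\<psi> n x - \<phi> x)) + l2_inner L (FK K) (\<lambda>x. \<psi> n x - \<phi> x)"
      using iFd iKd by (simp add: l2_inner_def)
    finally have "\<bar>(LINT x|Omega L. F x * \<psi> n x) - (LINT x|Omega L. F x * \<phi> x)\<bar>
      \<le> \<bar>LINT x|Omega L. F x * (\<psi> n x - \<phi> x) - FK K x * (\<psi> n x - \<phi> x)\<bar> + \<bar>l2_inner L (FK K) (\<lambda>x. \<psi> n x - \<phi> x)\<bar>"
      by linarith
    moreover have "\<bar>l2_inner L (FK K) (\<lambda>x. \<psi> n x - \<phi> x)\<bar> < \<epsilon> / 2"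
      using l2_inner_Cauchy_Schwarz[OF FK2 d2] N[OF \<open>N \<le> n\<close>] by linarith
    moreover have "\<bar>LINT x|Omega L. F x * (\<psi> n x - \<phi> x) - FK K x * (\<psi> n x - \<phi> x)\<bar> \<le> \<epsilon> / 2"
    proof -
      have "\<bar>LINT x|Omega L. F x * (\<psi> n x - \<phi> x) - FK K x * (\<psi> n x - \<phi> x)\<bar>
          \<le> (LINT x|Omega L. \<bar>F x * (\<psi> n x - \<phi> x) - FK K x * (\<psi> n x - \<phi> x)\<bar>)"
        by (rule integral_abs_bound)
      also have "\<dots> \<le> (LINT x|Omega L. 2 * B * \<bar>F x - FK K x\<bar>)"
      proof (rule integral_mono)
        show "integrable (Omega L) (\<lambda>x. \<bar>F x * (\<psi> n x - \<phi> x) - FK K x * (\<psi> n x - \<phi> x)\<bar>)"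
          by (intro integrable_abs Bochner_Integration.integrable_diff iFd iKd)
        show "integrable (Omega L) (\<lambda>x. 2 * B * \<bar>F x - FK K x\<bar>)"
          by (intro integrable_mult_right integrable_abs Bochner_Integration.integrable_diff F L2_field_integrable FK2)
        fix x
        have "\<bar>F x * (\<psi> n x - \<phi> x) - FK K x * (\<psi> n x - \<phi> x)\<bar> = \<bar>\<psi> n x - \<phi> x\<bar> * \<bar>F x - FK K x\<bar>"
          by (simp add: abs_mult[symmetric] algebra_simps)
        also have "\<dots> \<le> 2 * B * \<bar>F x - FK K x\<bar>" by (intro mult_right_mono d) auto
        finally show "\<bar>F x * (\<psi> n x - \<phi> x) - FK K x * (\<psi> n x - \<phi> x)\<bar> \<le> 2 * B * \<bar>F x - FK K x\<bar>" .
      qed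
      also have "\<dots> = 2 * B * (LINT x|Omega L. \<bar>F x - FK K x\<bar>)" by simp
      also have "\<dots> \<le> 2 * B * (\<epsilon> / (4 * (B + 1)))" using K B0 by (intro mult_left_mono) auto
      also have "\<dots> \<le> \<epsilon> / 2" using B0 e by (simp add: field_simps)
      finally show ?thesis .
    qed
    ultimately show "norm ((LINT x|Omega L. F x * \<psi> n x) - (LINT x|Omega L. F x * \<phi> x)) < \<epsilon>"
      unfolding real_norm_def by linarith
  qed
qed

section \<open>Fejer means of gradients, and limits in which the argument varies with N\<close>

lemma l2_norm_vec_sq:
  fixes f :: "real^'n \<Rightarrow> real^'m"
  assumes "L2_field L f"
  shows "(l2_norm L f)\<^sup>2 = (\<Sum>i\<in>UNIV. (l2_norm L (\<lambda>x. f x $ i))\<^sup>2)"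
  by (simp add: l2_norm_sq l2_inner_vec[OF assms assms])

lemma L2_fejer_grad: "L2_field L (fejer_grad L N f)"
  by (simp add: fejer_grad_def L2_fmult_grad)

lemma periodic_C1_fejer: "0 < L \<Longrightarrow> periodic_C1 L (fejer L N f) (fejer_grad L N f)"
  by (simp add: fejer_def fejer_grad_def periodic_C1_fmult)

lemma fejer_weak_gradient:
  assumes "0 < L" "weak_gradient L f G"
  shows "(\<lambda>x. fejer_grad L N f x $ i) = fejer L N (\<lambda>x. G x $ i)"
  by (simp add: fejer_def fejer_grad_def fmult_weak_gradient[OF assms])

lemma l2_norm_fejer_grad_le:
  fixes f :: "real^'n \<Rightarrow> real"
  assumes L: "0 < L" and G: "weak_gradient L f G"
  shows "l2_norm L (fejer_grad L N f) \<le> l2_norm L G"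
proof (rule power2_le_imp_le[OF _ l2_norm_nonneg])
  have G2: "L2_field L G" using G by (simp add: weak_gradient_def)
  show "(l2_norm L (fejer_grad L N f))\<^sup>2 \<le> (l2_norm L G)\<^sup>2"
    unfolding l2_norm_vec_sq[OF L2_fejer_grad] l2_norm_vec_sq[OF G2] fejer_weak_gradient[OF L G]
    by (intro sum_mono power_mono l2_norm_fejer_le L L2_field_component[OF G2] l2_norm_nonneg)
qed

lemma fejer_grad_tendsto:
  fixes f :: "real^'n \<Rightarrow> real"
  assumes L: "0 < L" and G: "weak_gradient L f G"
  shows "(\<lambda>N. l2_norm L (\<lambda>x. fejer_grad L N f x - G x)) \<longlonglongrightarrow> 0"
proof -
  have G2: "L2_field L G" using G by (simp add: weak_gradient_def)
  have eq: "(l2_norm L (\<lambda>x. fejer_grad L N f x - G x))\<^sup>2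
      = (\<Sum>i\<in>UNIV. (l2_norm L (\<lambda>x. fejer L N (\<lambda>x. G x $ i) x - G x $ i))\<^sup>2)" for N
    using l2_norm_vec_sq[OF L2_field_diff[OF L2_fejer_grad G2], of N f]
    by (simp add: fun_cong[OF fejer_weak_gradient[OF L G]])
  have "(\<lambda>N. \<Sum>i\<in>(UNIV::'n set). (l2_norm L (\<lambda>x. fejer L N (\<lambda>x. G x $ i) x - G x $ i))\<^sup>2) \<longlonglongrightarrow> (\<Sum>i\<in>(UNIV::'n set). 0\<^sup>2)"
    by (intro tendsto_sum tendsto_power fejer_tendsto L L2_field_component G2)
  then have "(\<lambda>N. (l2_norm L (\<lambda>x. fejer_grad L N f x - G x))\<^sup>2) \<longlonglongrightarrow> 0"
    by (simp add: eq)
  from tendsto_real_sqrt[OF this] show ?thesis by (simp add: l2_norm_nonneg)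
qed

text \<open>The index of the mean and its argument move together; contraction uniformly in N
  separates the two errors.\<close>

lemma fejer_tendsto_diagonal:
  fixes \<phi> :: "real^'n \<Rightarrow> real"
  assumes L: "0 < L" and \<psi>: "\<And>N. L2_field L (\<psi> N)" and \<phi>: "L2_field L \<phi>"
    and lim: "(\<lambda>N. l2_norm L (\<lambda>x. \<psi> N x - \<phi> x)) \<longlonglongrightarrow> 0"
  shows "(\<lambda>N. l2_norm L (\<lambda>x. fejer L N (\<psi> N) x - \<phi> x)) \<longlonglongrightarrow> 0"
proof (rule Lim_null_comparison[OF always_eventually], rule allI)
  show "(\<lambda>N. l2_norm L (\<lambda>x. \<psi> N x - \<phi> x) + l2_norm L (\<lambda>x. fejer L N \<phi> x - \<phi> x)) \<longlonglongrightarrow> 0"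
    using tendsto_add[OF lim fejer_tendsto[OF L \<phi>]] by simp
  fix N
  have d: "L2_field L (\<lambda>x. fejer L N (\<lambda>x. \<psi> N x - \<phi> x) x)" by (rule L2_fejer)
  have "l2_norm L (\<lambda>x. fejer L N (\<psi> N) x - \<phi> x)
      = l2_norm L (\<lambda>x. fejer L N (\<lambda>x. \<psi> N x - \<phi> x) x + (fejer L N \<phi> x - \<phi> x))"
    by (simp add: fejer_def fmult_diff[OF \<psi> \<phi>])
  also have "\<dots> \<le> l2_norm L (\<lambda>x. fejer L N (\<lambda>x. \<psi> N x - \<phi> x) x) + l2_norm L (\<lambda>x. fejer L N \<phi> x - \<phi> x)"
    by (rule l2_norm_triangle[OF d L2_field_diff[OF L2_fejer \<phi>]])
  also have "l2_norm L (\<lambda>x. fejer L N (\<lambda>x. \<psi> N x - \<phi> x) x) \<le> l2_norm L (\<lambda>x. \<psi> N x - \<phi> x)"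
    by (rule l2_norm_fejer_le[OF L L2_field_diff[OF \<psi> \<phi>]])
  finally show "norm (l2_norm L (\<lambda>x. fejer L N (\<psi> N) x - \<phi> x))
      \<le> l2_norm L (\<lambda>x. \<psi> N x - \<phi> x) + l2_norm L (\<lambda>x. fejer L N \<phi> x - \<phi> x)"
    by (simp add: l2_norm_nonneg)
qed

lemma l2_norm_lipschitz_tendsto:
  fixes \<phi> :: "real^'n \<Rightarrow> real"
  assumes F: "\<And>N. L2_field L (F N)" "L2_field L f" and \<beta>: "\<And>a b. \<bar>\<beta> a - \<beta> b\<bar> \<le> K * \<bar>a - b\<bar>" "0 \<le> K"
    and b2: "\<And>N. L2_field L (\<lambda>x. \<beta> (F N x))" "L2_field L (\<lambda>x. \<beta> (f x))"
    and lim: "(\<lambda>N. l2_norm L (\<lambda>x. F N x - f x)) \<longlonglongrightarrow> 0"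
  shows "(\<lambda>N. l2_norm L (\<lambda>x. \<beta> (F N x :: real) - \<beta> (f x :: real) :: real)) \<longlonglongrightarrow> 0"
proof (rule Lim_null_comparison[OF always_eventually], rule allI)
  show "(\<lambda>N. K * l2_norm L (\<lambda>x. F N x - f x)) \<longlonglongrightarrow> 0"
    using tendsto_mult[OF tendsto_const lim, of K] by simp
  show "norm (l2_norm L (\<lambda>x. \<beta> (F N x) - \<beta> (f x))) \<le> K * l2_norm L (\<lambda>x. F N x - f x)" for N
    using l2_norm_mono[OF L2_field_diff[OF b2(1) b2(2)] L2_field_diff[OF F(1) F(2)], of _ K N] \<beta>
    by (simp add: l2_norm_nonneg)
qed

text \<open>A smooth substitute for truncation at height \<open>M\<close>.\<close>

definition bsin :: "real \<Rightarrow> real \<Rightarrow> real" where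
  "bsin M s = M * sin (s / M)"

lemma abs_sin_diff_le: "\<bar>sin a - sin b\<bar> \<le> \<bar>a - b :: real\<bar>"
  using field_differentiable_bound[of UNIV sin cos 1 a b]
  by (auto intro!: derivative_eq_intros)

lemma abs_cos_diff_le: "\<bar>cos a - cos b\<bar> \<le> \<bar>a - b :: real\<bar>"
  using field_differentiable_bound[of UNIV cos "\<lambda>x. - sin x" 1 a b]
  by (auto intro!: derivative_eq_intros)

lemma bsin_lipschitz:
  assumes M: "0 < M"
  shows "\<bar>bsin M a - bsin M b\<bar> \<le> \<bar>a - b\<bar>"
proof -
  have "\<bar>bsin M a - bsin M b\<bar> = M * \<bar>sin (a / M) - sin (b / M)\<bar>"
    using M unfolding bsin_def right_diff_distrib[symmetric] abs_mult by simp
  also have "\<dots> \<le> M * \<bar>a / M - b / M\<bar>"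
    using M by (intro mult_left_mono abs_sin_diff_le) simp
  also have "\<dots> = \<bar>a - b\<bar>" using M by (simp flip: diff_divide_distrib)
  finally show ?thesis .
qed

lemma cos_scaled_lipschitz:
  fixes a b M :: real
  shows "0 < M \<Longrightarrow> \<bar>cos (a / M) - cos (b / M)\<bar> \<le> 1 / M * \<bar>a - b\<bar>"
  using abs_cos_diff_le[of "a / M" "b / M"] by (simp add: diff_divide_distrib[symmetric])

lemma bsin_bounded: "0 < M \<Longrightarrow> \<bar>bsin M s\<bar> \<le> M"
  by (simp add: bsin_def abs_mult)

lemma bsin_abs_le: "0 < M \<Longrightarrow> \<bar>bsin M s\<bar> \<le> \<bar>s\<bar>"
  using bsin_lipschitz[of M s 0] by (simp add: bsin_def)

lemma continuous_on_bsin: "0 < M \<Longrightarrow> continuous_on S (bsin M)"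
  unfolding bsin_def by (intro continuous_intros) auto

lemma DERIV_bsin: "0 < M \<Longrightarrow> (bsin M has_real_derivative cos (s / M)) (at s)"
  unfolding bsin_def by (auto intro!: derivative_eq_intros)

lemma L2_bsin:
  fixes f :: "real^'n \<Rightarrow> real"
  assumes M: "0 < M" and f: "L2_field L f"
  shows "L2_field L (\<lambda>x. bsin M (f x))"
proof (rule L2_field_dominated[OF f, of _ 1])
  show "(\<lambda>x. bsin M (f x)) \<in> borel_measurable (Omega L)"
    by (rule borel_measurable_continuous_on[OF continuous_on_bsin[OF M] L2_field_measurable[OF f]])
qed (use bsin_abs_le[OF M] in simp)

lemma measurable_cos_scaled:
  assumes f: "f \<in> borel_measurable N"
  shows "(\<lambda>x. cos (f x / M) :: real) \<in> borel_measurable N"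
  using f by measurable

lemma L2_cos_scaled:
  fixes f :: "real^'n \<Rightarrow> real"
  assumes f: "L2_field L f"
  shows "L2_field L (\<lambda>x. cos (f x / M))"
  by (rule L2_field_bounded[OF measurable_cos_scaled[OF L2_field_measurable[OF f]], of _ 1]) simp

text \<open>The outer mean is the adjoint of the inner one, so that testing with this function
  differentiates the integral of a primitive of \<open>bsin\<close> evaluated at the Fejer
  mean.\<close>

definition nonlinear_test :: "real \<Rightarrow> real \<Rightarrow> nat \<Rightarrow> (real^'n \<Rightarrow> real) \<Rightarrow> real^'n \<Rightarrow> real" where
  "nonlinear_test L M N \<theta> = fejer L N (\<lambda>x. bsin M (fejer L N \<theta> x))"

section \<open>Limits, and bounds uniform in N, of the source, dissipation and transport terms under
  the nonlinear test\<close>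

context
  fixes L M :: real and \<theta> :: "real^'n \<Rightarrow> real"
  assumes L: "0 < L" and M: "0 < M" and \<theta>: "L2_field L \<theta>"
begin

lemma bsin_fejer_tendsto:
  "(\<lambda>N. l2_norm L (\<lambda>x. bsin M (fejer L N \<theta> x) - bsin M (\<theta> x))) \<longlonglongrightarrow> 0"
  by (rule l2_norm_lipschitz_tendsto[OF L2_fejer \<theta>, of _ 1])
     (use bsin_lipschitz[OF M] in \<open>auto intro: L2_bsin[OF M] L2_fejer \<theta> fejer_tendsto[OF L \<theta>]\<close>)

lemma nonlinear_test_tendsto:
  "(\<lambda>N. l2_norm L (\<lambda>x. nonlinear_test L M N \<theta> x - bsin M (\<theta> x))) \<longlonglongrightarrow> 0"
  unfolding nonlinear_test_def
  by (rule fejer_tendsto_diagonal[OF L L2_bsin[OF M L2_fejer] L2_bsin[OF M \<theta>] bsin_fejer_tendsto])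

lemma L2_nonlinear_test: "L2_field L (nonlinear_test L M N \<theta>)"
  by (simp add: nonlinear_test_def L2_fejer)

lemma nonlinear_test_bounded: "\<bar>nonlinear_test L M N \<theta> x\<bar> \<le> M"
  unfolding nonlinear_test_def
  by (rule fejer_bounded[OF L L2_field_measurable[OF L2_bsin[OF M L2_fejer]] bsin_bounded[OF M]])

lemma l2_norm_bsin_le: "L2_field L f \<Longrightarrow> l2_norm L (\<lambda>x. bsin M (f x)) \<le> l2_norm L f"
  using l2_norm_mono[OF L2_bsin[OF M], of L f f 1] bsin_abs_le[OF M] by simp

lemma l2_norm_nonlinear_test_le: "l2_norm L (nonlinear_test L M N \<theta>) \<le> l2_norm L \<theta>"
proof -
  have "l2_norm L (nonlinear_test L M N \<theta>) \<le> l2_norm L (\<lambda>x. bsin M (fejer L N \<theta> x))"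
    unfolding nonlinear_test_def by (rule l2_norm_fejer_le[OF L L2_bsin[OF M L2_fejer]])
  also have "\<dots> \<le> l2_norm L (fejer L N \<theta>)" by (rule l2_norm_bsin_le[OF L2_fejer])
  also have "\<dots> \<le> l2_norm L \<theta>" by (rule l2_norm_fejer_le[OF L \<theta>])
  finally show ?thesis .
qed

lemma nonlinear_test_source:
  assumes g: "L2_field L g"
  shows "(\<lambda>N. l2_inner L g (nonlinear_test L M N \<theta>)) \<longlonglongrightarrow> l2_inner L g (\<lambda>x. bsin M (\<theta> x))"
    and "\<bar>l2_inner L g (nonlinear_test L M N \<theta>)\<bar> \<le> l2_norm L g * l2_norm L \<theta>"
proof -
  have b: "L2_field L (\<lambda>x. bsin M (\<theta> x))" by (rule L2_bsin[OF M \<theta>])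
  have "(\<lambda>N. l2_inner L g (nonlinear_test L M N \<theta>) - l2_inner L g (\<lambda>x. bsin M (\<theta> x))) \<longlonglongrightarrow> 0"
  proof (rule Lim_null_comparison[OF always_eventually], rule allI)
    show "(\<lambda>N. l2_norm L g * l2_norm L (\<lambda>x. nonlinear_test L M N \<theta> x - bsin M (\<theta> x))) \<longlonglongrightarrow> 0"
      using tendsto_mult[OF tendsto_const nonlinear_test_tendsto, of "l2_norm L g"] by simp
    show "norm (l2_inner L g (nonlinear_test L M N \<theta>) - l2_inner L g (\<lambda>x. bsin M (\<theta> x)))
        \<le> l2_norm L g * l2_norm L (\<lambda>x. nonlinear_test L M N \<theta> x - bsin M (\<theta> x))" for N
      unfolding l2_inner_diff_right[OF L2_nonlinear_test b g, symmetric] real_norm_def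
      by (rule l2_inner_Cauchy_Schwarz[OF g L2_field_diff[OF L2_nonlinear_test b]])
  qed
  then show "(\<lambda>N. l2_inner L g (nonlinear_test L M N \<theta>)) \<longlonglongrightarrow> l2_inner L g (\<lambda>x. bsin M (\<theta> x))"
    by (rule LIM_zero_cancel)
  show "\<bar>l2_inner L g (nonlinear_test L M N \<theta>)\<bar> \<le> l2_norm L g * l2_norm L \<theta>"
    using l2_inner_Cauchy_Schwarz[OF g L2_nonlinear_test] mult_left_mono[OF l2_norm_nonlinear_test_le l2_norm_nonneg]
    by (rule order_trans)
qed

context
  fixes G :: "real^'n \<Rightarrow> real^'n"
  assumes G: "weak_gradient L \<theta> G"
begin

lemma L2_weak_gradient: "L2_field L G"
  using G by (simp add: weak_gradient_def)

text \<open>By symmetry the outer mean moves onto G, where it becomes the gradient of the Fejer mean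
  of \<theta>. The cosine is the derivative of \<open>bsin\<close> from the chain rule.\<close>

lemma nonlinear_test_dissipation_eq:
  "l2_inner L G (fejer_grad L N (\<lambda>x. bsin M (fejer L N \<theta> x))) =
    (LINT x|Omega L. (norm (fejer_grad L N \<theta> x))\<^sup>2 * cos (fejer L N \<theta> x / M))"
proof -
  let ?\<phi> = "\<lambda>x. bsin M (fejer L N \<theta> x)" and ?D = "\<lambda>x. cos (fejer L N \<theta> x / M) *\<^sub>R fejer_grad L N \<theta> x"
  have C1: "periodic_C1 L ?\<phi> ?D"
    by (rule periodic_C1_compose[OF periodic_C1_fejer[OF L] DERIV_bsin[OF M]]) (intro continuous_intros, use M in auto)
  have w: "weak_gradient L ?\<phi> ?D" by (rule weak_gradient_periodic_C1[OF L C1])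
  have D2: "L2_field L ?D" using w by (simp add: weak_gradient_def)
  have "l2_inner L G (fejer_grad L N ?\<phi>) = (\<Sum>i\<in>UNIV. l2_inner L (\<lambda>x. G x $ i) (fejer L N (\<lambda>x. ?D x $ i)))"
    unfolding l2_inner_vec[OF L2_weak_gradient L2_fejer_grad] fejer_weak_gradient[OF L w] ..
  also have "\<dots> = (\<Sum>i\<in>UNIV. l2_inner L (fejer L N (\<lambda>x. G x $ i)) (\<lambda>x. ?D x $ i))"
    unfolding fejer_def by (intro sum.cong refl fmult_symmetric[symmetric] L2_field_component[OF L2_weak_gradient] L2_field_component[OF D2[unfolded fejer_def]])
  also have "\<dots> = l2_inner L (fejer_grad L N \<theta>) ?D"
    unfolding l2_inner_vec[OF L2_fejer_grad D2] fejer_weak_gradient[OF L G] ..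
  finally show ?thesis
    by (simp add: l2_inner_def power2_norm_eq_inner mult.commute)
qed

lemma nonlinear_test_dissipation_le:
  "\<bar>l2_inner L G (fejer_grad L N (\<lambda>x. bsin M (fejer L N \<theta> x)))\<bar> \<le> (l2_norm L G)\<^sup>2"
proof -
  have "\<bar>LINT x|Omega L. (fejer_grad L N \<theta> x \<bullet> fejer_grad L N \<theta> x) * cos (fejer L N \<theta> x / M)\<bar>
      \<le> 1 * (l2_norm L (fejer_grad L N \<theta>) * l2_norm L (fejer_grad L N \<theta>))"
    by (rule integrable_inner_mult_bounded(2)[OF L2_fejer_grad L2_fejer_grad
          measurable_cos_scaled[OF L2_field_measurable[OF L2_fejer]]]) auto
  also have "\<dots> \<le> (l2_norm L G)\<^sup>2"
    using l2_norm_fejer_grad_le[OF L G, of N] by (simp add: power2_eq_square mult_mono l2_norm_nonneg)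
  finally show ?thesis by (simp add: nonlinear_test_dissipation_eq power2_norm_eq_inner)
qed

text \<open>Gradient and cosine vary together. With |G|^2 fixed in L1 the cosine converges
  boundedly; the change of the square is (D - G) . (D + G), small by L2 convergence of the
  gradients.\<close>

lemma nonlinear_test_dissipation:
  "(\<lambda>N. l2_inner L G (fejer_grad L N (\<lambda>x. bsin M (fejer L N \<theta> x))))
    \<longlonglongrightarrow> (LINT x|Omega L. (norm (G x))\<^sup>2 * cos (\<theta> x / M))"
proof -
  let ?S = "\<lambda>N. fejer L N \<theta>" and ?D = "\<lambda>N. fejer_grad L N \<theta>"
  have lim1: "(\<lambda>N. LINT x|Omega L. (norm (G x))\<^sup>2 * cos (?S N x / M))
      \<longlonglongrightarrow> (LINT x|Omega L. (norm (G x))\<^sup>2 * cos (\<theta> x / M))"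
  proof (rule tendsto_integral_mult_bounded[OF L2_field_square[OF L2_weak_gradient], of _ 1])
    show "(\<lambda>N. l2_norm L (\<lambda>x. cos (?S N x / M) - cos (\<theta> x / M))) \<longlonglongrightarrow> 0"
    proof (rule l2_norm_lipschitz_tendsto[OF L2_fejer \<theta> cos_scaled_lipschitz[OF M] _ _ _ fejer_tendsto[OF L \<theta>]])
      show "0 \<le> 1 / M" using M by simp
    qed (rule L2_cos_scaled[OF L2_fejer], rule L2_cos_scaled[OF \<theta>])
  qed (auto intro!: L2_field_measurable L2_cos_scaled L2_fejer \<theta>)
  have "(\<lambda>N. (LINT x|Omega L. (norm (?D N x))\<^sup>2 * cos (?S N x / M)) - (LINT x|Omega L. (norm (G x))\<^sup>2 * cos (?S N x / M))) \<longlonglongrightarrow> 0"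
  proof (rule Lim_null_comparison[OF always_eventually], rule allI)
    show "(\<lambda>N. 2 * l2_norm L G * l2_norm L (\<lambda>x. ?D N x - G x)) \<longlonglongrightarrow> 0"
      using tendsto_mult[OF tendsto_const fejer_grad_tendsto[OF L G], of "2 * l2_norm L G"] by simp
    fix N
    let ?c = "\<lambda>x. cos (?S N x / M)"
    have c: "?c \<in> borel_measurable (Omega L)" by (rule measurable_cos_scaled[OF L2_field_measurable[OF L2_fejer]])
    have c1: "\<bar>?c x\<bar> \<le> 1" for x by simp
    have d: "L2_field L (\<lambda>x. ?D N x - G x)" and s: "L2_field L (\<lambda>x. ?D N x + G x)"
      by (intro L2_field_diff L2_field_add L2_fejer_grad L2_weak_gradient)+
    have i: "integrable (Omega L) (\<lambda>x. (norm (?D N x))\<^sup>2 * ?c x)" "integrable (Omega L) (\<lambda>x. (norm (G x))\<^sup>2 * ?c x)"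
      using integrable_inner_mult_bounded(1)[OF L2_fejer_grad L2_fejer_grad c c1]
        integrable_inner_mult_bounded(1)[OF L2_weak_gradient L2_weak_gradient c c1] by (simp_all add: power2_norm_eq_inner)
    have "(LINT x|Omega L. (norm (?D N x))\<^sup>2 * ?c x) - (LINT x|Omega L. (norm (G x))\<^sup>2 * ?c x)
        = (LINT x|Omega L. (norm (?D N x))\<^sup>2 * ?c x - (norm (G x))\<^sup>2 * ?c x)"
      using i by simp
    also have "\<dots> = (LINT x|Omega L. ((?D N x - G x) \<bullet> (?D N x + G x)) * ?c x)"
      by (intro Bochner_Integration.integral_cong refl)
         (simp add: power2_norm_eq_inner inner_diff_left inner_add_right inner_commute algebra_simps)
    finally have "\<bar>(LINT x|Omega L. (norm (?D N x))\<^sup>2 * ?c x) - (LINT x|Omega L. (norm (G x))\<^sup>2 * ?c x)\<bar>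
        \<le> 1 * (l2_norm L (\<lambda>x. ?D N x - G x) * l2_norm L (\<lambda>x. ?D N x + G x))"
      using integrable_inner_mult_bounded(2)[OF d s c c1] by simp
    also have "\<dots> \<le> 2 * l2_norm L G * l2_norm L (\<lambda>x. ?D N x - G x)"
    proof -
      have "l2_norm L (\<lambda>x. ?D N x + G x) \<le> 2 * l2_norm L G"
        using l2_norm_triangle[OF L2_fejer_grad L2_weak_gradient, of N \<theta>] l2_norm_fejer_grad_le[OF L G, of N] by linarith
      from mult_left_mono[OF this l2_norm_nonneg[of L "\<lambda>x. ?D N x - G x"]] show ?thesis by (simp add: mult_ac)
    qed
    finally show "norm ((LINT x|Omega L. (norm (?D N x))\<^sup>2 * ?c x) - (LINT x|Omega L. (norm (G x))\<^sup>2 * ?c x))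
        \<le> 2 * l2_norm L G * l2_norm L (\<lambda>x. ?D N x - G x)"
      unfolding real_norm_def .
  qed
  from tendsto_add[OF this lim1] show ?thesis by (simp add: nonlinear_test_dissipation_eq)
qed

context
  fixes u :: "real^'n \<Rightarrow> real^'n"
  assumes u: "L2_field L u" and df: "div_free L u"
begin

text \<open>This bound is uniform in N but grows with M, which dictates the order of the two
  limits.\<close>

lemma nonlinear_test_transport_le:
  "\<bar>l2_inner L (\<lambda>x. u x \<bullet> G x) (nonlinear_test L M N \<theta>)\<bar> \<le> M * (l2_norm L u * l2_norm L G)"
  unfolding l2_inner_def inner_real_def
  by (rule integrable_inner_mult_bounded(2)[OF u L2_weak_gradient L2_field_measurable[OF L2_nonlinear_test] nonlinear_test_bounded])
     (use M in simp)

lemma nonlinear_test_transport: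
  "(\<lambda>N. l2_inner L (\<lambda>x. u x \<bullet> G x) (nonlinear_test L M N \<theta>)) \<longlonglongrightarrow> 0"
proof -
  let ?b = "\<lambda>N x. bsin M (fejer L N \<theta> x)"
  have F: "integrable (Omega L) (\<lambda>x. u x \<bullet> G x)" by (rule L2_field_inner_integrable[OF u L2_weak_gradient])
  have bm: "?b N \<in> borel_measurable (Omega L)" for N by (rule L2_field_measurable[OF L2_bsin[OF M L2_fejer]])
  note b\<theta> = L2_field_measurable[OF L2_bsin[OF M \<theta>]]
  have lim1: "(\<lambda>N. LINT x|Omega L. (u x \<bullet> G x) * nonlinear_test L M N \<theta> x) \<longlonglongrightarrow> (LINT x|Omega L. (u x \<bullet> G x) * bsin M (\<theta> x))"
    by (rule tendsto_integral_mult_bounded[OF F L2_field_measurable[OF L2_nonlinear_test] nonlinear_test_bounded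
          b\<theta> bsin_bounded[OF M] nonlinear_test_tendsto])
  have lim2: "(\<lambda>N. LINT x|Omega L. (u x \<bullet> G x) * ?b N x) \<longlonglongrightarrow> (LINT x|Omega L. (u x \<bullet> G x) * bsin M (\<theta> x))"
    by (rule tendsto_integral_mult_bounded[OF F bm bsin_bounded[OF M] b\<theta> bsin_bounded[OF M] bsin_fejer_tendsto])
  have "(\<lambda>N. LINT x|Omega L. (u x \<bullet> G x) * ?b N x) \<longlonglongrightarrow> 0"
  proof (rule Lim_null_comparison[OF always_eventually], rule allI)
    show "(\<lambda>N. M * l2_norm L u * l2_norm L (\<lambda>x. fejer_grad L N \<theta> x - G x)) \<longlonglongrightarrow> 0"
      using tendsto_mult[OF tendsto_const fejer_grad_tendsto[OF L G], of "M * l2_norm L u"] by simp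
    fix N
    \<comment> \<open>The primitive -M^2 cos(s / M) of \<open>bsin\<close> turns the integrand into
      u . grad of a periodic function.\<close>
    have z: "(LINT x|Omega L. (u x \<bullet> fejer_grad L N \<theta> x) * ?b N x) = 0"
      by (rule div_free_transport_C1[OF periodic_C1_fejer[OF L] df, of "\<lambda>s. - M\<^sup>2 * cos (s / M)"])
         (use M in \<open>auto intro!: derivative_eq_intros continuous_intros simp: bsin_def power2_eq_square\<close>)
    have d: "L2_field L (\<lambda>x. fejer_grad L N \<theta> x - G x)" by (rule L2_field_diff[OF L2_fejer_grad L2_weak_gradient])
    have i: "integrable (Omega L) (\<lambda>x. (u x \<bullet> fejer_grad L N \<theta> x) * ?b N x)" "integrable (Omega L) (\<lambda>x. (u x \<bullet> G x) * ?b N x)"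
      using M by (auto intro!: integrable_inner_mult_bounded(1)[where B=M] u L2_weak_gradient L2_fejer_grad bm bsin_bounded)
    have "(LINT x|Omega L. (u x \<bullet> (fejer_grad L N \<theta> x - G x)) * ?b N x)
        = (LINT x|Omega L. (u x \<bullet> fejer_grad L N \<theta> x) * ?b N x - (u x \<bullet> G x) * ?b N x)"
      by (intro Bochner_Integration.integral_cong refl) (simp add: inner_diff_right algebra_simps)
    also have "\<dots> = - (LINT x|Omega L. (u x \<bullet> G x) * ?b N x)" using i z by simp
    finally have "\<bar>LINT x|Omega L. (u x \<bullet> G x) * ?b N x\<bar> = \<bar>LINT x|Omega L. (u x \<bullet> (fejer_grad L N \<theta> x - G x)) * ?b N x\<bar>"
      by simp
    also have "\<dots> \<le> M * (l2_norm L u * l2_norm L (\<lambda>x. fejer_grad L N \<theta> x - G x))"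
      by (rule integrable_inner_mult_bounded(2)[OF u d bm bsin_bounded[OF M]]) (use M in simp)
    finally show "norm (LINT x|Omega L. (u x \<bullet> G x) * ?b N x) \<le> M * l2_norm L u * l2_norm L (\<lambda>x. fejer_grad L N \<theta> x - G x)"
      by (simp add: mult.assoc)
  qed
  with lim2 have "(LINT x|Omega L. (u x \<bullet> G x) * bsin M (\<theta> x)) = 0" using LIMSEQ_unique by blast
  with lim1 show ?thesis by (simp add: l2_inner_def)
qed

end

end

end

section \<open>A chain rule for indefinite integrals\<close>

lemmas integrable_on_subinterval = Equivalence_Lebesgue_Henstock_Integration.integrable_subinterval
lemmas integral_split_interval = Equivalence_Measurable_On_Borel.integral_combine

text \<open>A uniform partition of mesh at most d; the bounds telescope because the right-hand side
  is itself an increment.\<close>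

lemma increment_bound_local_to_global:
  fixes D W :: "real \<Rightarrow> real"
  assumes aT: "a \<le> T" and d: "0 < d"
    and loc: "\<And>s t. a \<le> s \<Longrightarrow> s \<le> t \<Longrightarrow> t \<le> T \<Longrightarrow> t - s \<le> d \<Longrightarrow> \<bar>D t - D s\<bar> \<le> W t - W s"
  shows "\<bar>D T - D a\<bar> \<le> W T - W a"
proof -
  obtain m :: nat where m: "(T - a) / d < real m" using reals_Archimedean2 by blast
  define n where "n = Suc m"
  define h where "h = (T - a) / real n"
  have n0: "0 < real n" by (simp add: n_def)
  have h0: "0 \<le> h" using aT n0 by (simp add: h_def)
  have nh: "a + real n * h = T" using n0 by (simp add: h_def)
  have hd: "h \<le> d"
  proof -
    have "T - a < real m * d" using m d by (simp add: pos_divide_less_eq)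
    also have "\<dots> \<le> real n * d" using d by (simp add: n_def)
    finally show ?thesis using n0 by (simp add: h_def pos_divide_le_eq mult.commute)
  qed
  have "\<bar>D (a + real k * h) - D a\<bar> \<le> W (a + real k * h) - W a" if "k \<le> n" for k
    using that
  proof (induction k)
    case (Suc k)
    have le: "a + real (Suc k) * h \<le> T"
      using mult_right_mono[of "real (Suc k)" "real n" h] Suc.prems h0 nh by simp
    have eq: "a + real (Suc k) * h = a + real k * h + h" by (simp add: algebra_simps)
    have "\<bar>D (a + real (Suc k) * h) - D (a + real k * h)\<bar> \<le> W (a + real (Suc k) * h) - W (a + real k * h)"
      using h0 hd le unfolding eq by (intro loc) auto
    then show ?case using Suc by auto
  qed simp
  from this[of n] show ?thesis by (simp add: nh)
qed

text \<open>The c_i are only indefinite integrals, and E is known only through a first-order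
  expansion with quadratic remainder. No pointwise derivative is formed: on short intervals the
  error is at most \<epsilon> times the variation of the c_i, and such errors add up to \<epsilon>
  times a fixed total.\<close>

theorem integral_chain_rule:
  fixes c r G :: "'i \<Rightarrow> real \<Rightarrow> real" and E :: "real \<Rightarrow> real"
  assumes I: "finite I" and aT: "a \<le> T"
    and r: "\<And>i. i \<in> I \<Longrightarrow> integrable (lebesgue_on {a..T}) (r i)"
    and c: "\<And>i t. i \<in> I \<Longrightarrow> a \<le> t \<Longrightarrow> t \<le> T \<Longrightarrow> c i t = c i a + (LINT s|lebesgue_on {a..t}. r i s)"
    and G: "\<And>i. i \<in> I \<Longrightarrow> continuous_on {a..T} (G i)"
    and E: "\<And>s t. a \<le> s \<Longrightarrow> s \<le> t \<Longrightarrow> t \<le> T \<Longrightarrow>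
      \<bar>E t - E s - (\<Sum>i\<in>I. G i s * (c i t - c i s))\<bar> \<le> B * (\<Sum>i\<in>I. (c i t - c i s)\<^sup>2)"
    and B: "0 \<le> B"
  shows "integrable (lebesgue_on {a..T}) (\<lambda>s. \<Sum>i\<in>I. G i s * r i s)"
    and "E T = E a + (LINT s|lebesgue_on {a..T}. (\<Sum>i\<in>I. G i s * r i s))"
proof -
  have Gr: "integrable (lebesgue_on {a..T}) (\<lambda>s. G i s * r i s)" if "i \<in> I" for i
  proof -
    have "compact (G i ` {a..T})" by (intro compact_continuous_image G that compact_Icc)
    then obtain K where K: "\<And>s. s \<in> {a..T} \<Longrightarrow> \<bar>G i s\<bar> \<le> K"
      using compact_imp_bounded bounded_iff by (metis imageI real_norm_def)
    show ?thesis
    proof (rule Bochner_Integration.integrable_bound[of _ "\<lambda>s. K * r i s"])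
      show "integrable (lebesgue_on {a..T}) (\<lambda>s. K * r i s)" using r[OF that] by simp
      show "(\<lambda>s. G i s * r i s) \<in> borel_measurable (lebesgue_on {a..T})"
        by (intro borel_measurable_times continuous_imp_measurable_on_sets_lebesgue G that
            borel_measurable_integrable r) simp
      show "AE s in lebesgue_on {a..T}. norm (G i s * r i s) \<le> norm (K * r i s)"
      proof (rule AE_I2)
        fix s assume "s \<in> space (lebesgue_on {a..T})"
        then have "\<bar>G i s\<bar> \<le> \<bar>K\<bar>" using K[of s] by simp
        then show "norm (G i s * r i s) \<le> norm (K * r i s)"
          by (simp add: abs_mult mult_right_mono)
      qed
    qed
  qed
  show int: "integrable (lebesgue_on {a..T}) (\<lambda>s. \<Sum>i\<in>I. G i s * r i s)"
    by (intro Bochner_Integration.integrable_sum Gr)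
  \<comment> \<open>A variation function of c_i: it dominates the increments of c_i and is
    continuous, so the variation over short intervals is small.\<close>
  define V where "V i t = (LINT s|lebesgue_on {a..t}. \<bar>r i s\<bar>)" for i t
  have incr: "(LINT x|lebesgue_on {a..t}. f x) - (LINT x|lebesgue_on {a..s}. f x) = (LINT x|lebesgue_on {s..t}. f x)"
    if "integrable (lebesgue_on {a..T}) f" "a \<le> s" "s \<le> t" "t \<le> T" for f :: "real \<Rightarrow> real" and s t
  proof -
    have "integrable (lebesgue_on {a..t}) f" using that by (intro integrable_on_subinterval[OF that(1)]) auto
    from integral_split_interval[OF this that(2,3)] show ?thesis by simp
  qed
  have V_incr: "V i t - V i s = (LINT x|lebesgue_on {s..t}. \<bar>r i x\<bar>)" if "i \<in> I" "a \<le> s" "s \<le> t" "t \<le> T" for i s t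
    unfolding V_def using that r by (intro incr) auto
  have c_incr: "c i t - c i s = (LINT x|lebesgue_on {s..t}. r i x)" if "i \<in> I" "a \<le> s" "s \<le> t" "t \<le> T" for i s t
    using incr[OF r[OF that(1)] that(2-4)] c[OF that(1), of t] c[OF that(1), of s] that by simp
  have sub: "integrable (lebesgue_on {s..t}) f" if "integrable (lebesgue_on {a..T}) f" "a \<le> s" "t \<le> T" for f :: "real \<Rightarrow> real" and s t
    using that by (intro integrable_on_subinterval[OF that(1)]) auto
  have c_V: "\<bar>c i t - c i s\<bar> \<le> V i t - V i s" if "i \<in> I" "a \<le> s" "s \<le> t" "t \<le> T" for i s t
    unfolding c_incr[OF that] V_incr[OF that] by (rule integral_abs_bound)
  \<comment> \<open>The defect of the claimed identity; the goal is that it has no increment over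
    the whole interval.\<close>
  define D where "D t = E t - (LINT s|lebesgue_on {a..t}. (\<Sum>i\<in>I. G i s * r i s))" for t
  define W where "W t = (\<Sum>i\<in>I. V i t)" for t
  have key: "\<bar>D T - D a\<bar> \<le> \<epsilon> * ((B + 1) * (W T - W a))" if e: "0 < \<epsilon>" for \<epsilon>
  proof -
    have "\<forall>i\<in>I. \<exists>d. 0 < d \<and> (\<forall>s\<in>{a..T}. \<forall>t\<in>{a..T}. \<bar>t - s\<bar> < d \<longrightarrow> \<bar>G i t - G i s\<bar> < \<epsilon> \<and> \<bar>V i t - V i s\<bar> < \<epsilon>)"
    proof
      fix i assume i: "i \<in> I"
      have uG: "uniformly_continuous_on {a..T} (G i)" and uV: "uniformly_continuous_on {a..T} (V i)"
        unfolding V_def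
        by (intro compact_uniformly_continuous compact_Icc G i indefinite_integral_continuous_real integrable_abs r)+
      obtain d1 where d1: "0 < d1" "\<forall>s\<in>{a..T}. \<forall>t\<in>{a..T}. dist t s < d1 \<longrightarrow> dist (G i t) (G i s) < \<epsilon>"
        using uG e unfolding uniformly_continuous_on_def by blast
      obtain d2 where d2: "0 < d2" "\<forall>s\<in>{a..T}. \<forall>t\<in>{a..T}. dist t s < d2 \<longrightarrow> dist (V i t) (V i s) < \<epsilon>"
        using uV e unfolding uniformly_continuous_on_def by blast
      show "\<exists>d. 0 < d \<and> (\<forall>s\<in>{a..T}. \<forall>t\<in>{a..T}. \<bar>t - s\<bar> < d \<longrightarrow> \<bar>G i t - G i s\<bar> < \<epsilon> \<and> \<bar>V i t - V i s\<bar> < \<epsilon>)"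
        using d1 d2 by (intro exI[of _ "min d1 d2"]) (simp add: dist_real_def)
    qed
    from bchoice[OF this] obtain d where "\<forall>i\<in>I. 0 < d i \<and>
      (\<forall>s\<in>{a..T}. \<forall>t\<in>{a..T}. \<bar>t - s\<bar> < d i \<longrightarrow> \<bar>G i t - G i s\<bar> < \<epsilon> \<and> \<bar>V i t - V i s\<bar> < \<epsilon>)" ..
    then have d: "\<And>i. i \<in> I \<Longrightarrow> 0 < d i"
      "\<And>i s t. i \<in> I \<Longrightarrow> s \<in> {a..T} \<Longrightarrow> t \<in> {a..T} \<Longrightarrow> \<bar>t - s\<bar> < d i \<Longrightarrow> \<bar>G i t - G i s\<bar> < \<epsilon> \<and> \<bar>V i t - V i s\<bar> < \<epsilon>"
      by blast+
    \<comment> \<open>Inserting 1 covers an empty index set; halving makes the inequality with every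
      d i strict.\<close>
    define \<delta> where "\<delta> = Min (insert 1 (d ` I)) / 2"
    have "0 < Min (insert 1 (d ` I))" using I d(1) by (subst Min_gr_iff) auto
    then have \<delta>: "0 < \<delta>" "\<delta> < Min (insert 1 (d ` I))" by (simp_all add: \<delta>_def)
    have \<delta>d: "\<delta> < d i" if "i \<in> I" for i
      using \<delta>(2) I that by (meson Min_le finite.insertI finite_imageI imageI insertI2 less_le_trans)
    have "\<bar>D t - D s\<bar> \<le> \<epsilon> * ((B + 1) * W t) - \<epsilon> * ((B + 1) * W s)" if st: "a \<le> s" "s \<le> t" "t \<le> T" "t - s \<le> \<delta>" for s t
    proof -
      have small: "\<bar>G i x - G i s\<bar> \<le> \<epsilon>" "V i t - V i s \<le> \<epsilon>" if "i \<in> I" "x \<in> {s..t}" for i x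
        using d(2)[OF that(1), of s x] d(2)[OF that(1), of s t] \<delta>d[OF that(1)] st that(2) by auto
      have "D t - D s = (E t - E s) - (LINT x|lebesgue_on {s..t}. (\<Sum>i\<in>I. G i x * r i x))"
        using incr[OF int st(1-3)] by (simp add: D_def)
      also have "(LINT x|lebesgue_on {s..t}. (\<Sum>i\<in>I. G i x * r i x)) = (\<Sum>i\<in>I. LINT x|lebesgue_on {s..t}. G i x * r i x)"
        by (rule Bochner_Integration.integral_sum) (rule sub[OF Gr], use st in auto)
      also have "(E t - E s) - (\<Sum>i\<in>I. LINT x|lebesgue_on {s..t}. G i x * r i x)
          = (E t - E s - (\<Sum>i\<in>I. G i s * (c i t - c i s)))
            - (\<Sum>i\<in>I. (LINT x|lebesgue_on {s..t}. G i x * r i x) - G i s * (c i t - c i s))"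
        by (simp add: sum_subtractf)
      finally have "\<bar>D t - D s\<bar> \<le> \<bar>E t - E s - (\<Sum>i\<in>I. G i s * (c i t - c i s))\<bar>
          + (\<Sum>i\<in>I. \<bar>(LINT x|lebesgue_on {s..t}. G i x * r i x) - G i s * (c i t - c i s)\<bar>)"
        using sum_abs[of "\<lambda>i. (LINT x|lebesgue_on {s..t}. G i x * r i x) - G i s * (c i t - c i s)" I]
        by linarith
      \<comment> \<open>In the remainder one factor of each squared increment is at most \<epsilon>.
        In the other sum, freezing G at the left endpoint costs \<epsilon> times the
        variation.\<close>
      also have "\<dots> \<le> B * (\<Sum>i\<in>I. \<epsilon> * (V i t - V i s)) + (\<Sum>i\<in>I. \<epsilon> * (V i t - V i s))"
      proof (rule add_mono)
        have "(c i t - c i s)\<^sup>2 \<le> \<epsilon> * (V i t - V i s)" if "i \<in> I" for i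
        proof -
          have "(c i t - c i s)\<^sup>2 = \<bar>c i t - c i s\<bar> * \<bar>c i t - c i s\<bar>" by (simp add: power2_eq_square)
          also have "\<dots> \<le> \<epsilon> * (V i t - V i s)"
            using c_V[OF that st(1-3)] small(2)[OF that, of s] st(2) e by (intro mult_mono) auto
          finally show ?thesis .
        qed
        then show "\<bar>E t - E s - (\<Sum>i\<in>I. G i s * (c i t - c i s))\<bar> \<le> B * (\<Sum>i\<in>I. \<epsilon> * (V i t - V i s))"
          using E[OF st(1-3)] B by (meson mult_left_mono order_trans sum_mono)
        show "(\<Sum>i\<in>I. \<bar>(LINT x|lebesgue_on {s..t}. G i x * r i x) - G i s * (c i t - c i s)\<bar>) \<le> (\<Sum>i\<in>I. \<epsilon> * (V i t - V i s))"
        proof (rule sum_mono)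
          fix i assume i: "i \<in> I"
          have ri: "integrable (lebesgue_on {s..t}) (r i)" "integrable (lebesgue_on {s..t}) (\<lambda>x. G i x * r i x)"
            using st by (simp_all add: sub[OF r[OF i]] sub[OF Gr[OF i]])
          have "(LINT x|lebesgue_on {s..t}. G i x * r i x) - G i s * (c i t - c i s)
              = (LINT x|lebesgue_on {s..t}. (G i x - G i s) * r i x)"
            using ri by (simp add: c_incr[OF i st(1-3)] left_diff_distrib)
          also have "\<bar>\<dots>\<bar> \<le> (LINT x|lebesgue_on {s..t}. \<bar>(G i x - G i s) * r i x\<bar>)" by (rule integral_abs_bound)
          also have "\<dots> \<le> (LINT x|lebesgue_on {s..t}. \<epsilon> * \<bar>r i x\<bar>)"
          proof (rule integral_mono)
            show "integrable (lebesgue_on {s..t}) (\<lambda>x. \<bar>(G i x - G i s) * r i x\<bar>)"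
              unfolding left_diff_distrib using ri by simp
            show "integrable (lebesgue_on {s..t}) (\<lambda>x. \<epsilon> * \<bar>r i x\<bar>)" using ri by simp
            fix x assume "x \<in> space (lebesgue_on {s..t})"
            then show "\<bar>(G i x - G i s) * r i x\<bar> \<le> \<epsilon> * \<bar>r i x\<bar>"
              unfolding abs_mult by (intro mult_right_mono small(1)[OF i]) auto
          qed
          also have "\<dots> = \<epsilon> * (V i t - V i s)" by (simp add: V_incr[OF i st(1-3)])
          finally show "\<bar>(LINT x|lebesgue_on {s..t}. G i x * r i x) - G i s * (c i t - c i s)\<bar> \<le> \<epsilon> * (V i t - V i s)" .
        qed
      qed
      also have "\<dots> = \<epsilon> * ((B + 1) * W t) - \<epsilon> * ((B + 1) * W s)"
        by (simp add: W_def sum_subtractf flip: sum_distrib_left) (simp add: algebra_simps)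
      finally show ?thesis .
    qed
    from increment_bound_local_to_global[OF aT \<delta>(1) this] show ?thesis by (simp add: right_diff_distrib)
  qed
  have "\<bar>D T - D a\<bar> \<le> 0"
  proof (rule field_le_epsilon)
    fix e :: real assume e: "0 < e"
    \<comment> \<open>The modulus of the fixed total; dividing by C + 1 is safe even if it is
      zero.\<close>
    define C where "C = \<bar>(B + 1) * (W T - W a)\<bar>"
    have "\<bar>D T - D a\<bar> \<le> e / (C + 1) * ((B + 1) * (W T - W a))" by (rule key) (use e in \<open>simp add: C_def add_nonneg_pos\<close>)
    also have "\<dots> \<le> e / (C + 1) * (C + 1)" using e by (intro mult_left_mono) (auto simp: C_def)
    also have "\<dots> = e" by (simp add: C_def add_nonneg_eq_0_iff)
    finally show "\<bar>D T - D a\<bar> \<le> 0 + e" by simp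
  qed
  moreover have "(LINT s|lebesgue_on {a..a}. (\<Sum>i\<in>I. G i s * r i s)) = 0"
    using incr[OF int order_refl order_refl aT] by simp
  ultimately show "E T = E a + (LINT s|lebesgue_on {a..T}. (\<Sum>i\<in>I. G i s * r i s))"
    by (simp add: D_def)
qed

section \<open>Energy balances of the tracer\<close>

text \<open>Sines and cosines under one index type, so that all coefficients form a single finite
  family for the chain rule.\<close>

definition mode :: "real \<Rightarrow> (int^'n) + (int^'n) \<Rightarrow> real^'n \<Rightarrow> real" where
  "mode L = case_sum (cosw L) (sinw L)"

definition mode_grad :: "real \<Rightarrow> (int^'n) + (int^'n) \<Rightarrow> real^'n \<Rightarrow> real^'n" where
  "mode_grad L = case_sum (\<lambda>k x. - sinw L k x *\<^sub>R wave L k) (\<lambda>k x. cosw L k x *\<^sub>R wave L k)"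

definition mode_weight :: "real \<Rightarrow> (int^'n \<Rightarrow> real) \<Rightarrow> (int^'n) + (int^'n) \<Rightarrow> real" where
  "mode_weight L w i = case_sum w w i / L ^ CARD('n)"

lemma periodic_C1_mode: "0 < L \<Longrightarrow> periodic_C1 L (mode L i) (mode_grad L i)"
  by (cases i) (simp_all only: mode_def mode_grad_def sum.case periodic_C1_cosw periodic_C1_sinw)

lemma L2_mode: "L2_field L (mode L i)"
  by (cases i) (simp_all add: mode_def L2_cosw L2_sinw)

lemma fmult_modes:
  assumes "finite A"
  shows "fmult L A w f x = (\<Sum>i\<in>A <+> A. mode_weight L w i * l2_inner L f (mode L i) * mode L i x)"
  by (simp add: sum.Plus[OF assms assms] fmult_def mode_def mode_weight_def sum.distrib[symmetric] algebra_simps add_divide_distrib)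

lemma fmult_grad_modes:
  assumes "finite A"
  shows "fmult_grad L A w f x = (\<Sum>i\<in>A <+> A. (mode_weight L w i * l2_inner L f (mode L i)) *\<^sub>R mode_grad L i x)"
  by (simp add: sum.Plus[OF assms assms] fmult_grad_def mode_def mode_grad_def mode_weight_def sum.distrib[symmetric]
      scaleR_diff_left scaleR_diff_right)
     (simp add: algebra_simps)

definition tracer_rhs ::
    "real \<Rightarrow> real \<Rightarrow> (real^'n \<Rightarrow> real^'n) \<Rightarrow> (real^'n \<Rightarrow> real) \<Rightarrow> (real^'n \<Rightarrow> real^'n) \<Rightarrow>
     (real^'n \<Rightarrow> real) \<Rightarrow> (real^'n \<Rightarrow> real^'n) \<Rightarrow> real" where
  "tracer_rhs L \<mu> u g G \<phi> D\<phi> =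
     l2_inner L g \<phi> - \<mu> * l2_inner L G D\<phi> - l2_inner L (\<lambda>x. u x \<bullet> G x) \<phi>"

lemma tracer_rhs_fmult:
  fixes u G :: "real^'n \<Rightarrow> real^'n"
  assumes L: "0 < L" and A: "finite A" and u: "L2_field L u" and g: "L2_field L g" and G: "L2_field L G"
  shows "tracer_rhs L \<mu> u g G (fmult L A w f) (fmult_grad L A w f) =
    (\<Sum>i\<in>A <+> A. mode_weight L w i * l2_inner L f (mode L i) * tracer_rhs L \<mu> u g G (mode L i) (mode_grad L i))"
proof -
  let ?a = "\<lambda>i. mode_weight L w i * l2_inner L f (mode L i)"
  have md: "continuous_on UNIV (mode L i)" for i by (rule periodic_C1_continuous[OF periodic_C1_mode[OF L]])
  have mg: "L2_field L (mode_grad L i)" for i by (rule periodic_C1_L2(2)[OF periodic_C1_mode[OF L]])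
  have "l2_inner L g (fmult L A w f) = (\<Sum>i\<in>A <+> A. l2_inner L g (\<lambda>x. ?a i * mode L i x))"
    unfolding fmult_modes[OF A, abs_def] by (intro l2_inner_sum_right L2_field_cmult L2_mode g)
  then have 1: "l2_inner L g (fmult L A w f) = (\<Sum>i\<in>A <+> A. ?a i * l2_inner L g (mode L i))"
    by (simp only: l2_inner_cmult_right)
  have "l2_inner L G (fmult_grad L A w f) = (\<Sum>i\<in>A <+> A. l2_inner L G (\<lambda>x. ?a i *\<^sub>R mode_grad L i x))"
    unfolding fmult_grad_modes[OF A, abs_def] by (intro l2_inner_sum_right L2_field_scale mg G)
  then have 2: "l2_inner L G (fmult_grad L A w f) = (\<Sum>i\<in>A <+> A. ?a i * l2_inner L G (mode_grad L i))"
    by (simp add: l2_inner_def)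
  have "l2_inner L (\<lambda>x. u x \<bullet> G x) (fmult L A w f)
      = (LINT x|Omega L. (\<Sum>i\<in>A <+> A. ?a i * ((u x \<bullet> G x) * mode L i x)))"
    unfolding l2_inner_def fmult_modes[OF A, abs_def] inner_real_def
    by (intro Bochner_Integration.integral_cong refl) (simp add: sum_distrib_left algebra_simps)
  also have "\<dots> = (\<Sum>i\<in>A <+> A. LINT x|Omega L. ?a i * ((u x \<bullet> G x) * mode L i x))"
    by (intro Bochner_Integration.integral_sum integrable_mult_right integrable_inner_mult_continuous u G md)
  finally have 3: "l2_inner L (\<lambda>x. u x \<bullet> G x) (fmult L A w f) = (\<Sum>i\<in>A <+> A. ?a i * l2_inner L (\<lambda>x. u x \<bullet> G x) (mode L i))"
    by (simp add: l2_inner_def)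
  show ?thesis
    unfolding tracer_rhs_def 1 2 3 right_diff_distrib sum_subtractf sum_distrib_left
    by (simp add: algebra_simps)
qed

lemma tracer_solution_rhs:
  assumes "tracer_solution L \<mu> t0 u g \<theta>" "periodic_C1 L \<phi> D\<phi>" "t0 \<le> t"
  shows "integrable (lebesgue_on {t0..t}) (\<lambda>s. tracer_rhs L \<mu> (u s) g (grad L (\<theta> s)) \<phi> D\<phi>)"
    and "l2_inner L (\<theta> t) \<phi> = l2_inner L (\<theta> t0) \<phi> +
      (LINT s|lebesgue_on {t0..t}. tracer_rhs L \<mu> (u s) g (grad L (\<theta> s)) \<phi> D\<phi>)"
  using assms unfolding tracer_solution_def tracer_rhs_def Let_def by blast+

lemma tracer_solution_L2: "tracer_solution L \<mu> t0 u g \<theta> \<Longrightarrow> t0 \<le> t \<Longrightarrow> L2_field L (\<theta> t)"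
  unfolding tracer_solution_def energy_class_def by blast

lemma tracer_solution_H1:
  assumes "tracer_solution L \<mu> t0 u g \<theta>"
  shows "AE s in lebesgue_on {t0..T}. t0 \<le> s \<and> in_H1 L (\<theta> s)"
proof -
  have "AE s in lebesgue_on {t0..}. in_H1 L (\<theta> s)"
    using assms unfolding tracer_solution_def energy_class_def by blast
  then have "AE s in lebesgue. s \<in> {t0..} \<longrightarrow> in_H1 L (\<theta> s)"
    by (simp add: AE_restrict_space_iff)
  then show ?thesis by (auto simp: AE_restrict_space_iff elim!: eventually_mono)
qed

lemma tracer_coeff_continuous:
  assumes sol: "tracer_solution L \<mu> t0 u g \<theta>" and \<phi>: "periodic_C1 L \<phi> D\<phi>" and T: "t0 \<le> T"
  shows "continuous_on {t0..T} (\<lambda>t. l2_inner L (\<theta> t) \<phi>)"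
proof -
  have "continuous_on {t0..T} (\<lambda>t. l2_inner L (\<theta> t0) \<phi> +
      (LINT s|lebesgue_on {t0..t}. tracer_rhs L \<mu> (u s) g (grad L (\<theta> s)) \<phi> D\<phi>))"
    by (intro continuous_intros indefinite_integral_continuous_real tracer_solution_rhs(1)[OF sol \<phi> T])
  then show ?thesis
    by (rule continuous_on_eq) (rule tracer_solution_rhs(2)[OF sol \<phi>, symmetric], simp)
qed

text \<open>Mean value theorem and Lipschitz continuity of \<beta>'; this avoids a second
  derivative.\<close>

lemma second_order_remainder:
  fixes \<beta> \<beta>' :: "real \<Rightarrow> real"
  assumes \<beta>: "\<And>s. (\<beta> has_real_derivative \<beta>' s) (at s)" and K: "\<And>a b. \<bar>\<beta>' a - \<beta>' b\<bar> \<le> K * \<bar>a - b\<bar>" "0 \<le> K"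
  shows "\<bar>\<beta> y - \<beta> x - \<beta>' x * (y - x)\<bar> \<le> K * (y - x)\<^sup>2"
proof -
  have "\<exists>z. \<bar>z - x\<bar> \<le> \<bar>y - x\<bar> \<and> \<beta> y - \<beta> x = \<beta>' z * (y - x)"
  proof (cases x y rule: linorder_cases)
    case less
    then obtain z where "x < z" "z < y" "\<beta> y - \<beta> x = (y - x) * \<beta>' z" using MVT2[of x y \<beta> \<beta>'] \<beta> by blast
    then show ?thesis by (intro exI[of _ z]) (auto simp: mult.commute)
  next
    case greater
    then obtain z where "y < z" "z < x" "\<beta> x - \<beta> y = (x - y) * \<beta>' z" using MVT2[of y x \<beta> \<beta>'] \<beta> by blast
    then show ?thesis by (intro exI[of _ z]) (auto simp: algebra_simps)
  qed auto
  then obtain z where z: "\<bar>z - x\<bar> \<le> \<bar>y - x\<bar>" "\<beta> y - \<beta> x = \<beta>' z * (y - x)" by blast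
  have "\<bar>\<beta> y - \<beta> x - \<beta>' x * (y - x)\<bar> = \<bar>\<beta>' z - \<beta>' x\<bar> * \<bar>y - x\<bar>"
    unfolding z(2) left_diff_distrib[symmetric] abs_mult ..
  also have "\<dots> \<le> (K * \<bar>y - x\<bar>) * \<bar>y - x\<bar>"
    using K(1)[of z x] mult_left_mono[OF z(1) K(2)] by (intro mult_right_mono) auto
  finally show ?thesis by (simp add: power2_eq_square mult.assoc abs_mult_self_eq)
qed

text \<open>Write P for the multiplier. The integral of \<beta>(P \<theta>) is a function of
  finitely many coefficients, and each of these is an indefinite integral by the weak formulation.
  Its partial derivatives assemble, through the symmetry of P, into the test function P \<beta>'(P
  \<theta>).\<close>

lemma multiplier_energy:
  fixes \<theta> :: "real \<Rightarrow> real^'n \<Rightarrow> real"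
  assumes L: "0 < L" and sol: "tracer_solution L \<mu> t0 u g \<theta>"
    and u: "\<And>t. t0 \<le> t \<Longrightarrow> L2_field L (u t)" and g: "L2_field L g"
    and w: "even_weights A w" and w1: "\<And>k. k \<in> A \<Longrightarrow> \<bar>w k\<bar> \<le> 1"
    and \<beta>: "\<And>s. (\<beta> has_real_derivative \<beta>' s) (at s)" and K: "\<And>a b. \<bar>\<beta>' a - \<beta>' b\<bar> \<le> K * \<bar>a - b\<bar>" "0 \<le> K"
    and T: "t0 \<le> T"
  obtains R where "integrable (lebesgue_on {t0..T}) R"
    and "AE s in lebesgue_on {t0..T}. R s = tracer_rhs L \<mu> (u s) g (grad L (\<theta> s))
      (fmult L A w (\<lambda>x. \<beta>' (fmult L A w (\<theta> s) x))) (fmult_grad L A w (\<lambda>x. \<beta>' (fmult L A w (\<theta> s) x)))"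
    and "(LINT x|Omega L. \<beta> (fmult L A w (\<theta> T) x)) =
      (LINT x|Omega L. \<beta> (fmult L A w (\<theta> t0) x)) + (LINT s|lebesgue_on {t0..T}. R s)"
proof -
  have A: "finite A" using w by (simp add: even_weights_def)
  define X where "X t = fmult L A w (\<theta> t)" for t
  define c where "c i t = l2_inner L (\<theta> t) (mode L i)" for i t
  define r where "r i s = tracer_rhs L \<mu> (u s) g (grad L (\<theta> s)) (mode L i) (mode_grad L i)" for i s
  \<comment> \<open>The partial derivative of E with respect to the coefficient c i.\<close>
  define Gc where "Gc i t = mode_weight L w i * l2_inner L (\<lambda>x. \<beta>' (X t x)) (mode L i)" for i t
  define E where "E t = (LINT x|Omega L. \<beta> (X t x))" for t
  \<comment> \<open>The Parseval constant: it bounds the square norm of P applied to a difference by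
    the squared increments of the coefficients.\<close>
  define B where "B = 1 / L ^ CARD('n)"
  have B0: "0 \<le> B" using L by (simp add: B_def)
  let ?I = "A <+> A"
  note \<theta>2 = tracer_solution_L2[OF sol]
  have c\<beta>: "continuous_on S \<beta>" for S
    using \<beta> by (meson DERIV_isCont continuous_at_imp_continuous_on)
  have c\<beta>': "continuous_on UNIV \<beta>'"
    using K by (intro lipschitz_on_continuous_on[OF lipschitz_onI[of UNIV \<beta>' K]]) (auto simp: dist_real_def)
  have cX: "continuous_on UNIV (X t)" for t
    unfolding X_def by (rule periodic_C1_continuous[OF periodic_C1_fmult[OF L]])
  have X2: "L2_field L (X t)" for t by (rule L2_field_continuous[OF cX])
  have c\<beta>'X: "continuous_on UNIV (\<lambda>x. \<beta>' (X t x))" for t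
    by (rule continuous_on_compose2[OF c\<beta>' cX]) simp
  have \<beta>'X2: "L2_field L (\<lambda>x. \<beta>' (X t x))" for t by (rule L2_field_continuous[OF c\<beta>'X])
  have i\<beta>: "integrable (Omega L) (\<lambda>x. \<beta> (X t x))" for t
    by (rule integrable_Omega_continuous) (rule continuous_on_compose2[OF c\<beta>[of UNIV] cX], simp)
  have dX2: "L2_field L (\<lambda>x. X t x - X s x)" for s t by (rule L2_field_diff[OF X2 X2])
  have norm_dX: "(l2_norm L (\<lambda>x. X t x - X s x))\<^sup>2 \<le> B * (\<Sum>i\<in>?I. (c i t - c i s)\<^sup>2)" if "t0 \<le> s" "t0 \<le> t" for s t
  proof -
    have d: "L2_field L (\<lambda>x. \<theta> t x - \<theta> s x)" by (rule L2_field_diff[OF \<theta>2 \<theta>2]) (use that in auto)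
    have ci: "l2_inner L (\<lambda>x. \<theta> t x - \<theta> s x) (mode L i) = c i t - c i s" for i
      unfolding c_def using that by (intro l2_inner_diff_left \<theta>2 L2_mode)
    have cc: "l2_inner L (\<lambda>x. \<theta> t x - \<theta> s x) (cosw L k) = c (Inl k) t - c (Inl k) s"
      "l2_inner L (\<lambda>x. \<theta> t x - \<theta> s x) (sinw L k) = c (Inr k) t - c (Inr k) s" for k
      using ci[of "Inl k"] ci[of "Inr k"] by (simp_all add: mode_def)
    have dX: "(\<lambda>x. X t x - X s x) = fmult L A w (\<lambda>x. \<theta> t x - \<theta> s x)"
      unfolding X_def by (rule ext) (rule fmult_diff[OF \<theta>2[OF that(2)] \<theta>2[OF that(1)], symmetric])
    have "(l2_norm L (\<lambda>x. X t x - X s x))\<^sup>2 = (\<Sum>k\<in>A. (w k)\<^sup>2 / L ^ CARD('n) * ((c (Inl k) t - c (Inl k) s)\<^sup>2 + (c (Inr k) t - c (Inr k) s)\<^sup>2))"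
      unfolding dX l2_norm_fmult_sq[OF L w d] cc by (rule refl)
    also have "\<dots> \<le> (\<Sum>k\<in>A. B * ((c (Inl k) t - c (Inl k) s)\<^sup>2 + (c (Inr k) t - c (Inr k) s)\<^sup>2))"
      unfolding B_def using w1 L
      by (intro sum_mono mult_right_mono divide_right_mono) (auto simp: abs_square_le_1)
    also have "\<dots> = B * (\<Sum>i\<in>?I. (c i t - c i s)\<^sup>2)"
      unfolding sum.Plus[OF A A] o_def by (simp only: sum_distrib_left sum.distrib distrib_left)
    finally show ?thesis .
  qed
  have r: "integrable (lebesgue_on {t0..T}) (r i)" for i
    unfolding r_def by (rule tracer_solution_rhs(1)[OF sol periodic_C1_mode[OF L] T])
  have c: "c i t = c i t0 + (LINT s|lebesgue_on {t0..t}. r i s)" if "t0 \<le> t" for i t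
    unfolding r_def c_def by (rule tracer_solution_rhs(2)[OF sol periodic_C1_mode[OF L] that])
  have cont_c: "continuous_on {t0..T} (c i)" for i
    unfolding c_def by (rule tracer_coeff_continuous[OF sol periodic_C1_mode[OF L] T])
  have cont_G: "continuous_on {t0..T} (Gc i)" for i
    unfolding continuous_on_def
  proof
    fix s assume s: "s \<in> {t0..T}"
    let ?F = "at s within {t0..T}"
    let ?h = "\<lambda>t. \<bar>mode_weight L w i\<bar> * (K * sqrt (B * (\<Sum>i\<in>?I. (c i t - c i s)\<^sup>2)) * l2_norm L (mode L i))"
    have "(?h \<longlongrightarrow> \<bar>mode_weight L w i\<bar> * (K * sqrt (B * (\<Sum>i\<in>?I. (c i s - c i s)\<^sup>2)) * l2_norm L (mode L i))) ?F"
      using cont_c s by (intro tendsto_intros) (auto simp: continuous_on_def)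
    then have lim: "(?h \<longlongrightarrow> 0) ?F" by simp
    have "((\<lambda>t. Gc i t - Gc i s) \<longlongrightarrow> 0) ?F"
    proof (rule Lim_null_comparison[OF _ lim])
      have "norm (Gc i t - Gc i s) \<le> ?h t" if t: "t \<in> {t0..T}" for t
      proof -
        have "l2_norm L (\<lambda>x. X t x - X s x) \<le> sqrt (B * (\<Sum>i\<in>?I. (c i t - c i s)\<^sup>2))"
          using norm_dX[of s t] s t by (intro real_le_rsqrt) auto
        from mult_left_mono[OF this K(2)]
        have 1: "K * l2_norm L (\<lambda>x. X t x - X s x) \<le> K * sqrt (B * (\<Sum>i\<in>?I. (c i t - c i s)\<^sup>2))" .
        have "l2_norm L (\<lambda>x. \<beta>' (X t x) - \<beta>' (X s x)) \<le> K * l2_norm L (\<lambda>x. X t x - X s x)"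
          by (rule l2_norm_mono[OF L2_field_diff[OF \<beta>'X2 \<beta>'X2] dX2 _ K(2)]) (simp add: K(1))
        from order_trans[OF this 1]
        have "l2_norm L (\<lambda>x. \<beta>' (X t x) - \<beta>' (X s x)) * l2_norm L (mode L i)
            \<le> K * sqrt (B * (\<Sum>i\<in>?I. (c i t - c i s)\<^sup>2)) * l2_norm L (mode L i)"
          by (rule mult_right_mono[OF _ l2_norm_nonneg])
        with l2_inner_Cauchy_Schwarz[OF L2_field_diff[OF \<beta>'X2 \<beta>'X2] L2_mode, of t s i]
        have "\<bar>l2_inner L (\<lambda>x. \<beta>' (X t x) - \<beta>' (X s x)) (mode L i)\<bar>
            \<le> K * sqrt (B * (\<Sum>i\<in>?I. (c i t - c i s)\<^sup>2)) * l2_norm L (mode L i)" by linarith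
        from mult_left_mono[OF this abs_ge_zero[of "mode_weight L w i"]] show ?thesis
          unfolding Gc_def right_diff_distrib[symmetric] l2_inner_diff_left[OF \<beta>'X2 \<beta>'X2 L2_mode, symmetric] real_norm_def abs_mult .
      qed
      then show "\<forall>\<^sub>F t in ?F. norm (Gc i t - Gc i s) \<le> ?h t" by (auto simp: eventually_at_filter)
    qed
    then show "(Gc i \<longlongrightarrow> Gc i s) ?F" by (rule LIM_zero_cancel)
  qed
  have E: "\<bar>E t - E s - (\<Sum>i\<in>?I. Gc i s * (c i t - c i s))\<bar> \<le> (K * B) * (\<Sum>i\<in>?I. (c i t - c i s)\<^sup>2)"
    if st: "t0 \<le> s" "s \<le> t" "t \<le> T" for s t
  proof -
    have dX: "X t x - X s x = (\<Sum>i\<in>?I. (mode_weight L w i * (c i t - c i s)) * mode L i x)" for x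
      unfolding X_def fmult_modes[OF A] c_def by (simp add: sum_subtractf[symmetric] algebra_simps)
    have "l2_inner L (\<lambda>x. \<beta>' (X s x)) (\<lambda>x. X t x - X s x)
        = (\<Sum>i\<in>?I. l2_inner L (\<lambda>x. \<beta>' (X s x)) (\<lambda>x. (mode_weight L w i * (c i t - c i s)) * mode L i x))"
      unfolding dX by (intro l2_inner_sum_right L2_field_cmult L2_mode \<beta>'X2)
    also have "\<dots> = (\<Sum>i\<in>?I. Gc i s * (c i t - c i s))"
      unfolding l2_inner_cmult_right Gc_def by (simp add: algebra_simps)
    finally have inner: "(\<Sum>i\<in>?I. Gc i s * (c i t - c i s)) = (LINT x|Omega L. \<beta>' (X s x) * (X t x - X s x))"
      by (simp add: l2_inner_def)
    have i2: "integrable (Omega L) (\<lambda>x. \<beta>' (X s x) * (X t x - X s x))"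
      by (rule L2_field_mult_integrable[OF \<beta>'X2 dX2])
    have "E t - E s - (\<Sum>i\<in>?I. Gc i s * (c i t - c i s))
        = (LINT x|Omega L. \<beta> (X t x) - \<beta> (X s x) - \<beta>' (X s x) * (X t x - X s x))"
      unfolding inner E_def using i\<beta> i2 by simp
    also have "\<bar>\<dots>\<bar> \<le> (LINT x|Omega L. \<bar>\<beta> (X t x) - \<beta> (X s x) - \<beta>' (X s x) * (X t x - X s x)\<bar>)"
      by (rule integral_abs_bound)
    also have "\<dots> \<le> (LINT x|Omega L. K * (norm (X t x - X s x))\<^sup>2)"
    proof (rule integral_mono)
      show "integrable (Omega L) (\<lambda>x. \<bar>\<beta> (X t x) - \<beta> (X s x) - \<beta>' (X s x) * (X t x - X s x)\<bar>)"
        using i\<beta> i2 by simp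
      show "integrable (Omega L) (\<lambda>x. K * (norm (X t x - X s x))\<^sup>2)"
        using L2_field_square[OF dX2] by simp
      show "\<bar>\<beta> (X t x) - \<beta> (X s x) - \<beta>' (X s x) * (X t x - X s x)\<bar> \<le> K * (norm (X t x - X s x))\<^sup>2" for x
        using second_order_remainder[OF \<beta> K] by simp
    qed
    also have "\<dots> = K * (l2_norm L (\<lambda>x. X t x - X s x))\<^sup>2"
      by (simp add: l2_norm_def)
    also have "\<dots> \<le> K * (B * (\<Sum>i\<in>?I. (c i t - c i s)\<^sup>2))"
      using norm_dX[of s t] st K(2) by (intro mult_left_mono) auto
    finally show ?thesis by (simp only: mult.assoc)
  qed
  have fI: "finite ?I" using A by simp
  have KB: "0 \<le> K * B" using K(2) B0 by simp
  note chain = integral_chain_rule[OF fI T r c cont_G E KB]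
  show ?thesis
  proof (rule that)
    show "integrable (lebesgue_on {t0..T}) (\<lambda>s. \<Sum>i\<in>?I. Gc i s * r i s)" by (rule chain(1))
    show "(LINT x|Omega L. \<beta> (fmult L A w (\<theta> T) x)) =
      (LINT x|Omega L. \<beta> (fmult L A w (\<theta> t0) x)) + (LINT s|lebesgue_on {t0..T}. (\<Sum>i\<in>?I. Gc i s * r i s))"
      using chain(2) unfolding E_def X_def .
    \<comment> \<open>Recombining the modes into one test function needs a square-integrable
      gradient of \<theta>, available only at almost every time.\<close>
    show "AE s in lebesgue_on {t0..T}. (\<Sum>i\<in>?I. Gc i s * r i s) = tracer_rhs L \<mu> (u s) g (grad L (\<theta> s))
      (fmult L A w (\<lambda>x. \<beta>' (fmult L A w (\<theta> s) x))) (fmult_grad L A w (\<lambda>x. \<beta>' (fmult L A w (\<theta> s) x)))"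
      using tracer_solution_H1[OF sol, of T]
    proof eventually_elim
      case (elim s)
      then have "L2_field L (grad L (\<theta> s))" using weak_gradient_grad by (auto simp: weak_gradient_def)
      with elim show ?case
        by (simp only: tracer_rhs_fmult[OF L A u g] Gc_def r_def X_def)
    qed
  qed
qed

section \<open>Convergence of the truncated quantities as M tends to infinity\<close>

lemma bsin_tendsto: "((\<lambda>M. bsin M s) \<longlongrightarrow> s) at_top"
proof (cases "s = 0")
  case False
  have "((\<lambda>h::real. sin h / h) \<longlongrightarrow> 1) (at 0)"
    using DERIV_sin[of 0] by (simp add: has_field_derivative_iff)
  moreover have "filterlim (\<lambda>M. s / M) (at 0) at_top"
    unfolding filterlim_at
  proof
    show "((\<lambda>M. s / M) \<longlongrightarrow> 0) at_top" by (rule real_tendsto_divide_at_top[OF tendsto_const filterlim_ident])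
    show "\<forall>\<^sub>F M in at_top. s / M \<in> UNIV \<and> s / M \<noteq> 0"
      using eventually_gt_at_top[of 0] by eventually_elim (use False in auto)
  qed
  ultimately have "((\<lambda>M. sin (s / M) / (s / M)) \<longlongrightarrow> 1) at_top" by (rule filterlim_compose)
  then have "((\<lambda>M. s * (sin (s / M) / (s / M))) \<longlongrightarrow> s * 1) at_top" by (intro tendsto_intros)
  moreover have "s * (sin (s / M) / (s / M)) = bsin M s" for M using False by (simp add: bsin_def)
  ultimately show ?thesis by simp
qed (simp add: bsin_def)

lemma bsin_Suc_tendsto:
  assumes "0 < c"
  shows "(\<lambda>n. bsin (c * real (Suc n)) s) \<longlonglongrightarrow> s"
proof (rule filterlim_compose[OF bsin_tendsto])
  have "filterlim (\<lambda>n. real (Suc n)) at_top sequentially"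
    by (rule filterlim_compose[OF filterlim_real_sequentially filterlim_Suc])
  then show "filterlim (\<lambda>n. c * real (Suc n)) at_top sequentially"
    by (rule filterlim_tendsto_pos_mult_at_top[OF tendsto_const assms])
qed

definition bsin_primitive :: "real \<Rightarrow> real \<Rightarrow> real" where
  "bsin_primitive M s = M\<^sup>2 * (1 - cos (s / M))"

lemma DERIV_bsin_primitive: "0 < M \<Longrightarrow> (bsin_primitive M has_real_derivative bsin M s) (at s)"
  unfolding bsin_primitive_def bsin_def by (auto intro!: derivative_eq_intros simp: power2_eq_square)

text \<open>Half-angle formula. It shows that the primitive lies between 0 and s^2 / 2 and tends to
  s^2 / 2, which is what dominated convergence needs.\<close>

lemma bsin_primitive_eq: "0 < M \<Longrightarrow> bsin_primitive M s = (bsin (2 * M) s)\<^sup>2 / 2"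
proof -
  assume "0 < M"
  have "cos (s / M) = 1 - 2 * (sin (s / (2 * M)))\<^sup>2"
    using cos_double_sin[of "s / (2 * M)"] by simp
  then show ?thesis by (simp add: bsin_primitive_def bsin_def power_mult_distrib)
qed

lemma bsin_primitive_lipschitz:
  assumes M: "0 < M"
  shows "\<bar>bsin_primitive M a - bsin_primitive M b\<bar> \<le> M * \<bar>a - b\<bar>"
proof -
  have "\<bar>bsin_primitive M a - bsin_primitive M b\<bar> = M\<^sup>2 * \<bar>cos (b / M) - cos (a / M)\<bar>"
    unfolding bsin_primitive_def right_diff_distrib[symmetric] abs_mult by (simp add: abs_minus_commute)
  also have "\<dots> \<le> M\<^sup>2 * (1 / M * \<bar>b - a\<bar>)"
    by (intro mult_left_mono cos_scaled_lipschitz M) simp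
  also have "\<dots> = M * \<bar>a - b\<bar>" using M by (simp add: power2_eq_square abs_minus_commute)
  finally show ?thesis .
qed

lemma L2_bsin_primitive:
  fixes f :: "real^'n \<Rightarrow> real"
  assumes M: "0 < M" and f: "L2_field L f"
  shows "L2_field L (\<lambda>x. bsin_primitive M (f x))"
proof (rule L2_field_bounded)
  have "continuous_on UNIV (bsin_primitive M)"
    using DERIV_bsin_primitive[OF M] by (meson DERIV_isCont continuous_at_imp_continuous_on)
  then show "(\<lambda>x. bsin_primitive M (f x)) \<in> borel_measurable (Omega L)"
    by (rule borel_measurable_continuous_on[OF _ L2_field_measurable[OF f]])
  show "norm (bsin_primitive M (f x)) \<le> M\<^sup>2 * 2" for x
  proof -
    have "\<bar>1 - cos (f x / M)\<bar> \<le> 2" using cos_ge_minus_one[of "f x / M"] cos_le_one[of "f x / M"] by linarith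
    then show ?thesis by (simp add: bsin_primitive_def abs_mult mult_left_mono)
  qed
qed

lemma integral_bsin_primitive_fejer:
  fixes f :: "real^'n \<Rightarrow> real"
  assumes L: "0 < L" and M: "0 < M" and f: "L2_field L f"
  shows "(\<lambda>N. LINT x|Omega L. bsin_primitive M (fejer L N f x)) \<longlonglongrightarrow> (LINT x|Omega L. bsin_primitive M (f x))"
proof -
  note i = L2_field_integrable[OF L2_bsin_primitive[OF M L2_fejer]] L2_field_integrable[OF L2_bsin_primitive[OF M f]]
  have "(\<lambda>N. (LINT x|Omega L. bsin_primitive M (fejer L N f x)) - (LINT x|Omega L. bsin_primitive M (f x))) \<longlonglongrightarrow> 0"
  proof (rule Lim_null_comparison[OF always_eventually], rule allI)
    show "(\<lambda>N. M * (sqrt (L ^ CARD('n)) * l2_norm L (\<lambda>x. fejer L N f x - f x))) \<longlonglongrightarrow> 0"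
      using tendsto_mult[OF tendsto_const fejer_tendsto[OF L f], of "M * sqrt (L ^ CARD('n))"] by (simp add: mult.assoc)
    fix N
    have d: "L2_field L (\<lambda>x. fejer L N f x - f x)" by (rule L2_field_diff[OF L2_fejer f])
    have "norm ((LINT x|Omega L. bsin_primitive M (fejer L N f x)) - (LINT x|Omega L. bsin_primitive M (f x)))
        = \<bar>LINT x|Omega L. bsin_primitive M (fejer L N f x) - bsin_primitive M (f x)\<bar>"
      by (simp add: Bochner_Integration.integral_diff[OF i])
    also have "\<dots> \<le> (LINT x|Omega L. \<bar>bsin_primitive M (fejer L N f x) - bsin_primitive M (f x)\<bar>)"
      by (rule integral_abs_bound)
    also have "\<dots> \<le> (LINT x|Omega L. M * norm (fejer L N f x - f x))"
    proof (rule integral_mono)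
      show "integrable (Omega L) (\<lambda>x. \<bar>bsin_primitive M (fejer L N f x) - bsin_primitive M (f x)\<bar>)"
        by (intro integrable_abs Bochner_Integration.integrable_diff i)
      show "integrable (Omega L) (\<lambda>x. M * norm (fejer L N f x - f x))"
        using L2_field_integrable[OF d] by simp
      show "\<bar>bsin_primitive M (fejer L N f x) - bsin_primitive M (f x)\<bar> \<le> M * norm (fejer L N f x - f x)" for x
        using bsin_primitive_lipschitz[OF M] by simp
    qed
    also have "\<dots> = M * (LINT x|Omega L. norm (fejer L N f x - f x))" by simp
    also have "\<dots> \<le> M * (sqrt (L ^ CARD('n)) * l2_norm L (\<lambda>x. fejer L N f x - f x))"
      using M by (intro mult_left_mono integral_abs_le_l2_norm L d) simp
    finally show "norm ((LINT x|Omega L. bsin_primitive M (fejer L N f x)) - (LINT x|Omega L. bsin_primitive M (f x)))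
        \<le> M * (sqrt (L ^ CARD('n)) * l2_norm L (\<lambda>x. fejer L N f x - f x))" .
  qed
  then show ?thesis by (rule LIM_zero_cancel)
qed

lemma integral_bsin_primitive_tendsto:
  fixes f :: "real^'n \<Rightarrow> real"
  assumes f: "L2_field L f"
  shows "(\<lambda>n. LINT x|Omega L. bsin_primitive (real (Suc n)) (f x)) \<longlonglongrightarrow> (l2_norm L f)\<^sup>2 / 2"
proof -
  have "(\<lambda>n. LINT x|Omega L. bsin_primitive (real (Suc n)) (f x)) \<longlonglongrightarrow> (LINT x|Omega L. (norm (f x))\<^sup>2 / 2)"
  proof (rule integral_dominated_convergence[where w="\<lambda>x. (norm (f x))\<^sup>2 / 2"])
    show "(\<lambda>x. (norm (f x))\<^sup>2 / 2) \<in> borel_measurable (Omega L)" "integrable (Omega L) (\<lambda>x. (norm (f x))\<^sup>2 / 2)"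
      using L2_field_square[OF f] by simp_all
    show "(\<lambda>x. bsin_primitive (real (Suc n)) (f x)) \<in> borel_measurable (Omega L)" for n
      by (rule L2_field_measurable[OF L2_bsin_primitive[OF _ f]]) simp
    show "AE x in Omega L. (\<lambda>n. bsin_primitive (real (Suc n)) (f x)) \<longlonglongrightarrow> (norm (f x))\<^sup>2 / 2"
    proof (rule AE_I2)
      fix x
      have "(\<lambda>n. (bsin (2 * real (Suc n)) (f x))\<^sup>2 / 2) \<longlonglongrightarrow> (f x)\<^sup>2 / 2"
        by (intro tendsto_divide tendsto_power bsin_Suc_tendsto tendsto_const) simp_all
      then show "(\<lambda>n. bsin_primitive (real (Suc n)) (f x)) \<longlonglongrightarrow> (norm (f x))\<^sup>2 / 2"
        by (simp only: bsin_primitive_eq[OF of_nat_0_less_iff[THEN iffD2, OF zero_less_Suc]] real_norm_def power2_abs)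
    qed
    show "AE x in Omega L. norm (bsin_primitive (real (Suc n)) (f x)) \<le> (norm (f x))\<^sup>2 / 2" for n
    proof (rule AE_I2)
      fix x
      have "(bsin (2 * real (Suc n)) (f x))\<^sup>2 \<le> (f x)\<^sup>2"
        using bsin_abs_le[of "2 * real (Suc n)" "f x"] by (simp add: abs_le_square_iff)
      then show "norm (bsin_primitive (real (Suc n)) (f x)) \<le> (norm (f x))\<^sup>2 / 2"
        by (simp only: bsin_primitive_eq[OF of_nat_0_less_iff[THEN iffD2, OF zero_less_Suc]] real_norm_def power2_abs) simp
    qed
  qed
  then show ?thesis by (simp add: l2_norm_def)
qed

lemma l2_inner_bsin_tendsto:
  fixes f g :: "real^'n \<Rightarrow> real"
  assumes f: "L2_field L f" and g: "L2_field L g"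
  shows "(\<lambda>n. l2_inner L g (\<lambda>x. bsin (real (Suc n)) (f x))) \<longlonglongrightarrow> l2_inner L g f"
  unfolding l2_inner_def inner_real_def
proof (rule integral_dominated_convergence[where w="\<lambda>x. \<bar>g x * f x\<bar>"])
  have b: "L2_field L (\<lambda>x. bsin (real (Suc n)) (f x))" for n by (rule L2_bsin[OF _ f]) simp
  show "(\<lambda>x. g x * f x) \<in> borel_measurable (Omega L)" "(\<lambda>x. g x * bsin (real (Suc n)) (f x)) \<in> borel_measurable (Omega L)" for n
    by (intro borel_measurable_times L2_field_measurable f g b)+
  show "integrable (Omega L) (\<lambda>x. \<bar>g x * f x\<bar>)"
    by (intro integrable_abs L2_field_mult_integrable f g)
  show "AE x in Omega L. (\<lambda>n. g x * bsin (real (Suc n)) (f x)) \<longlonglongrightarrow> g x * f x"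
    using bsin_Suc_tendsto[of 1] by (intro AE_I2 tendsto_mult tendsto_const) simp
  show "AE x in Omega L. norm (g x * bsin (real (Suc n)) (f x)) \<le> \<bar>g x * f x\<bar>" for n
    using bsin_abs_le[of "real (Suc n)"] by (intro AE_I2) (simp add: abs_mult mult_left_mono)
qed

lemma integral_cos_tendsto:
  fixes f :: "real^'n \<Rightarrow> real" and G :: "real^'n \<Rightarrow> real^'n"
  assumes f: "L2_field L f" and G: "L2_field L G"
  shows "(\<lambda>n. LINT x|Omega L. (norm (G x))\<^sup>2 * cos (f x / real (Suc n))) \<longlonglongrightarrow> (l2_norm L G)\<^sup>2"
proof -
  have "(\<lambda>n. LINT x|Omega L. (norm (G x))\<^sup>2 * cos (f x / real (Suc n))) \<longlonglongrightarrow> (LINT x|Omega L. (norm (G x))\<^sup>2)"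
  proof (rule integral_dominated_convergence[where w="\<lambda>x. (norm (G x))\<^sup>2"])
    show i: "integrable (Omega L) (\<lambda>x. (norm (G x))\<^sup>2)" by (rule L2_field_square[OF G])
    then show m: "(\<lambda>x. (norm (G x))\<^sup>2) \<in> borel_measurable (Omega L)" by simp
    show "(\<lambda>x. (norm (G x))\<^sup>2 * cos (f x / real (Suc n))) \<in> borel_measurable (Omega L)" for n
      by (intro borel_measurable_times m L2_field_measurable L2_cos_scaled f)
    show "AE x in Omega L. (\<lambda>n. (norm (G x))\<^sup>2 * cos (f x / real (Suc n))) \<longlonglongrightarrow> (norm (G x))\<^sup>2"
    proof (rule AE_I2)
      fix x
      have "(\<lambda>n. f x / real (Suc n)) \<longlonglongrightarrow> 0"
        by (rule real_tendsto_divide_at_top[OF tendsto_const filterlim_compose[OF filterlim_real_sequentially filterlim_Suc]])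
      then have "(\<lambda>n. (norm (G x))\<^sup>2 * cos (f x / real (Suc n))) \<longlonglongrightarrow> (norm (G x))\<^sup>2 * cos 0"
        by (intro tendsto_mult tendsto_const tendsto_cos)
      then show "(\<lambda>n. (norm (G x))\<^sup>2 * cos (f x / real (Suc n))) \<longlonglongrightarrow> (norm (G x))\<^sup>2" by simp
    qed
    show "AE x in Omega L. norm ((norm (G x))\<^sup>2 * cos (f x / real (Suc n))) \<le> (norm (G x))\<^sup>2" for n
      by (intro AE_I2) (simp add: abs_mult mult_left_le)
  qed
  then show ?thesis by (simp add: l2_norm_def)
qed

text \<open>The weak formulation gives continuity in time only against smooth test functions; for h
  in L2 the pairing is a pointwise limit of pairings with its Fejer means.\<close>

lemma tracer_inner_measurable:
  fixes \<theta> :: "real \<Rightarrow> real^'n \<Rightarrow> real"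
  assumes L: "0 < L" and sol: "tracer_solution L \<mu> t0 u g \<theta>" and h: "L2_field L h" and T: "t0 \<le> T"
  shows "(\<lambda>s. l2_inner L h (\<theta> s)) \<in> borel_measurable (lebesgue_on {t0..T})"
proof (rule borel_measurable_LIMSEQ_real)
  let ?f = "\<lambda>N s. l2_inner L (fejer L N h) (\<theta> s)"
  show "(\<lambda>N. ?f N s) \<longlonglongrightarrow> l2_inner L h (\<theta> s)" if "s \<in> space (lebesgue_on {t0..T})" for s
  proof -
    have \<theta>: "L2_field L (\<theta> s)" using that by (intro tracer_solution_L2[OF sol]) simp
    have "(\<lambda>N. ?f N s - l2_inner L h (\<theta> s)) \<longlonglongrightarrow> 0"
    proof (rule Lim_null_comparison[OF always_eventually], rule allI)
      show "(\<lambda>N. l2_norm L (\<lambda>x. fejer L N h x - h x) * l2_norm L (\<theta> s)) \<longlonglongrightarrow> 0"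
        using tendsto_mult[OF fejer_tendsto[OF L h] tendsto_const] by simp
      show "norm (?f N s - l2_inner L h (\<theta> s)) \<le> l2_norm L (\<lambda>x. fejer L N h x - h x) * l2_norm L (\<theta> s)" for N
        unfolding l2_inner_diff_left[OF L2_fejer h \<theta>, symmetric] real_norm_def
        by (rule l2_inner_Cauchy_Schwarz[OF L2_field_diff[OF L2_fejer h] \<theta>])
    qed
    then show ?thesis by (rule LIM_zero_cancel)
  qed
  show "?f N \<in> borel_measurable (lebesgue_on {t0..T})" for N
  proof (rule continuous_imp_measurable_on_sets_lebesgue)
    have eq: "?f N s = (\<Sum>k\<in>fejer_set N. fejer_weight N k / L ^ CARD('n) *
     (l2_inner L h (cosw L k) * l2_inner L (\<theta> s) (cosw L k) + l2_inner L h (sinw L k) * l2_inner L (\<theta> s) (sinw L k)))"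
      if "s \<in> {t0..T}" for s
      unfolding fejer_def using that by (intro l2_inner_fmult tracer_solution_L2[OF sol]) simp
    have "continuous_on {t0..T} (\<lambda>s. \<Sum>k\<in>fejer_set N. fejer_weight N k / L ^ CARD('n) *
     (l2_inner L h (cosw L k) * l2_inner L (\<theta> s) (cosw L k) + l2_inner L h (sinw L k) * l2_inner L (\<theta> s) (sinw L k)))"
      by (intro continuous_on_sum continuous_on_mult continuous_on_add continuous_on_const
          tracer_coeff_continuous[OF sol periodic_C1_cosw[OF L] T] tracer_coeff_continuous[OF sol periodic_C1_sinw[OF L] T])
    then show "continuous_on {t0..T} (?f N)"
      by (rule continuous_on_eq) (rule eq[symmetric])
  qed simp
qed

section \<open>From the truncated balance to the energy equality\<close>

lemma tracer_grad_integrable: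
  "tracer_solution L \<mu> t0 u g \<theta> \<Longrightarrow> integrable (lebesgue_on {t0..T}) (\<lambda>s. (l2_norm L (grad L (\<theta> s)))\<^sup>2)"
  unfolding tracer_solution_def energy_class_def by blast

text \<open>The limit in N at fixed M, by dominated convergence in time. The recorded bound on f
  involves neither M nor u; it is the majorant for the limit in M.\<close>

lemma tracer_truncated_energy:
  fixes \<theta> :: "real \<Rightarrow> real^'n \<Rightarrow> real"
  assumes L: "0 < L" and sol: "tracer_solution L \<mu> t0 u g \<theta>"
    and u: "\<And>t. t0 \<le> t \<Longrightarrow> L2_field L (u t)" "\<And>t. t0 \<le> t \<Longrightarrow> div_free L (u t)"
    and U: "\<And>t. t \<in> {t0..T} \<Longrightarrow> l2_norm L (u t) \<le> U"
    and g: "L2_field L g" and T: "t0 \<le> T" and M: "0 < M"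
  obtains f where "integrable (lebesgue_on {t0..T}) f"
    and "AE s in lebesgue_on {t0..T}. f s = l2_inner L g (\<lambda>x. bsin M (\<theta> s x))
      - \<mu> * (LINT x|Omega L. (norm (grad L (\<theta> s) x))\<^sup>2 * cos (\<theta> s x / M))"
    and "AE s in lebesgue_on {t0..T}. \<bar>f s\<bar> \<le> l2_norm L g * l2_norm L (\<theta> s) + \<bar>\<mu>\<bar> * (l2_norm L (grad L (\<theta> s)))\<^sup>2"
    and "(LINT x|Omega L. bsin_primitive M (\<theta> T x)) =
      (LINT x|Omega L. bsin_primitive M (\<theta> t0 x)) + (LINT s|lebesgue_on {t0..T}. f s)"
proof -
  let ?G = "\<lambda>s. grad L (\<theta> s)"
  let ?rhs = "\<lambda>N s. l2_inner L g (nonlinear_test L M N (\<theta> s))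
      - \<mu> * l2_inner L (?G s) (fejer_grad L N (\<lambda>x. bsin M (fejer L N (\<theta> s) x)))
      - l2_inner L (\<lambda>x. u s x \<bullet> ?G s x) (nonlinear_test L M N (\<theta> s))"
  obtain C where C: "\<And>s. s \<in> {t0..T} \<Longrightarrow> l2_norm L (\<theta> s) \<le> C"
    using sol unfolding tracer_solution_def energy_class_def by blast
  have U0: "0 \<le> U" using U[of t0] T l2_norm_nonneg[of L "u t0"] by simp
  have "\<exists>R. integrable (lebesgue_on {t0..T}) R \<and> (AE s in lebesgue_on {t0..T}. R s = ?rhs N s) \<and>
     (LINT x|Omega L. bsin_primitive M (fejer L N (\<theta> T) x)) =
      (LINT x|Omega L. bsin_primitive M (fejer L N (\<theta> t0) x)) + (LINT s|lebesgue_on {t0..T}. R s)" for N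
  proof (rule multiplier_energy[OF L sol u(1) g fejer_even_weights fejer_weight_abs_le DERIV_bsin_primitive[OF M] _ _ T])
    show "\<bar>bsin M a - bsin M b\<bar> \<le> 1 * \<bar>a - b\<bar>" for a b using bsin_lipschitz[OF M] by simp
  next
    fix R
    assume "integrable (lebesgue_on {t0..T}) R"
      and "AE s in lebesgue_on {t0..T}. R s = tracer_rhs L \<mu> (u s) g (grad L (\<theta> s))
        (fmult L (fejer_set N) (fejer_weight N) (\<lambda>x. bsin M (fmult L (fejer_set N) (fejer_weight N) (\<theta> s) x)))
        (fmult_grad L (fejer_set N) (fejer_weight N) (\<lambda>x. bsin M (fmult L (fejer_set N) (fejer_weight N) (\<theta> s) x)))"
      and "(LINT x|Omega L. bsin_primitive M (fmult L (fejer_set N) (fejer_weight N) (\<theta> T) x)) =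
        (LINT x|Omega L. bsin_primitive M (fmult L (fejer_set N) (fejer_weight N) (\<theta> t0) x)) + (LINT s|lebesgue_on {t0..T}. R s)"
    then show ?thesis
      unfolding tracer_rhs_def fejer_def[symmetric] fejer_grad_def[symmetric] nonlinear_test_def[symmetric] by blast
  qed simp_all
  from choice[OF allI[OF this]] obtain R where "\<forall>N. integrable (lebesgue_on {t0..T}) (R N) \<and>
     (AE s in lebesgue_on {t0..T}. R N s = ?rhs N s) \<and>
     (LINT x|Omega L. bsin_primitive M (fejer L N (\<theta> T) x)) =
      (LINT x|Omega L. bsin_primitive M (fejer L N (\<theta> t0) x)) + (LINT s|lebesgue_on {t0..T}. R N s)" ..
  then have R: "\<And>N. integrable (lebesgue_on {t0..T}) (R N)" "\<And>N. AE s in lebesgue_on {t0..T}. R N s = ?rhs N s"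
     "\<And>N. (LINT x|Omega L. bsin_primitive M (fejer L N (\<theta> T) x)) =
      (LINT x|Omega L. bsin_primitive M (fejer L N (\<theta> t0) x)) + (LINT s|lebesgue_on {t0..T}. R N s)"
    by blast+
  have allR: "AE s in lebesgue_on {t0..T}. \<forall>N. R N s = ?rhs N s"
    using R(2) by (simp add: AE_all_countable)
  have inS: "AE s in lebesgue_on {t0..T}. s \<in> {t0..T}" by (rule AE_I2) simp
  \<comment> \<open>Defined as a limit of the R N rather than by its formula, so that measurability
    in time is inherited.\<close>
  define f where "f s = lim (\<lambda>N. R N s)" for s
  let ?lim = "\<lambda>s. l2_inner L g (\<lambda>x. bsin M (\<theta> s x)) - \<mu> * (LINT x|Omega L. (norm (?G s x))\<^sup>2 * cos (\<theta> s x / M))"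
  have lim: "AE s in lebesgue_on {t0..T}. (\<lambda>N. R N s) \<longlonglongrightarrow> ?lim s"
    using allR tracer_solution_H1[OF sol, of T]
  proof eventually_elim
    case (elim s)
    then have G: "weak_gradient L (\<theta> s) (?G s)" and s: "t0 \<le> s" and \<theta>: "L2_field L (\<theta> s)"
      using weak_gradient_grad tracer_solution_L2[OF sol] by auto
    have "(\<lambda>N. ?rhs N s) \<longlonglongrightarrow> ?lim s - 0"
      by (intro tendsto_diff tendsto_mult tendsto_const nonlinear_test_source(1)[OF L M \<theta> g]
          nonlinear_test_dissipation[OF L M \<theta> G] nonlinear_test_transport[OF L M \<theta> G u(1)[OF s] u(2)[OF s]])
    with elim(1) show ?case by simp
  qed
  have flim: "AE s in lebesgue_on {t0..T}. f s = ?lim s"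
    using lim by eventually_elim (simp add: f_def limI)
  have fR: "AE s in lebesgue_on {t0..T}. (\<lambda>N. R N s) \<longlonglongrightarrow> f s"
    using lim flim by eventually_elim simp
  have fm: "f \<in> borel_measurable (lebesgue_on {t0..T})"
    unfolding f_def by (rule borel_measurable_lim_metric[OF borel_measurable_integrable[OF R(1)]])
  \<comment> \<open>The last summand majorises the transport term; the norm of the gradient is
    replaced by 1 plus its square, which is integrable in time.\<close>
  let ?w = "\<lambda>s. l2_norm L g * C + \<bar>\<mu>\<bar> * (l2_norm L (?G s))\<^sup>2 + M * (U * (1 + (l2_norm L (?G s))\<^sup>2))"
  have wi: "integrable (lebesgue_on {t0..T}) ?w"
    using tracer_grad_integrable[OF sol, of T]
      finite_measure.integrable_const[OF finite_measure_lebesgue_on[OF lmeasurable_interval(1)[of t0 T, unfolded cbox_interval]]]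
    by (intro Bochner_Integration.integrable_add integrable_mult_right) auto
  have bd: "AE s in lebesgue_on {t0..T}. norm (R N s) \<le> ?w s" for N
    using allR tracer_solution_H1[OF sol, of T] inS
  proof eventually_elim
    case (elim s)
    then have G: "weak_gradient L (\<theta> s) (?G s)" and s: "t0 \<le> s" and \<theta>: "L2_field L (\<theta> s)"
      using weak_gradient_grad tracer_solution_L2[OF sol] by auto
    have 1: "\<bar>l2_inner L g (nonlinear_test L M N (\<theta> s))\<bar> \<le> l2_norm L g * C"
      using nonlinear_test_source(2)[OF L M \<theta> g, of N] mult_left_mono[OF C[OF elim(3)] l2_norm_nonneg[of L g]] by linarith
    have 2: "\<bar>\<mu> * l2_inner L (?G s) (fejer_grad L N (\<lambda>x. bsin M (fejer L N (\<theta> s) x)))\<bar> \<le> \<bar>\<mu>\<bar> * (l2_norm L (?G s))\<^sup>2"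
      unfolding abs_mult by (rule mult_left_mono[OF nonlinear_test_dissipation_le[OF L M \<theta> G]]) simp
    have "\<bar>l2_inner L (\<lambda>x. u s x \<bullet> ?G s x) (nonlinear_test L M N (\<theta> s))\<bar> \<le> M * (l2_norm L (u s) * l2_norm L (?G s))"
      by (rule nonlinear_test_transport_le[OF L M \<theta> G u(1)[OF s] u(2)[OF s]])
    also have "\<dots> \<le> M * (U * (1 + (l2_norm L (?G s))\<^sup>2))"
    proof (intro mult_left_mono mult_mono U elim(3) U0)
      have "l2_norm L (?G s) * 2 \<le> 1 + (l2_norm L (?G s))\<^sup>2"
        using sum_squares_bound[of 1 "l2_norm L (?G s)"] by simp
      then show "l2_norm L (?G s) \<le> 1 + (l2_norm L (?G s))\<^sup>2" using l2_norm_nonneg[of L "?G s"] by linarith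
    qed (use M l2_norm_nonneg in auto)
    finally have 3: "\<bar>l2_inner L (\<lambda>x. u s x \<bullet> ?G s x) (nonlinear_test L M N (\<theta> s))\<bar> \<le> M * (U * (1 + (l2_norm L (?G s))\<^sup>2))" .
    from elim(1) have "R N s = ?rhs N s" by blast
    with 1 2 3 show ?case unfolding real_norm_def by linarith
  qed
  note dct = integral_dominated_convergence[OF fm borel_measurable_integrable[OF R(1)] wi fR bd]
    integrable_dominated_convergence[OF fm borel_measurable_integrable[OF R(1)] wi fR bd]
  show ?thesis
  proof (rule that)
    show "integrable (lebesgue_on {t0..T}) f" by (rule dct(2))
    show "AE s in lebesgue_on {t0..T}. f s = ?lim s" by (rule flim)
    show "AE s in lebesgue_on {t0..T}. \<bar>f s\<bar> \<le> l2_norm L g * l2_norm L (\<theta> s) + \<bar>\<mu>\<bar> * (l2_norm L (?G s))\<^sup>2"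
      using flim tracer_solution_H1[OF sol, of T]
    proof eventually_elim
      case (elim s)
      then have G: "L2_field L (?G s)" and \<theta>: "L2_field L (\<theta> s)"
        using weak_gradient_grad tracer_solution_L2[OF sol] by (auto simp: weak_gradient_def)
      have "\<bar>l2_inner L g (\<lambda>x. bsin M (\<theta> s x))\<bar> \<le> l2_norm L g * l2_norm L (\<lambda>x. bsin M (\<theta> s x))"
        by (rule l2_inner_Cauchy_Schwarz[OF g L2_bsin[OF M \<theta>]])
      also have "\<dots> \<le> l2_norm L g * l2_norm L (\<theta> s)"
        by (intro mult_left_mono l2_norm_bsin_le[OF L M \<theta> \<theta>] l2_norm_nonneg)
      finally have 1: "\<bar>l2_inner L g (\<lambda>x. bsin M (\<theta> s x))\<bar> \<le> l2_norm L g * l2_norm L (\<theta> s)" .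
      have "\<bar>LINT x|Omega L. (?G s x \<bullet> ?G s x) * cos (\<theta> s x / M)\<bar> \<le> 1 * (l2_norm L (?G s) * l2_norm L (?G s))"
        by (rule integrable_inner_mult_bounded(2)[OF G G measurable_cos_scaled[OF L2_field_measurable[OF \<theta>]]]) auto
      then have "\<bar>LINT x|Omega L. (norm (?G s x))\<^sup>2 * cos (\<theta> s x / M)\<bar> \<le> (l2_norm L (?G s))\<^sup>2"
        unfolding power2_norm_eq_inner power2_eq_square[of "l2_norm L (?G s)"] by simp
      from mult_left_mono[OF this abs_ge_zero[of \<mu>]]
      have 2: "\<bar>\<mu> * (LINT x|Omega L. (norm (?G s x))\<^sup>2 * cos (\<theta> s x / M))\<bar> \<le> \<bar>\<mu>\<bar> * (l2_norm L (?G s))\<^sup>2"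
        unfolding abs_mult .
      from 1 2 elim(1) show ?case by linarith
    qed
    have "(\<lambda>N. (LINT x|Omega L. bsin_primitive M (fejer L N (\<theta> t0) x)) + (LINT s|lebesgue_on {t0..T}. R N s))
        \<longlonglongrightarrow> (LINT x|Omega L. bsin_primitive M (\<theta> t0 x)) + (LINT s|lebesgue_on {t0..T}. f s)"
      by (intro tendsto_add integral_bsin_primitive_fejer L M dct(1) tracer_solution_L2[OF sol]) simp
    moreover have "(\<lambda>N. LINT x|Omega L. bsin_primitive M (fejer L N (\<theta> T) x)) \<longlonglongrightarrow> (LINT x|Omega L. bsin_primitive M (\<theta> T x))"
      by (intro integral_bsin_primitive_fejer L M tracer_solution_L2[OF sol] T)
    ultimately show "(LINT x|Omega L. bsin_primitive M (\<theta> T x)) =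
      (LINT x|Omega L. bsin_primitive M (\<theta> t0 x)) + (LINT s|lebesgue_on {t0..T}. f s)"
      unfolding R(3) using LIMSEQ_unique by blast
  qed
qed

text \<open>The truncated balances contain no transport term any more, and their integrands have a
  common majorant, so the level can be sent to infinity in every term.\<close>

theorem tracer_energy_equality:
  fixes \<theta> :: "real \<Rightarrow> real^'n \<Rightarrow> real"
  assumes L: "0 < L" and sol: "tracer_solution L \<mu> t0 u g \<theta>"
    and u: "\<And>t. t0 \<le> t \<Longrightarrow> L2_field L (u t)" "\<And>t. t0 \<le> t \<Longrightarrow> div_free L (u t)"
    and U: "\<And>t. t \<in> {t0..T} \<Longrightarrow> l2_norm L (u t) \<le> U"
    and g: "L2_field L g" and T: "t0 \<le> T"
  shows "integrable (lebesgue_on {t0..T}) (\<lambda>s. l2_inner L g (\<theta> s) - \<mu> * (l2_norm L (grad L (\<theta> s)))\<^sup>2)"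
    and "(l2_norm L (\<theta> T))\<^sup>2 / 2 = (l2_norm L (\<theta> t0))\<^sup>2 / 2 +
      (LINT s|lebesgue_on {t0..T}. l2_inner L g (\<theta> s) - \<mu> * (l2_norm L (grad L (\<theta> s)))\<^sup>2)"
proof -
  let ?G = "\<lambda>s. grad L (\<theta> s)"
  let ?e = "\<lambda>s. l2_inner L g (\<theta> s) - \<mu> * (l2_norm L (?G s))\<^sup>2"
  obtain C where C: "\<And>s. s \<in> {t0..T} \<Longrightarrow> l2_norm L (\<theta> s) \<le> C"
    using sol unfolding tracer_solution_def energy_class_def by blast
  have "\<exists>f. integrable (lebesgue_on {t0..T}) f \<and>
    (AE s in lebesgue_on {t0..T}. f s = l2_inner L g (\<lambda>x. bsin (real (Suc n)) (\<theta> s x))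
      - \<mu> * (LINT x|Omega L. (norm (?G s x))\<^sup>2 * cos (\<theta> s x / real (Suc n)))) \<and>
    (AE s in lebesgue_on {t0..T}. \<bar>f s\<bar> \<le> l2_norm L g * l2_norm L (\<theta> s) + \<bar>\<mu>\<bar> * (l2_norm L (?G s))\<^sup>2) \<and>
    (LINT x|Omega L. bsin_primitive (real (Suc n)) (\<theta> T x)) =
      (LINT x|Omega L. bsin_primitive (real (Suc n)) (\<theta> t0 x)) + (LINT s|lebesgue_on {t0..T}. f s)" for n
  proof (rule tracer_truncated_energy[OF L sol u U g T, of "real (Suc n)"])
    show "0 < real (Suc n)" by simp
  qed (assumption | intro exI conjI)+
  from choice[OF allI[OF this]] obtain f where "\<forall>n. integrable (lebesgue_on {t0..T}) (f n) \<and>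
    (AE s in lebesgue_on {t0..T}. f n s = l2_inner L g (\<lambda>x. bsin (real (Suc n)) (\<theta> s x))
      - \<mu> * (LINT x|Omega L. (norm (?G s x))\<^sup>2 * cos (\<theta> s x / real (Suc n)))) \<and>
    (AE s in lebesgue_on {t0..T}. \<bar>f n s\<bar> \<le> l2_norm L g * l2_norm L (\<theta> s) + \<bar>\<mu>\<bar> * (l2_norm L (?G s))\<^sup>2) \<and>
    (LINT x|Omega L. bsin_primitive (real (Suc n)) (\<theta> T x)) =
      (LINT x|Omega L. bsin_primitive (real (Suc n)) (\<theta> t0 x)) + (LINT s|lebesgue_on {t0..T}. f n s)" ..
  then have f: "\<And>n. integrable (lebesgue_on {t0..T}) (f n)"
    "\<And>n. AE s in lebesgue_on {t0..T}. f n s = l2_inner L g (\<lambda>x. bsin (real (Suc n)) (\<theta> s x))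
      - \<mu> * (LINT x|Omega L. (norm (?G s x))\<^sup>2 * cos (\<theta> s x / real (Suc n)))"
    "\<And>n. AE s in lebesgue_on {t0..T}. \<bar>f n s\<bar> \<le> l2_norm L g * l2_norm L (\<theta> s) + \<bar>\<mu>\<bar> * (l2_norm L (?G s))\<^sup>2"
    "\<And>n. (LINT x|Omega L. bsin_primitive (real (Suc n)) (\<theta> T x)) =
      (LINT x|Omega L. bsin_primitive (real (Suc n)) (\<theta> t0 x)) + (LINT s|lebesgue_on {t0..T}. f n s)"
    by blast+
  have allf: "AE s in lebesgue_on {t0..T}. \<forall>n. f n s = l2_inner L g (\<lambda>x. bsin (real (Suc n)) (\<theta> s x))
      - \<mu> * (LINT x|Omega L. (norm (?G s x))\<^sup>2 * cos (\<theta> s x / real (Suc n)))"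
    unfolding AE_all_countable using f(2) by blast
  have lim: "AE s in lebesgue_on {t0..T}. (\<lambda>n. f n s) \<longlonglongrightarrow> ?e s"
    using allf tracer_solution_H1[OF sol, of T]
  proof eventually_elim
    case (elim s)
    then have G: "L2_field L (?G s)" and \<theta>: "L2_field L (\<theta> s)"
      using weak_gradient_grad tracer_solution_L2[OF sol] by (auto simp: weak_gradient_def)
    have "(\<lambda>n. l2_inner L g (\<lambda>x. bsin (real (Suc n)) (\<theta> s x))
      - \<mu> * (LINT x|Omega L. (norm (?G s x))\<^sup>2 * cos (\<theta> s x / real (Suc n)))) \<longlonglongrightarrow> ?e s"
      by (intro tendsto_diff tendsto_mult tendsto_const l2_inner_bsin_tendsto integral_cos_tendsto \<theta> g G)
    with elim(1) show ?case by (simp only:)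
  qed
  have grad_i: "integrable (lebesgue_on {t0..T}) (\<lambda>s. (l2_norm L (?G s))\<^sup>2)" by (rule tracer_grad_integrable[OF sol])
  have em: "?e \<in> borel_measurable (lebesgue_on {t0..T})"
    by (intro borel_measurable_diff borel_measurable_times borel_measurable_const tracer_inner_measurable[OF L sol g T]
        borel_measurable_integrable[OF grad_i])
  let ?w = "\<lambda>s. l2_norm L g * C + \<bar>\<mu>\<bar> * (l2_norm L (?G s))\<^sup>2"
  have wi: "integrable (lebesgue_on {t0..T}) ?w"
    using grad_i finite_measure.integrable_const[OF finite_measure_lebesgue_on[OF lmeasurable_interval(1)[of t0 T, unfolded cbox_interval]]]
    by (intro Bochner_Integration.integrable_add integrable_mult_right) auto
  have inS: "AE s in lebesgue_on {t0..T}. s \<in> {t0..T}" by (rule AE_I2) simp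
  have bd: "AE s in lebesgue_on {t0..T}. norm (f n s) \<le> ?w s" for n
    using f(3)[of n] inS
  proof eventually_elim
    case (elim s)
    then show ?case using mult_left_mono[OF C[OF elim(2)] l2_norm_nonneg[of L g]] by simp
  qed
  note dct = integral_dominated_convergence[OF em borel_measurable_integrable[OF f(1)] wi lim bd]
    integrable_dominated_convergence[OF em borel_measurable_integrable[OF f(1)] wi lim bd]
  show "integrable (lebesgue_on {t0..T}) ?e" by (rule dct(2))
  have "(\<lambda>n. (LINT x|Omega L. bsin_primitive (real (Suc n)) (\<theta> t0 x)) + (LINT s|lebesgue_on {t0..T}. f n s))
      \<longlonglongrightarrow> (l2_norm L (\<theta> t0))\<^sup>2 / 2 + (LINT s|lebesgue_on {t0..T}. ?e s)"
    by (intro tendsto_add integral_bsin_primitive_tendsto dct(1) tracer_solution_L2[OF sol]) simp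
  moreover have "(\<lambda>n. LINT x|Omega L. bsin_primitive (real (Suc n)) (\<theta> T x)) \<longlonglongrightarrow> (l2_norm L (\<theta> T))\<^sup>2 / 2"
    by (intro integral_bsin_primitive_tendsto tracer_solution_L2[OF sol] T)
  ultimately show "(l2_norm L (\<theta> T))\<^sup>2 / 2 = (l2_norm L (\<theta> t0))\<^sup>2 / 2 + (LINT s|lebesgue_on {t0..T}. ?e s)"
    unfolding f(4) using LIMSEQ_unique by blast
qed

section \<open>Long-time bounds\<close>

text \<open>Completeness of Lebesgue measure supplies the measurability of h. It is applied to the
  flux, which is reached only through an identity valid at almost every time.\<close>

lemma integrable_lebesgue_on_AE_cong:
  fixes f h :: "real \<Rightarrow> real"
  assumes f: "integrable (lebesgue_on {a..b}) f" and ae: "AE s in lebesgue_on {a..b}. h s = f s"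
  shows "integrable (lebesgue_on {a..b}) h"
    and "(LINT s|lebesgue_on {a..b}. h s) = (LINT s|lebesgue_on {a..b}. f s)"
proof -
  have "AE s in lebesgue. s \<in> {a..b} \<longrightarrow> h s = f s" using ae by (simp add: AE_restrict_space_iff)
  then obtain N where N: "N \<in> null_sets lebesgue" "{s. \<not> (s \<in> {a..b} \<longrightarrow> h s = f s)} \<subseteq> N"
    by (auto simp: eventually_ae_filter)
  have "f absolutely_integrable_on {a..b}" using f by (simp add: set_integrable_eq)
  then have "h absolutely_integrable_on {a..b}"
    by (rule absolutely_integrable_spike[where S=N]) (use N in \<open>auto simp: negligible_iff_null_sets\<close>)
  then show h: "integrable (lebesgue_on {a..b}) h" by (intro absolutely_integrable_imp_integrable) auto
  show "(LINT s|lebesgue_on {a..b}. h s) = (LINT s|lebesgue_on {a..b}. f s)"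
    by (intro integral_cong_AE borel_measurable_integrable f h ae)
qed

lemma AE_subinterval:
  fixes a b c d :: real
  assumes "AE s in lebesgue_on {a..b}. P s" "{c..d} \<subseteq> {a..b}"
  shows "AE s in lebesgue_on {c..d}. P s"
  using assms by (auto simp: AE_restrict_space_iff elim!: eventually_mono)

text \<open>Suppose y exceeds the bound at t and let s be the last time before it at which it does
  not. On (s, t] the right-hand side of the differential inequality is at most zero, so y cannot
  have grown there.\<close>

lemma dissipative_bound:
  fixes y e :: "real \<Rightarrow> real"
  assumes cont: "\<And>T. 0 \<le> T \<Longrightarrow> continuous_on {0..T} y"
    and incr: "\<And>s t. 0 \<le> s \<Longrightarrow> s \<le> t \<Longrightarrow> y t - y s = (LINT r|lebesgue_on {s..t}. e r)"
    and diss: "\<And>T. 0 \<le> T \<Longrightarrow> AE r in lebesgue_on {0..T}. e r \<le> C - a * y r"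
    and a: "0 < a" and t: "0 \<le> t"
  shows "y t \<le> max (y 0) (C / a)"
proof (rule ccontr)
  define K where "K = max (y 0) (C / a)"
  assume "\<not> y t \<le> max (y 0) (C / a)"
  then have yt: "K < y t" unfolding K_def by (rule not_le_imp_less)
  let ?S = "{r \<in> {0..t}. y r \<le> K}"
  have "closed ?S" by (rule continuous_on_closed_Collect_le[OF cont[OF t] continuous_on_const]) simp
  moreover have "bounded ?S" by (rule bounded_subset[of "{0..t}"]) auto
  ultimately have "compact ?S" by (simp add: compact_eq_bounded_closed)
  moreover have "0 \<in> ?S" using t by (simp add: K_def)
  ultimately obtain s where s: "s \<in> ?S" "\<And>r. r \<in> ?S \<Longrightarrow> r \<le> s"
    using compact_attains_sup[of ?S] by blast
  have gt: "K < y r" if "s < r" "r \<le> t" for r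
    using s(1) s(2)[of r] that by force
  \<comment> \<open>At s itself y does not exceed the bound; the single point is discarded as a null
    set.\<close>
  have "AE r in lebesgue. r \<noteq> s" by (intro AE_completion AE_lborel_singleton)
  then have "AE r in lebesgue_on {s..t}. r \<noteq> s" by (simp add: AE_restrict_space_iff) (auto elim!: eventually_mono)
  moreover have "AE r in lebesgue_on {s..t}. e r \<le> C - a * y r"
    by (rule AE_subinterval[OF diss[OF t]]) (use s(1) in auto)
  moreover have "AE r in lebesgue_on {s..t}. r \<in> {s..t}" by (rule AE_I2) simp
  ultimately have "AE r in lebesgue_on {s..t}. 0 \<le> - e r"
  proof eventually_elim
    case (elim r)
    then have "K < y r" by (intro gt) auto
    then have "C / a \<le> y r" by (simp add: K_def)
    then have "C \<le> a * y r" using a by (simp add: pos_divide_le_eq mult.commute)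
    then show ?case using elim(2) by linarith
  qed
  then have "0 \<le> (LINT r|lebesgue_on {s..t}. - e r)" by (rule integral_nonneg_AE)
  moreover have "y t - y s = (LINT r|lebesgue_on {s..t}. e r)" by (rule incr) (use s(1) in auto)
  ultimately have "y t \<le> y s" by simp
  with yt s(1) show False by simp
qed

text \<open>For Fejer means the inequality holds coefficient by coefficient, the zero mode being
  absent; then N tends to infinity on the left while the right side is bounded by G.\<close>

lemma Poincare_mean_zero:
  fixes \<theta> :: "real^'n \<Rightarrow> real"
  assumes L: "0 < L" and G: "weak_gradient L \<theta> G" and mz: "mean_zero L \<theta>"
  shows "(2 * pi / L)\<^sup>2 * (l2_norm L \<theta>)\<^sup>2 \<le> (l2_norm L G)\<^sup>2"
proof -
  have \<theta>: "L2_field L \<theta>" using G by (simp add: weak_gradient_def)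
  have le: "(2 * pi / L)\<^sup>2 * (l2_norm L (fejer L N \<theta>))\<^sup>2 \<le> (l2_norm L G)\<^sup>2" for N
  proof -
    have "(2 * pi / L)\<^sup>2 * ((fejer_weight N k)\<^sup>2 / L ^ CARD('n) * ((l2_inner L \<theta> (cosw L k))\<^sup>2 + (l2_inner L \<theta> (sinw L k))\<^sup>2))
        \<le> (fejer_weight N k)\<^sup>2 * (norm (wave L k))\<^sup>2 / L ^ CARD('n) * ((l2_inner L \<theta> (cosw L k))\<^sup>2 + (l2_inner L \<theta> (sinw L k))\<^sup>2)" for k :: "int^'n"
    proof (cases "k = 0")
      case True
      then show ?thesis by (simp add: mean_zero_coeff[OF mz])
    next
      case False
      define q where "q = (fejer_weight N k)\<^sup>2 / L ^ CARD('n) * ((l2_inner L \<theta> (cosw L k))\<^sup>2 + (l2_inner L \<theta> (sinw L k))\<^sup>2)"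
      have "0 \<le> q" using L by (simp add: q_def)
      then have "(2 * pi / L)\<^sup>2 * q \<le> (norm (wave L k))\<^sup>2 * q"
        using norm_wave_ge[OF L False] L by (intro mult_right_mono power_mono) auto
      then show ?thesis by (simp add: q_def mult_ac)
    qed
    then have "(2 * pi / L)\<^sup>2 * (l2_norm L (fejer L N \<theta>))\<^sup>2 \<le> (l2_norm L (fejer_grad L N \<theta>))\<^sup>2"
      unfolding fejer_def fejer_grad_def l2_norm_fmult_sq[OF L fejer_even_weights \<theta>]
        l2_norm_fmult_grad_sq[OF L fejer_even_weights G] sum_distrib_left
      by (intro sum_mono)
    also have "\<dots> \<le> (l2_norm L G)\<^sup>2"
      by (intro power_mono l2_norm_fejer_grad_le[OF L G] l2_norm_nonneg)
    finally show ?thesis .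
  qed
  have "(\<lambda>N. l2_norm L (fejer L N \<theta>) - l2_norm L \<theta>) \<longlonglongrightarrow> 0"
  proof (rule Lim_null_comparison[OF always_eventually fejer_tendsto[OF L \<theta>]], rule allI)
    fix N
    have d: "L2_field L (\<lambda>x. fejer L N \<theta> x - \<theta> x)" "L2_field L (\<lambda>x. \<theta> x - fejer L N \<theta> x)"
      by (intro L2_field_diff L2_fejer \<theta>)+
    have "l2_norm L (fejer L N \<theta>) \<le> l2_norm L (\<lambda>x. fejer L N \<theta> x - \<theta> x) + l2_norm L \<theta>"
      using l2_norm_triangle[OF d(1) \<theta>] by simp
    moreover have "l2_norm L \<theta> \<le> l2_norm L (\<lambda>x. \<theta> x - fejer L N \<theta> x) + l2_norm L (fejer L N \<theta>)"
      using l2_norm_triangle[OF d(2) L2_fejer[of L N \<theta>]] by simp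
    ultimately show "norm (l2_norm L (fejer L N \<theta>) - l2_norm L \<theta>) \<le> l2_norm L (\<lambda>x. fejer L N \<theta> x - \<theta> x)"
      unfolding l2_norm_minus_commute[of L \<theta> "fejer L N \<theta>"] real_norm_def by linarith
  qed
  then have "(\<lambda>N. l2_norm L (fejer L N \<theta>)) \<longlonglongrightarrow> l2_norm L \<theta>" by (rule LIM_zero_cancel)
  then have "(\<lambda>N. (2 * pi / L)\<^sup>2 * (l2_norm L (fejer L N \<theta>))\<^sup>2) \<longlonglongrightarrow> (2 * pi / L)\<^sup>2 * (l2_norm L \<theta>)\<^sup>2"
    by (intro tendsto_intros)
  then show ?thesis by (rule LIMSEQ_le_const2) (use le in auto)
qed

text \<open>By Parseval this is |grad \<theta>^<|^2. Written in coefficients it is visibly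
  continuous in time along a solution.\<close>

definition low_enstrophy :: "real \<Rightarrow> real \<Rightarrow> (real^'n \<Rightarrow> real) \<Rightarrow> real" where
  "low_enstrophy L \<kappa> \<theta> = (\<Sum>k\<in>low_modes L \<kappa>. (norm (wave L k))\<^sup>2 / L ^ CARD('n) *
     ((l2_inner L \<theta> (cosw L k))\<^sup>2 + (l2_inner L \<theta> (sinw L k))\<^sup>2))"

lemma low_enstrophy_nonneg: "0 < L \<Longrightarrow> 0 \<le> low_enstrophy L \<kappa> \<theta>"
  unfolding low_enstrophy_def by (intro sum_nonneg) auto

lemma low_enstrophy_le:
  fixes \<theta> :: "real^'n \<Rightarrow> real"
  assumes L: "0 < L" and \<theta>: "L2_field L \<theta>"
  shows "low_enstrophy L \<kappa> \<theta> \<le> \<kappa>\<^sup>2 * (l2_norm L \<theta>)\<^sup>2"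
proof -
  have "low_enstrophy L \<kappa> \<theta> \<le> (\<Sum>k\<in>low_modes L \<kappa>. \<kappa>\<^sup>2 * (1\<^sup>2 / L ^ CARD('n) *
     ((l2_inner L \<theta> (cosw L k))\<^sup>2 + (l2_inner L \<theta> (sinw L k))\<^sup>2)))"
    unfolding low_enstrophy_def
  proof (rule sum_mono)
    fix k :: "int^'n" assume k: "k \<in> low_modes L \<kappa>"
    let ?c = "((l2_inner L \<theta> (cosw L k))\<^sup>2 + (l2_inner L \<theta> (sinw L k))\<^sup>2) / L ^ CARD('n)"
    have "(norm (wave L k))\<^sup>2 * ?c \<le> \<kappa>\<^sup>2 * ?c"
      using k L by (intro mult_right_mono power_mono) (auto simp: low_modes_def)
    then show "(norm (wave L k))\<^sup>2 / L ^ CARD('n) * ((l2_inner L \<theta> (cosw L k))\<^sup>2 + (l2_inner L \<theta> (sinw L k))\<^sup>2)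
        \<le> \<kappa>\<^sup>2 * (1\<^sup>2 / L ^ CARD('n) * ((l2_inner L \<theta> (cosw L k))\<^sup>2 + (l2_inner L \<theta> (sinw L k))\<^sup>2))" by simp
  qed
  also have "\<dots> = \<kappa>\<^sup>2 * (l2_norm L (low_pass L \<kappa> \<theta>))\<^sup>2"
    unfolding low_pass_def l2_norm_fmult_sq[OF L low_modes_even_weights[OF L] \<theta>] sum_distrib_left ..
  also have "\<dots> \<le> \<kappa>\<^sup>2 * (l2_norm L \<theta>)\<^sup>2"
    by (intro mult_left_mono power_mono l2_norm_low_pass_le L \<theta> l2_norm_nonneg) simp
  finally show ?thesis .
qed

text \<open>The quadratic case of the multiplier balance tests with the truncation applied twice;
  idempotence leaves one copy, and Parseval gives the sum.\<close>

lemma low_pass_dissipation: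
  fixes \<theta> :: "real^'n \<Rightarrow> real"
  assumes L: "0 < L" and G: "weak_gradient L \<theta> G"
  shows "l2_inner L G (low_pass_grad L \<kappa> (low_pass L \<kappa> \<theta>)) = low_enstrophy L \<kappa> \<theta>"
proof -
  let ?A = "low_modes L \<kappa> :: (int^'n) set"
  have G2: "L2_field L G" and Gi: "L2_field L (\<lambda>x. G x $ i)" for i
    using G by (auto simp: weak_gradient_def intro: L2_field_component)
  note ew = low_modes_even_weights[OF L]
  have eq: "low_pass_grad L \<kappa> (low_pass L \<kappa> \<theta>) = low_pass_grad L \<kappa> \<theta>"
    unfolding low_pass_grad_def low_pass_def
    by (auto simp: fun_eq_iff fmult_grad_def[of L ?A] fmult_coeff[OF L ew] intro!: sum.cong)
  have "l2_inner L G (low_pass_grad L \<kappa> \<theta>) = (\<Sum>i\<in>UNIV. l2_inner L (\<lambda>x. G x $ i) (fmult L ?A (\<lambda>_. 1) (\<lambda>x. G x $ i)))"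
    unfolding l2_inner_vec[OF G2 L2_low_pass_grad] unfolding low_pass_grad_def fmult_weak_gradient[OF L G] ..
  also have "\<dots> = (\<Sum>i\<in>UNIV. \<Sum>k\<in>?A. (wave L k $ i)\<^sup>2 * (1 / L ^ CARD('n) *
      ((l2_inner L \<theta> (cosw L k))\<^sup>2 + (l2_inner L \<theta> (sinw L k))\<^sup>2)))"
    by (intro sum.cong refl, subst l2_inner_commute)
       (simp add: l2_inner_fmult[OF Gi] weak_gradient_coeff[OF L G] power2_eq_square algebra_simps)
  also have "\<dots> = (\<Sum>k\<in>?A. (\<Sum>i\<in>UNIV. (wave L k $ i)\<^sup>2) * (1 / L ^ CARD('n) *
      ((l2_inner L \<theta> (cosw L k))\<^sup>2 + (l2_inner L \<theta> (sinw L k))\<^sup>2)))"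
    by (subst sum.swap) (simp only: sum_distrib_right)
  also have "\<dots> = low_enstrophy L \<kappa> \<theta>"
    unfolding low_enstrophy_def
    by (intro sum.cong refl) (simp add: norm_eq_sqrt_inner inner_vec_def power2_eq_square sum_nonneg)
  finally show ?thesis by (simp only: eq)
qed

lemma low_enstrophy_continuous:
  fixes \<theta> :: "real \<Rightarrow> real^'n \<Rightarrow> real"
  assumes L: "0 < L" and sol: "tracer_solution L \<mu> t0 u g \<theta>" and T: "t0 \<le> T"
  shows "continuous_on {t0..T} (\<lambda>s. low_enstrophy L \<kappa> (\<theta> s))"
  unfolding low_enstrophy_def
  by (intro continuous_on_sum continuous_on_mult continuous_on_add continuous_on_power continuous_on_const
      tracer_coeff_continuous[OF sol periodic_C1_cosw[OF L] T] tracer_coeff_continuous[OF sol periodic_C1_sinw[OF L] T])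

section \<open>Generalised limits\<close>

text \<open>Positivity follows from the domination by limsup, applied to -f.\<close>

lemma hahn_banach_limit_nonneg:
  assumes Lm: "hahn_banach_limit Lm" and f: "Bfun f at_top" and nn: "\<forall>\<^sub>F T in at_top. 0 \<le> f T"
  shows "0 \<le> Lm f"
proof -
  have "Bfun (\<lambda>T. - 1 * f T) at_top" using f by (simp add: Bfun_def)
  then have "ereal (Lm (\<lambda>T. - 1 * f T)) \<le> Limsup at_top (\<lambda>T. ereal (- 1 * f T))"
    using Lm unfolding hahn_banach_limit_def by blast
  also have "\<dots> \<le> ereal 0"
    by (rule Limsup_bounded) (use nn in \<open>auto elim!: eventually_mono\<close>)
  finally have "Lm (\<lambda>T. - 1 * f T) \<le> 0" by simp
  moreover have "Lm (\<lambda>T. - 1 * f T) = - 1 * Lm f"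
    using Lm f unfolding hahn_banach_limit_def by blast
  ultimately show ?thesis by simp
qed

text \<open>Linearity is granted only for functions bounded near infinity, so boundedness is passed
  on together with the value.\<close>

lemma hahn_banach_limit_lincomb:
  assumes Lm: "hahn_banach_limit Lm" and f: "Bfun f at_top" and h: "Bfun h at_top"
  shows "Lm (\<lambda>T. a * f T + b * h T) = a * Lm f + b * Lm h" and "Bfun (\<lambda>T. a * f T + b * h T) at_top"
proof -
  have B: "Bfun (\<lambda>T. c * k T) at_top" if "Bfun k at_top" for c and k :: "real \<Rightarrow> real"
  proof -
    from that obtain K where "\<forall>\<^sub>F T in at_top. norm (k T) \<le> K" unfolding Bfun_def by blast
    then have "\<forall>\<^sub>F T in at_top. norm (c * k T) \<le> \<bar>c\<bar> * K"
      by eventually_elim (simp add: abs_mult mult_left_mono)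
    then show ?thesis by (rule BfunI)
  qed
  show "Lm (\<lambda>T. a * f T + b * h T) = a * Lm f + b * Lm h"
    using Lm B[OF f, of a] B[OF h, of b] f h unfolding hahn_banach_limit_def by simp
  show "Bfun (\<lambda>T. a * f T + b * h T) at_top"
  proof -
    obtain K1 K2 where "\<forall>\<^sub>F T in at_top. norm (a * f T) \<le> K1" "\<forall>\<^sub>F T in at_top. norm (b * h T) \<le> K2"
      using B[OF f, of a] B[OF h, of b] unfolding Bfun_def by blast
    then have "\<forall>\<^sub>F T in at_top. norm (a * f T + b * h T) \<le> K1 + K2"
      by eventually_elim (simp add: abs_le_iff)
    then show ?thesis by (rule BfunI)
  qed
qed

lemma BfunI_ge_1:
  fixes f :: "real \<Rightarrow> real"
  assumes "\<And>T. 1 \<le> T \<Longrightarrow> \<bar>f T\<bar> \<le> K"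
  shows "Bfun f at_top"
proof (rule BfunI)
  show "\<forall>\<^sub>F T in at_top. norm (f T) \<le> K"
    using eventually_ge_at_top[of 1] by eventually_elim (simp add: assms)
qed

section \<open>Averaged balances\<close>

lemma leray_hopf_L2:
  assumes "leray_hopf_solution L \<nu> t0 F u0 u" "t0 \<le> t"
  shows "L2_field L (u t)"
  by (rule L2_field_vec) (use assms in \<open>auto simp: leray_hopf_solution_def energy_class_def\<close>)

lemma leray_hopf_bounded:
  fixes u :: "real \<Rightarrow> real^'n \<Rightarrow> real^'n"
  assumes lh: "leray_hopf_solution L \<nu> t0 F u0 u"
  shows "\<exists>U. \<forall>t\<in>{t0..T}. l2_norm L (u t) \<le> U"
proof -
  have "\<forall>i. \<exists>C. \<forall>t\<in>{t0..T}. l2_norm L (\<lambda>x. u t x $ i) \<le> C"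
    using lh unfolding leray_hopf_solution_def energy_class_def by blast
  from choice[OF this] obtain C where C: "\<forall>i. \<forall>t\<in>{t0..T}. l2_norm L (\<lambda>x. u t x $ i) \<le> C i" ..
  have "l2_norm L (u t) \<le> sqrt (\<Sum>i\<in>UNIV. (C i)\<^sup>2)" if t: "t \<in> {t0..T}" for t
  proof (rule real_le_rsqrt)
    have "L2_field L (u t)" using t by (intro leray_hopf_L2[OF lh]) simp
    then show "(l2_norm L (u t))\<^sup>2 \<le> (\<Sum>i\<in>UNIV. (C i)\<^sup>2)"
      using C t by (simp add: l2_norm_vec_sq sum_mono power_mono l2_norm_nonneg)
  qed
  then show ?thesis by blast
qed

lemma tracer_integral_split:
  fixes f :: "real \<Rightarrow> real"
  assumes f: "integrable (lebesgue_on {a..t}) f" and st: "a \<le> s" "s \<le> t"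
  shows "(LINT r|lebesgue_on {a..t}. f r) - (LINT r|lebesgue_on {a..s}. f r) = (LINT r|lebesgue_on {s..t}. f r)"
  using integral_split_interval[OF f st] by simp

section \<open>Bounds and balances along one tracer solution\<close>

context
  fixes L \<mu> t0 :: real and u :: "real \<Rightarrow> real^'n \<Rightarrow> real^'n" and g :: "real^'n \<Rightarrow> real"
    and \<theta> :: "real \<Rightarrow> real^'n \<Rightarrow> real"
  assumes L: "0 < L" and \<mu>: "0 < \<mu>" and t0: "t0 \<le> 0"
    and g: "L2_field L g"
    and sol: "tracer_solution L \<mu> t0 u g \<theta>"
    and u: "\<And>t. t0 \<le> t \<Longrightarrow> L2_field L (u t)" "\<And>t. t0 \<le> t \<Longrightarrow> div_free L (u t)"
    and uU: "\<And>T. \<exists>U. \<forall>t\<in>{t0..T}. l2_norm L (u t) \<le> U"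
begin

lemma energy_density_integrable:
  assumes "t0 \<le> T"
  shows "integrable (lebesgue_on {t0..T}) (\<lambda>s. l2_inner L g (\<theta> s) - \<mu> * (l2_norm L (grad L (\<theta> s)))\<^sup>2)"
proof -
  obtain U where "\<forall>t\<in>{t0..T}. l2_norm L (u t) \<le> U" using uU by blast
  then show ?thesis by (intro tracer_energy_equality(1)[OF L sol u _ g assms]) auto
qed

lemma energy_increment:
  assumes st: "t0 \<le> s" "s \<le> t"
  shows "(l2_norm L (\<theta> t))\<^sup>2 / 2 - (l2_norm L (\<theta> s))\<^sup>2 / 2 =
    (LINT r|lebesgue_on {s..t}. l2_inner L g (\<theta> r) - \<mu> * (l2_norm L (grad L (\<theta> r)))\<^sup>2)"
proof -
  have t: "t0 \<le> t" using st by simp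
  obtain U where U: "\<And>r. r \<in> {t0..t} \<Longrightarrow> l2_norm L (u r) \<le> U" using uU by blast
  have U': "\<And>r. r \<in> {t0..s} \<Longrightarrow> l2_norm L (u r) \<le> U" using U st by auto
  show ?thesis
    using tracer_energy_equality(2)[OF L sol u U g t] tracer_energy_equality(2)[OF L sol u U' g st(1)]
      tracer_integral_split[OF energy_density_integrable[OF t] st] by linarith
qed

text \<open>Poincare and Young turn the energy equality into a dissipative inequality for
  |\<theta>|^2 / 2: half of the dissipation absorbs the source.\<close>

lemma tracer_norm_bounded:
  shows "\<exists>Y. \<forall>t\<ge>0. (l2_norm L (\<theta> t))\<^sup>2 \<le> Y"
proof -
  let ?y = "\<lambda>t. (l2_norm L (\<theta> t))\<^sup>2 / 2"
  let ?e = "\<lambda>s. l2_inner L g (\<theta> s) - \<mu> * (l2_norm L (grad L (\<theta> s)))\<^sup>2"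
  \<comment> \<open>The decay rate supplied by diffusion: \<mu> times the Poincare constant.\<close>
  define c where "c = \<mu> * (2 * pi / L)\<^sup>2"
  have c: "0 < c" using L \<mu> by (simp add: c_def)
  have "?y t \<le> max (?y 0) ((l2_norm L g)\<^sup>2 / (2 * c) / c)" if t: "0 \<le> t" for t
  proof (rule dissipative_bound[where e="?e"])
    show "?y t - ?y s = (LINT r|lebesgue_on {s..t}. ?e r)" if "0 \<le> s" "s \<le> t" for s t
      by (rule energy_increment) (use that t0 in auto)
    show "continuous_on {0..T} ?y" if T: "0 \<le> T" for T
    proof -
      have "t0 \<le> T" using T t0 by simp
      then have "continuous_on {0..T} (\<lambda>t. ?y t0 + (LINT r|lebesgue_on {t0..t}. ?e r))"
        using continuous_on_subset[OF indefinite_integral_continuous_real[OF energy_density_integrable[of T]], of "{0..T}"] t0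
        by (intro continuous_on_add continuous_on_const) auto
      moreover have "?y t0 + (LINT r|lebesgue_on {t0..t}. ?e r) = ?y t" if "t \<in> {0..T}" for t
        using energy_increment[of t0 t] that t0 by simp
      ultimately show ?thesis by (rule continuous_on_eq)
    qed
    show "AE r in lebesgue_on {0..T}. ?e r \<le> (l2_norm L g)\<^sup>2 / (2 * c) - c * ?y r" if T: "0 \<le> T" for T
    proof -
      have "AE r in lebesgue_on {0..T}. t0 \<le> r \<and> in_H1 L (\<theta> r)"
        by (rule AE_subinterval[OF tracer_solution_H1[OF sol]]) (use t0 in auto)
      then show ?thesis
      proof eventually_elim
        case (elim r)
        then have G: "weak_gradient L (\<theta> r) (grad L (\<theta> r))" and \<theta>: "L2_field L (\<theta> r)" and mz: "mean_zero L (\<theta> r)"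
          using weak_gradient_grad tracer_solution_L2[OF sol] sol by (auto simp: tracer_solution_def)
        define a b where "a = l2_norm L g" and "b = l2_norm L (\<theta> r)"
        have 1: "c * b\<^sup>2 \<le> \<mu> * (l2_norm L (grad L (\<theta> r)))\<^sup>2"
          unfolding c_def b_def mult.assoc using Poincare_mean_zero[OF L G mz] \<mu> by (intro mult_left_mono) auto
        have 2: "l2_inner L g (\<theta> r) \<le> a * b"
          unfolding a_def b_def using l2_inner_Cauchy_Schwarz[OF g \<theta>] by linarith
        \<comment> \<open>Young's inequality, weighted so that exactly half of c b^2 is used
          up.\<close>
        have "0 \<le> (a - c * b)\<^sup>2 / (2 * c)" using c by simp
        also have "\<dots> = a\<^sup>2 / (2 * c) - a * b + c * b\<^sup>2 / 2"
          using c by (simp add: power2_eq_square field_simps)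
        finally have 3: "a * b \<le> a\<^sup>2 / (2 * c) + c * b\<^sup>2 / 2" by simp
        have "l2_inner L g (\<theta> r) - \<mu> * (l2_norm L (grad L (\<theta> r)))\<^sup>2 \<le> a\<^sup>2 / (2 * c) - c * (b\<^sup>2 / 2)"
          using 1 2 3 by simp
        then show ?case by (simp only: a_def b_def)
      qed
    qed
  qed (use c t in auto)
  then have "(l2_norm L (\<theta> t))\<^sup>2 \<le> 2 * max (?y 0) ((l2_norm L g)\<^sup>2 / (2 * c) / c)" if "0 \<le> t" for t
    using that by fastforce
  then show ?thesis by blast
qed

text \<open>The balance of \<theta>^<, obtained with \<beta>(s) = s^2 / 2, is compared with the full
  energy balance. Both contain the same source term (g, \<theta>); eliminating it leaves flux,
  dissipation and boundary terms.\<close>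

lemma low_mode_balance:
  fixes \<kappa> \<kappa>g :: real
  assumes umz: "\<And>t. t0 \<le> t \<Longrightarrow> mean_zero L (u t)"
    and gmz: "mean_zero L g" and le: "\<kappa>g \<le> \<kappa>" and band: "AE x in Omega L. g x = part L (2 * pi / L) \<kappa>g g x"
    and T: "0 \<le> T"
  shows "L ^ CARD('n) * (LINT s|lebesgue_on {0..T}. tracer_flux L \<kappa> (u s) (\<theta> s)) =
      \<mu> * (LINT s|lebesgue_on {0..T}. (l2_norm L (grad L (\<theta> s)))\<^sup>2)
      - \<mu> * (LINT s|lebesgue_on {0..T}. low_enstrophy L \<kappa> (\<theta> s))
      + ((l2_norm L (\<theta> T))\<^sup>2 / 2 - (l2_norm L (\<theta> 0))\<^sup>2 / 2)
      - ((l2_norm L (low_pass L \<kappa> (\<theta> T)))\<^sup>2 / 2 - (l2_norm L (low_pass L \<kappa> (\<theta> 0)))\<^sup>2 / 2)"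
proof -
  let ?G = "\<lambda>s. grad L (\<theta> s)" and ?P = "low_pass L \<kappa>" and ?n = "L ^ CARD('n)"
  have t0T: "t0 \<le> T" using T t0 by simp
  have DERIV_half_sq: "((\<lambda>s. s\<^sup>2 / 2) has_real_derivative s) (at s)" for s :: real
    by (auto intro!: derivative_eq_intros)
  have half_sq: "(LINT x|Omega L. (?P \<phi> x)\<^sup>2 / 2) = (l2_norm L (?P \<phi>))\<^sup>2 / 2" for \<phi>
    by (simp add: l2_norm_def)
  have bal: "\<exists>R. integrable (lebesgue_on {t0..t}) R \<and>
      (AE s in lebesgue_on {t0..t}. R s = l2_inner L g (\<theta> s) - \<mu> * low_enstrophy L \<kappa> (\<theta> s) - ?n * tracer_flux L \<kappa> (u s) (\<theta> s)) \<and>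
      (l2_norm L (?P (\<theta> t)))\<^sup>2 / 2 = (l2_norm L (?P (\<theta> t0)))\<^sup>2 / 2 + (LINT s|lebesgue_on {t0..t}. R s)"
    if t: "t0 \<le> t" for t
  proof (rule multiplier_energy[OF L sol u(1) g low_modes_even_weights[OF L, of \<kappa>] _ DERIV_half_sq _ _ t, where K=1])
    fix R
    assume R: "integrable (lebesgue_on {t0..t}) R"
      and ae: "AE s in lebesgue_on {t0..t}. R s = tracer_rhs L \<mu> (u s) g (?G s)
        (fmult L (low_modes L \<kappa>) (\<lambda>_. 1) (fmult L (low_modes L \<kappa>) (\<lambda>_. 1) (\<theta> s)))
        (fmult_grad L (low_modes L \<kappa>) (\<lambda>_. 1) (fmult L (low_modes L \<kappa>) (\<lambda>_. 1) (\<theta> s)))"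
      and eq: "(LINT x|Omega L. (fmult L (low_modes L \<kappa>) (\<lambda>_. 1) (\<theta> t) x)\<^sup>2 / 2) =
        (LINT x|Omega L. (fmult L (low_modes L \<kappa>) (\<lambda>_. 1) (\<theta> t0) x)\<^sup>2 / 2) + (LINT s|lebesgue_on {t0..t}. R s)"
    have "AE s in lebesgue_on {t0..t}. R s = l2_inner L g (\<theta> s) - \<mu> * low_enstrophy L \<kappa> (\<theta> s) - ?n * tracer_flux L \<kappa> (u s) (\<theta> s)"
      using ae tracer_solution_H1[OF sol, of t]
    proof eventually_elim
      case (elim s)
      then have s: "t0 \<le> s" and H1: "in_H1 L (\<theta> s)" by auto
      have G: "weak_gradient L (\<theta> s) (?G s)" by (rule weak_gradient_grad[OF H1])
      have \<theta>: "L2_field L (\<theta> s)" by (rule tracer_solution_L2[OF sol s])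
      have mz: "mean_zero L (\<theta> s)" using sol s by (auto simp: tracer_solution_def)
      have flux: "?n * tracer_flux L \<kappa> (u s) (\<theta> s) = l2_inner L (\<lambda>x. u s x \<bullet> ?G s x) (?P (\<theta> s))"
        using tracer_flux_eq[OF L u(1)[OF s] umz[OF s] u(2)[OF s] H1 mz] L by simp
      have "R s = l2_inner L g (?P (?P (\<theta> s))) - \<mu> * l2_inner L (?G s) (low_pass_grad L \<kappa> (?P (\<theta> s)))
          - l2_inner L (\<lambda>x. u s x \<bullet> ?G s x) (?P (?P (\<theta> s)))"
        using elim(1) unfolding tracer_rhs_def low_pass_def low_pass_grad_def .
      then show ?case
        unfolding low_pass_idem[OF L] low_pass_dissipation[OF L G]
          l2_inner_low_pass_source[OF L g gmz \<theta> le band] flux .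
    qed
    moreover have "(l2_norm L (?P (\<theta> t)))\<^sup>2 / 2 = (l2_norm L (?P (\<theta> t0)))\<^sup>2 / 2 + (LINT s|lebesgue_on {t0..t}. R s)"
      using eq unfolding low_pass_def[symmetric] half_sq .
    ultimately show ?thesis using R by blast
  qed auto
  obtain R where R: "integrable (lebesgue_on {t0..T}) R"
    "AE s in lebesgue_on {t0..T}. R s = l2_inner L g (\<theta> s) - \<mu> * low_enstrophy L \<kappa> (\<theta> s) - ?n * tracer_flux L \<kappa> (u s) (\<theta> s)"
    "(l2_norm L (?P (\<theta> T)))\<^sup>2 / 2 = (l2_norm L (?P (\<theta> t0)))\<^sup>2 / 2 + (LINT s|lebesgue_on {t0..T}. R s)"
    using bal[OF t0T] by blast
  \<comment> \<open>Balances start at t0 while averages start at 0. A second balance up to time 0 is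
    subtracted; its integrand agrees almost everywhere with the restriction of R.\<close>
  obtain R0 where R0: "integrable (lebesgue_on {t0..0}) R0"
    "AE s in lebesgue_on {t0..0}. R0 s = l2_inner L g (\<theta> s) - \<mu> * low_enstrophy L \<kappa> (\<theta> s) - ?n * tracer_flux L \<kappa> (u s) (\<theta> s)"
    "(l2_norm L (?P (\<theta> 0)))\<^sup>2 / 2 = (l2_norm L (?P (\<theta> t0)))\<^sup>2 / 2 + (LINT s|lebesgue_on {t0..0}. R0 s)"
    using bal[OF t0] by blast
  have sub: "{t0..0} \<subseteq> {t0..T}" "{0..T} \<subseteq> {t0..T}" using T t0 by auto
  have "(LINT s|lebesgue_on {t0..0}. R0 s) = (LINT s|lebesgue_on {t0..0}. R s)"
  proof (rule integrable_lebesgue_on_AE_cong(2)[OF integrable_on_subinterval[OF R(1) sub(1)]])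
    show "AE s in lebesgue_on {t0..0}. R0 s = R s"
      using R0(2) AE_subinterval[OF R(2) sub(1)] by eventually_elim simp
  qed
  then have incr: "(l2_norm L (?P (\<theta> T)))\<^sup>2 / 2 - (l2_norm L (?P (\<theta> 0)))\<^sup>2 / 2 = (LINT s|lebesgue_on {0..T}. R s)"
    unfolding R(3) R0(3) tracer_integral_split[OF R(1) t0 T, symmetric] by simp
  have Ri: "integrable (lebesgue_on {0..T}) R" by (rule integrable_on_subinterval[OF R(1) sub(2)])
  have Gi: "integrable (lebesgue_on {0..T}) (\<lambda>s. (l2_norm L (?G s))\<^sup>2)"
    by (rule integrable_on_subinterval[OF tracer_grad_integrable[OF sol] sub(2)])
  have ei: "integrable (lebesgue_on {0..T}) (\<lambda>s. l2_inner L g (\<theta> s) - \<mu> * (l2_norm L (?G s))\<^sup>2)"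
    by (rule integrable_on_subinterval[OF energy_density_integrable[OF t0T] sub(2)])
  have qi: "integrable (lebesgue_on {0..T}) (\<lambda>s. low_enstrophy L \<kappa> (\<theta> s))"
    by (rule integrable_on_subinterval[OF continuous_imp_integrable_real[OF low_enstrophy_continuous[OF L sol t0T]] sub(2)])
  \<comment> \<open>The identity for R solved for the flux, with (g, \<theta>) split so that every
    summand is already known to be integrable.\<close>
  let ?f = "\<lambda>s. (l2_inner L g (\<theta> s) - \<mu> * (l2_norm L (?G s))\<^sup>2) + \<mu> * (l2_norm L (?G s))\<^sup>2 - \<mu> * low_enstrophy L \<kappa> (\<theta> s) - R s"
  have fi: "integrable (lebesgue_on {0..T}) (\<lambda>s. 1 / ?n * ?f s)"
    by (intro integrable_mult_right Bochner_Integration.integrable_diff Bochner_Integration.integrable_add ei Gi qi Ri)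
  have "(LINT s|lebesgue_on {0..T}. tracer_flux L \<kappa> (u s) (\<theta> s)) = (LINT s|lebesgue_on {0..T}. 1 / ?n * ?f s)"
  proof (rule integrable_lebesgue_on_AE_cong(2)[OF fi])
    show "AE s in lebesgue_on {0..T}. tracer_flux L \<kappa> (u s) (\<theta> s) = 1 / ?n * ?f s"
      using AE_subinterval[OF R(2) sub(2)]
    proof eventually_elim
      case (elim s)
      have "?f s = ?n * tracer_flux L \<kappa> (u s) (\<theta> s)" unfolding elim by simp
      then show ?case using L by simp
    qed
  qed
  also have "\<dots> = 1 / ?n * (LINT s|lebesgue_on {0..T}. ?f s)" by (rule integral_mult_right_zero)
  also have "(LINT s|lebesgue_on {0..T}. ?f s)
      = (LINT s|lebesgue_on {0..T}. l2_inner L g (\<theta> s) - \<mu> * (l2_norm L (?G s))\<^sup>2)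
        + \<mu> * (LINT s|lebesgue_on {0..T}. (l2_norm L (?G s))\<^sup>2)
        - \<mu> * (LINT s|lebesgue_on {0..T}. low_enstrophy L \<kappa> (\<theta> s)) - (LINT s|lebesgue_on {0..T}. R s)"
    by (simp only: Bochner_Integration.integral_diff Bochner_Integration.integral_add integral_mult_right_zero
        Bochner_Integration.integrable_diff Bochner_Integration.integrable_add integrable_mult_right ei Gi qi Ri)
  finally show ?thesis
    using L energy_increment[OF t0 T] incr by simp
qed

text \<open>The energy balance over [0, T] bounds the total dissipation by the source work plus the
  initial energy; T at least 1 makes the latter at most Y T.\<close>

lemma dissipation_mean_bounded:
  assumes Y: "\<And>t. 0 \<le> t \<Longrightarrow> (l2_norm L (\<theta> t))\<^sup>2 \<le> Y" and T: "1 \<le> T"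
  shows "1 / T * (LINT s|lebesgue_on {0..T}. (l2_norm L (grad L (\<theta> s)))\<^sup>2) \<le> (l2_norm L g * sqrt Y + Y) / \<mu>"
    and "1 / T * (LINT s|lebesgue_on {0..T}. (l2_norm L (\<theta> s))\<^sup>2) \<le> Y"
proof -
  have T0: "0 \<le> T" and t0T: "t0 \<le> T" using T t0 by auto
  have Y0: "0 \<le> Y" using Y[of 0] by (meson order_refl order_trans zero_le_power2)
  have sub: "{0..T} \<subseteq> {t0..T}" using t0 by auto
  have Gi: "integrable (lebesgue_on {0..T}) (\<lambda>s. (l2_norm L (grad L (\<theta> s)))\<^sup>2)"
    by (rule integrable_on_subinterval[OF tracer_grad_integrable[OF sol] sub])
  have ei: "integrable (lebesgue_on {0..T}) (\<lambda>s. l2_inner L g (\<theta> s) - \<mu> * (l2_norm L (grad L (\<theta> s)))\<^sup>2)"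
    by (rule integrable_on_subinterval[OF energy_density_integrable[OF t0T] sub])
  have gi: "integrable (lebesgue_on {0..T}) (\<lambda>s. l2_inner L g (\<theta> s))"
    using Bochner_Integration.integrable_add[OF ei integrable_mult_right[OF Gi, of \<mu>]] by simp
  have ci: "integrable (lebesgue_on {0..T}) (\<lambda>s. c)" and cv: "(LINT s|lebesgue_on {0..T}. c) = T * c" for c :: real
    using T0 by (auto simp: measure_restrict_space intro: continuous_imp_integrable_real)
  have "(LINT s|lebesgue_on {0..T}. l2_inner L g (\<theta> s)) \<le> (LINT s|lebesgue_on {0..T}. l2_norm L g * sqrt Y)"
  proof (rule integral_mono[OF gi ci])
    fix s assume "s \<in> space (lebesgue_on {0..T})"
    then have s: "0 \<le> s" by simp
    have "l2_norm L (\<theta> s) \<le> sqrt Y" by (rule real_le_rsqrt[OF Y[OF s]])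
    moreover have "L2_field L (\<theta> s)" using s t0 by (intro tracer_solution_L2[OF sol]) simp
    ultimately show "l2_inner L g (\<theta> s) \<le> l2_norm L g * sqrt Y"
      using l2_inner_Cauchy_Schwarz[OF g, of "\<theta> s"] mult_left_mono[of "l2_norm L (\<theta> s)" "sqrt Y" "l2_norm L g"] l2_norm_nonneg[of L g]
      by linarith
  qed
  moreover have "(LINT s|lebesgue_on {0..T}. l2_inner L g (\<theta> s)) - \<mu> * (LINT s|lebesgue_on {0..T}. (l2_norm L (grad L (\<theta> s)))\<^sup>2)
      = (l2_norm L (\<theta> T))\<^sup>2 / 2 - (l2_norm L (\<theta> 0))\<^sup>2 / 2"
    unfolding energy_increment[OF t0 T0]
    by (simp only: Bochner_Integration.integral_diff[OF gi integrable_mult_right[OF Gi]] integral_mult_right_zero)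
  moreover have "(l2_norm L (\<theta> 0))\<^sup>2 / 2 \<le> Y * T"
  proof -
    have "(l2_norm L (\<theta> 0))\<^sup>2 / 2 \<le> Y" using Y[of 0] Y0 by simp
    also have "\<dots> \<le> Y * T" using mult_left_mono[OF T Y0] by simp
    finally show ?thesis .
  qed
  ultimately have "\<mu> * (LINT s|lebesgue_on {0..T}. (l2_norm L (grad L (\<theta> s)))\<^sup>2) \<le> T * (l2_norm L g * sqrt Y) + Y * T"
    unfolding cv using zero_le_power2[of "l2_norm L (\<theta> T)"] by linarith
  then show "1 / T * (LINT s|lebesgue_on {0..T}. (l2_norm L (grad L (\<theta> s)))\<^sup>2) \<le> (l2_norm L g * sqrt Y + Y) / \<mu>"
    using \<mu> T by (simp add: field_simps)
  have "(LINT s|lebesgue_on {0..T}. (l2_norm L (\<theta> s))\<^sup>2) \<le> T * Y"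
  proof (cases "integrable (lebesgue_on {0..T}) (\<lambda>s. (l2_norm L (\<theta> s))\<^sup>2)")
    case True
    have "(LINT s|lebesgue_on {0..T}. (l2_norm L (\<theta> s))\<^sup>2) \<le> (LINT s|lebesgue_on {0..T}. Y)"
      by (rule integral_mono[OF True ci]) (simp add: Y)
    then show ?thesis by (simp only: cv)
  next
    \<comment> \<open>The integral of a function that is not integrable is 0 by convention.\<close>
    case False
    then show ?thesis using Y0 T0 by (simp add: not_integrable_integral_eq)
  qed
  then show "1 / T * (LINT s|lebesgue_on {0..T}. (l2_norm L (\<theta> s))\<^sup>2) \<le> Y"
    using T by (simp add: field_simps)
qed

text \<open>By the energy equality |\<theta>|^2 differs from a constant by an indefinite integral,
  so it is continuous in time. For negative T the interval is empty.\<close>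

lemma tracer_norm_sq_integrable:
  "integrable (lebesgue_on {0..T}) (\<lambda>s. (l2_norm L (\<theta> s))\<^sup>2)"
proof (cases "0 \<le> T")
  case True
  then have T: "t0 \<le> T" using t0 by simp
  let ?e = "\<lambda>s. l2_inner L g (\<theta> s) - \<mu> * (l2_norm L (grad L (\<theta> s)))\<^sup>2"
  have "continuous_on {0..T} (\<lambda>t. (l2_norm L (\<theta> t0))\<^sup>2 + 2 * (LINT r|lebesgue_on {t0..t}. ?e r))"
    using continuous_on_subset[OF indefinite_integral_continuous_real[OF energy_density_integrable[OF T]], of "{0..T}"] t0
    by (intro continuous_on_add continuous_on_mult continuous_on_const) auto
  then have "continuous_on {0..T} (\<lambda>s. (l2_norm L (\<theta> s))\<^sup>2)"
  proof (rule continuous_on_eq)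
    show "(l2_norm L (\<theta> t0))\<^sup>2 + 2 * (LINT r|lebesgue_on {t0..t}. ?e r) = (l2_norm L (\<theta> t))\<^sup>2" if "t \<in> {0..T}" for t
      using energy_increment[of t0 t] that t0 by simp
  qed
  then show ?thesis by (rule continuous_imp_integrable_real)
qed (simp add: integrable_restrict_space)

end

theorem mainTheorem3:
  fixes L \<nu> \<mu> t0 \<kappa>g \<kappa> :: real
    and F u :: "real \<Rightarrow> real^'n \<Rightarrow> real^'n"
    and u0 :: "real^'n \<Rightarrow> real^'n"
    and g :: "real^'n \<Rightarrow> real"
    and \<theta> :: "real \<Rightarrow> real^'n \<Rightarrow> real"
    and Lm :: "(real \<Rightarrow> real) \<Rightarrow> real"
  assumes "CARD('n) \<in> {2, 3}"
    and "0 < L" and "0 < \<nu>" and "0 < \<mu>" and "t0 \<le> 0"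
    and "leray_hopf_solution L \<nu> t0 F u0 u"
    and "L2_field L g" and "mean_zero L g"
    and "2 * pi / L < \<kappa>g"
    and "AE x in Omega L. g x = part L (2 * pi / L) \<kappa>g g x"
    and "tracer_solution L \<mu> t0 u g \<theta>"
    and "hahn_banach_limit Lm"
    and "\<kappa>g \<le> \<kappa>" and "\<kappa> \<le> tracer_wavenumber L Lm \<theta>"
  shows "1 - (\<kappa> / tracer_wavenumber L Lm \<theta>)\<^sup>2
           \<le> time_avg Lm (\<lambda>t. tracer_flux L \<kappa> (u t) (\<theta> t)) / tracer_chi L \<mu> Lm \<theta>
       \<and> time_avg Lm (\<lambda>t. tracer_flux L \<kappa> (u t) (\<theta> t)) / tracer_chi L \<mu> Lm \<theta> \<le> 1"
proof -
  note L = assms(2) and \<mu> = assms(4) and t0 = assms(5) and lh = assms(6) and g = assms(7) and sol = assms(11)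
    and Lm = assms(12)
  have u: "\<And>t. t0 \<le> t \<Longrightarrow> L2_field L (u t)" "\<And>t. t0 \<le> t \<Longrightarrow> div_free L (u t)" "\<And>t. t0 \<le> t \<Longrightarrow> mean_zero L (u t)"
    using leray_hopf_L2[OF lh] lh by (auto simp: leray_hopf_solution_def)
  note uU = leray_hopf_bounded[OF lh]
  note setting = L \<mu> t0 g sol u(1) u(2) uU
  have \<kappa>0: "0 < \<kappa>" using assms(9,13) L by (meson divide_pos_pos less_le_trans less_trans mult_pos_pos pi_gt_zero zero_less_numeral)
  obtain Y where Y: "\<And>t. 0 \<le> t \<Longrightarrow> (l2_norm L (\<theta> t))\<^sup>2 \<le> Y" using tracer_norm_bounded[OF setting] by blast
  have Y0: "0 \<le> Y" using Y[of 0] by (meson order_refl order_trans zero_le_power2)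
  let ?n = "L ^ CARD('n)"
  \<comment> \<open>Time means as functions of T. Bounds are proved for T at least 1, which suffices
    for boundedness near infinity.\<close>
  define mean where "mean f T = 1 / T * (LINT s|lebesgue_on {0..T}. f s)" for f :: "real \<Rightarrow> real" and T
  define A where "A = mean (\<lambda>s. (l2_norm L (grad L (\<theta> s)))\<^sup>2)"
  define B where "B = mean (\<lambda>s. (l2_norm L (\<theta> s))\<^sup>2)"
  define Q where "Q = mean (\<lambda>s. low_enstrophy L \<kappa> (\<theta> s))"
  define Fl where "Fl = mean (\<lambda>s. tracer_flux L \<kappa> (u s) (\<theta> s))"
  have mean_nonneg: "0 \<le> mean f T" if "1 \<le> T" "\<And>s. 0 \<le> f s" for f T
    unfolding mean_def using that by (intro mult_nonneg_nonneg integral_nonneg_AE) auto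
  have A0: "0 \<le> A T" and B0: "0 \<le> B T" and Q0: "0 \<le> Q T" if "1 \<le> T" for T
    unfolding A_def B_def Q_def using that low_enstrophy_nonneg[OF L] by (intro mean_nonneg; simp)+
  have QB: "Q T \<le> \<kappa>\<^sup>2 * B T" if T: "1 \<le> T" for T
  proof -
    have "(LINT s|lebesgue_on {0..T}. low_enstrophy L \<kappa> (\<theta> s)) \<le> (LINT s|lebesgue_on {0..T}. \<kappa>\<^sup>2 * (l2_norm L (\<theta> s))\<^sup>2)"
    proof (rule integral_mono)
      have "t0 \<le> T" using T t0 by simp
      then show "integrable (lebesgue_on {0..T}) (\<lambda>s. low_enstrophy L \<kappa> (\<theta> s))"
        using integrable_on_subinterval[OF continuous_imp_integrable_real[OF low_enstrophy_continuous[OF L sol]], of T 0 T] t0 by auto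
      show "integrable (lebesgue_on {0..T}) (\<lambda>s. \<kappa>\<^sup>2 * (l2_norm L (\<theta> s))\<^sup>2)"
        by (intro integrable_mult_right tracer_norm_sq_integrable[OF setting])
      fix s assume "s \<in> space (lebesgue_on {0..T})"
      then have "t0 \<le> s" using t0 by simp
      then show "low_enstrophy L \<kappa> (\<theta> s) \<le> \<kappa>\<^sup>2 * (l2_norm L (\<theta> s))\<^sup>2"
        by (intro low_enstrophy_le L tracer_solution_L2[OF sol])
    qed
    from mult_left_mono[OF this, of "1 / T"] T show ?thesis
      by (simp add: Q_def B_def mean_def)
  qed
  have BA: "Bfun A at_top"
  proof (rule BfunI_ge_1)
    show "\<bar>A T\<bar> \<le> (l2_norm L g * sqrt Y + Y) / \<mu>" if "1 \<le> T" for T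
      using dissipation_mean_bounded(1)[OF setting Y that] A0[OF that] by (simp add: A_def mean_def)
  qed
  have BB: "Bfun B at_top"
  proof (rule BfunI_ge_1)
    show "\<bar>B T\<bar> \<le> Y" if "1 \<le> T" for T
      using dissipation_mean_bounded(2)[OF setting Y that] B0[OF that] by (simp add: B_def mean_def)
  qed
  have BQ: "Bfun Q at_top"
  proof (rule BfunI_ge_1)
    show "\<bar>Q T\<bar> \<le> \<kappa>\<^sup>2 * Y" if "1 \<le> T" for T
    proof -
      have "B T \<le> Y" using dissipation_mean_bounded(2)[OF setting Y that] by (simp add: B_def mean_def)
      then show ?thesis using QB[OF that] Q0[OF that] mult_left_mono[of "B T" Y "\<kappa>\<^sup>2"] by simp
    qed
  qed
  \<comment> \<open>The defect of the averaged balance consists of the boundary terms alone, crudely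
    at most 2 Y / L^d, divided by T; every generalised limit maps it to 0.\<close>
  define d where "d T = Fl T - (\<mu> / ?n * A T + (- \<mu> / ?n) * Q T)" for T
  have d_eq: "\<bar>d T\<bar> \<le> 2 * Y / ?n / T" if T: "1 \<le> T" for T
  proof -
    let ?y = "\<lambda>t. (l2_norm L (\<theta> t))\<^sup>2" and ?z = "\<lambda>t. (l2_norm L (low_pass L \<kappa> (\<theta> t)))\<^sup>2"
    have T0: "0 \<le> T" using T by simp
    note bal = low_mode_balance[OF setting u(3) assms(8,13,10) T0]
    have "?n * T * d T = ?n * (LINT s|lebesgue_on {0..T}. tracer_flux L \<kappa> (u s) (\<theta> s))
        - \<mu> * (LINT s|lebesgue_on {0..T}. (l2_norm L (grad L (\<theta> s)))\<^sup>2) + \<mu> * (LINT s|lebesgue_on {0..T}. low_enstrophy L \<kappa> (\<theta> s))"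
      using T L by (simp add: d_def A_def Q_def Fl_def mean_def field_simps)
    also have "\<dots> = (?y T / 2 - ?y 0 / 2) - (?z T / 2 - ?z 0 / 2)" using bal by linarith
    finally have eq: "?n * T * d T = (?y T / 2 - ?y 0 / 2) - (?z T / 2 - ?z 0 / 2)" .
    have "?z t \<le> ?y t" if "0 \<le> t" for t
      using that t0 by (intro power_mono l2_norm_low_pass_le L tracer_solution_L2[OF sol] l2_norm_nonneg) auto
    then have "?z T \<le> Y" "?z 0 \<le> Y" using Y[of T] Y[of 0] T0 by (meson order_refl order_trans)+
    moreover have "0 \<le> ?z T" "0 \<le> ?z 0" "0 \<le> ?y T" "0 \<le> ?y 0" by simp_all
    ultimately have "\<bar>?n * T * d T\<bar> \<le> 2 * Y"
      unfolding eq using Y[OF T0] Y[of 0] by linarith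
    moreover have "\<bar>?n * T * d T\<bar> = ?n * T * \<bar>d T\<bar>" using T L by (simp add: abs_mult)
    ultimately show ?thesis using T L by (simp add: field_simps)
  qed
  have d_lim: "(d \<longlongrightarrow> 0) at_top"
  proof (rule Lim_null_comparison)
    show "\<forall>\<^sub>F T in at_top. norm (d T) \<le> 2 * Y / ?n / T"
      using eventually_ge_at_top[of 1] by eventually_elim (simp only: real_norm_def d_eq)
    show "((\<lambda>T. 2 * Y / ?n / T) \<longlongrightarrow> 0) at_top"
      by (rule real_tendsto_divide_at_top[OF tendsto_const filterlim_ident])
  qed
  have Bd: "Bfun d at_top"
  proof (rule BfunI_ge_1)
    show "\<bar>d T\<bar> \<le> 2 * Y / ?n" if "1 \<le> T" for T
    proof -
      have "2 * Y / ?n / T \<le> 2 * Y / ?n / 1" using that Y0 L by (intro divide_left_mono) auto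
      then show ?thesis using d_eq[OF that] by simp
    qed
  qed
  have "Lm d = 0" using Lm d_lim by (auto simp: hahn_banach_limit_def)
  note lc = hahn_banach_limit_lincomb[OF Lm]
  have "Lm Fl = Lm (\<lambda>T. 1 * (\<mu> / ?n * A T + (- \<mu> / ?n) * Q T) + 1 * d T)"
    by (rule arg_cong[where f=Lm]) (simp add: d_def fun_eq_iff)
  also have "\<dots> = \<mu> / ?n * Lm A - \<mu> / ?n * Lm Q"
    using lc(1)[OF lc(2)[OF BA BQ] Bd, of 1 "\<mu> / ?n" "- \<mu> / ?n" 1] lc(1)[OF BA BQ, of "\<mu> / ?n" "- \<mu> / ?n"] \<open>Lm d = 0\<close>
    by simp
  finally have flux: "Lm Fl = \<mu> / ?n * Lm A - \<mu> / ?n * Lm Q" .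
  have ev: "\<forall>\<^sub>F T in at_top. P T" if "\<And>T::real. 1 \<le> T \<Longrightarrow> P T" for P
    using eventually_ge_at_top[of 1] by eventually_elim (rule that)
  have a0: "0 \<le> Lm A" by (rule hahn_banach_limit_nonneg[OF Lm BA ev[OF A0]])
  have q0: "0 \<le> Lm Q" by (rule hahn_banach_limit_nonneg[OF Lm BQ ev[OF Q0]])
  have "0 \<le> Lm (\<lambda>T. \<kappa>\<^sup>2 * B T + (- 1) * Q T)"
    by (rule hahn_banach_limit_nonneg[OF Lm lc(2)[OF BB BQ] ev]) (use QB in simp)
  then have qb: "Lm Q \<le> \<kappa>\<^sup>2 * Lm B" using lc(1)[OF BB BQ, of "\<kappa>\<^sup>2" "- 1"] by simp
  have avg: "time_avg Lm f = Lm (mean f)" for f by (simp add: time_avg_def mean_def[abs_def])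
  have wn: "tracer_wavenumber L Lm \<theta> = sqrt (Lm A / Lm B)"
    by (simp add: tracer_wavenumber_def avg A_def B_def)
  have chi: "tracer_chi L \<mu> Lm \<theta> = \<mu> / ?n * Lm A" by (simp add: tracer_chi_def avg A_def)
  \<comment> \<open>A wavenumber that is at least \<kappa> > 0 forces the quotient under the root to
    be positive. Hence neither average vanishes and the divisions below are genuine.\<close>
  have "0 < Lm A / Lm B"
    using less_le_trans[OF \<kappa>0 assms(14)] unfolding wn by (rule real_sqrt_gt_0_iff[THEN iffD1])
  with a0 have a: "0 < Lm A" and b: "0 < Lm B" by (auto simp: zero_less_divide_iff)
  have ratio: "time_avg Lm (\<lambda>t. tracer_flux L \<kappa> (u t) (\<theta> t)) / tracer_chi L \<mu> Lm \<theta> = 1 - Lm Q / Lm A"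
    unfolding avg chi Fl_def[symmetric] flux right_diff_distrib[symmetric]
    using \<mu> L a by (simp add: diff_divide_distrib)
  have "(\<kappa> / tracer_wavenumber L Lm \<theta>)\<^sup>2 = \<kappa>\<^sup>2 * Lm B / Lm A"
    unfolding wn power_divide using a b by simp
  moreover have "Lm Q / Lm A \<le> \<kappa>\<^sup>2 * Lm B / Lm A" using qb a by (intro divide_right_mono) auto
  moreover have "0 \<le> Lm Q / Lm A" using q0 a by simp
  ultimately show ?thesis unfolding ratio by simp
qed

end
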